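(* Let $H$ be a bialgebra, let $\{\mathcal R^{(c)}\}_{c\in C}\subset\operatorname{Hom}_\Bbbk(H\otimes H,\Bbbk)$ be a family of co-quasi-triangular structures on $H$, let $n\ge2$, and let $\mathbf c:\{(i,j):1\le i<j\le n\}\to C$. Define $\mathcal J_{\mathbf c}\in\operatorname{Hom}_\Bbbk(H^{\otimes2n},\Bbbk)$ as the convolution product $$\mathcal J_{\mathbf c}=\mathcal R^{(\mathbf c(1,2))}_{2,n+1}*\big(\mathcal R^{(\mathbf c(2,3))}_{3,n+2}*\mathcal R^{(\mathbf c(1,3))}_{3,n+1}\big)*\cdots*\big(\mathcal R^{(\mathbf c(n-1,n))}_{n,2n-1}*\cdots*\mathcal R^{(\mathbf c(1,n))}_{n,n+1}\big)$$ (for $i=2,\dots,n$ in increasing order, and for each $i$ the factors $\mathcal R^{(\mathbf c(j,i))}_{i,n+j}$ with $j=i-1,\dots,1$ in decreasing order). If $\mathbf c$ is transitive, then $\mathcal J_{\mathbf c}$, viewed as an element of $\operatorname{Hom}_\Bbbk(H^{\otimes n}\otimes H^{\otimes n},\Bbbk)$, is a dual Drinfeld twist for the bialgebra $H^{\otimes n}$.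
   Context: $\Bbbk$ is a field of characteristic zero; Sweedler notation is used. For a coalgebra $D$, the convolution on $\operatorname{Hom}_\Bbbk(D,\Bbbk)$ is $(f*g)(d)=f(d_{(1)})g(d_{(2)})$, with unit $\varepsilon$; tensor powers $H^{\otimes N}$ carry the standard tensor product coalgebra (and algebra) structure. For $f\in\operatorname{Hom}_\Bbbk(H^{\otimes r},\Bbbk)$ and distinct $i_1,\dots,i_r\in\{1,\dots,N\}$, $f_{i_1,\dots,i_r}\in\operatorname{Hom}_\Bbbk(H^{\otimes N},\Bbbk)$ is $f_{i_1,\dots,i_r}(h_1\otimes\cdots\otimes h_N)=f(h_{i_1}\otimes\cdots\otimes h_{i_r})\prod_{j\notin\{i_1,\dots,i_r\}}\varepsilon(h_j)$. A co-quasi-triangular structure on a bialgebra $B$ with multiplication $m_B$ is a $*$-invertible $\mathcal R\in\operatorname{Hom}_\Bbbk(B\otimes B,\Bbbk)$ such that $\mathcal R(a_{(1)},a'_{(1)})a_{(2)}a'_{(2)}=\mathcal R(a_{(2)},a'_{(2)})a'_{(1)}a_{(1)}$ for all $a,a'\in B$, $\mathcal R\circ(m_B\otimes\mathrm{id})=\mathcal R_{1,3}*\mathcal R_{2,3}$ and $\mathcal R\circ(\mathrm{id}\otimes m_B)=\mathcal R_{1,3}*\mathcal R_{1,2}$. A dual Drinfeld twist for a bialgebra $B$ is a $*$-invertible $\mathcal J\in\operatorname{Hom}_\Bbbk(B\otimes B,\Bbbk)$ such that $\mathcal J(a_{(1)},1)a_{(2)}=\mathcal J(a_{(2)},1)a_{(1)}$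 and $\mathcal J(1,a_{(1)})a_{(2)}=\mathcal J(1,a_{(2)})a_{(1)}$ for all $a\in B$, and $(\mathcal J\circ(m_B\otimes\mathrm{id}))*\mathcal J_{1,2}=(\mathcal J\circ(\mathrm{id}\otimes m_B))*\mathcal J_{2,3}$ in $\operatorname{Hom}_\Bbbk(B^{\otimes3},\Bbbk)$. $\mathbf c$ is transitive if $\mathbf c(i,k)\in\{\mathbf c(i,j),\mathbf c(j,k)\}$ for all $1\le i<j<k\le n$. *)

theory Defs
  imports Complex_Main "HOL-Algebra.Group" "HOL-Library.Function_Algebras"
begin

section \<open>Vector spaces, algebras and bialgebras as records\<close>

text \<open>
  The scalars form a type of class \<^class>\<open>field\<close>.  A vector space is a subspace, the carrier of a
  record, of a vector space living on a whole type: addition is that of the type, and the scalar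
  multiplication is the field \<open>scl\<close> of the record.  Explicit carriers are needed because
  the tensor powers of a space, for varying exponents, have to share one type.
\<close>

record ('a, 'k) kalg = "'a monoid" +
  scl :: "'k \<Rightarrow> 'a \<Rightarrow> 'a"

definition linear_on ::
  "('a::ab_group_add, 'k::field, 'm) kalg_scheme \<Rightarrow> ('k \<Rightarrow> 'w::ab_group_add \<Rightarrow> 'w) \<Rightarrow> ('a \<Rightarrow> 'w) \<Rightarrow> bool"
  where "linear_on V sW f \<longleftrightarrow>
    (\<forall>x\<in>carrier V. \<forall>y\<in>carrier V. f (x + y) = f x + f y) \<and>
    (\<forall>c. \<forall>x\<in>carrier V. f (scl V c x) = sW c (f x))"

text \<open>Functionals are compared only on the carrier; their values elsewhere are irrelevant.\<close>

definition Hom_k :: "('a::ab_group_add, 'k::field, 'm) kalg_scheme \<Rightarrow> ('a \<Rightarrow> 'k) set"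
  where "Hom_k V = {f. linear_on V (*) f}"

definition tuples :: "('a, 'k, 'm) kalg_scheme \<Rightarrow> nat \<Rightarrow> 'a list set"
  where "tuples V N = {xs. length xs = N \<and> set xs \<subseteq> carrier V}"

definition multilinear ::
  "('a::ab_group_add, 'k::field, 'm) kalg_scheme \<Rightarrow> nat \<Rightarrow> ('k \<Rightarrow> 'w::ab_group_add \<Rightarrow> 'w)
    \<Rightarrow> ('a list \<Rightarrow> 'w) \<Rightarrow> bool"
  where "multilinear V N sW f \<longleftrightarrow>
    (\<forall>xs\<in>tuples V N. \<forall>i<N.
      (\<forall>x\<in>carrier V. \<forall>y\<in>carrier V. f (xs[i := x + y]) = f (xs[i := x]) + f (xs[i := y])) \<and>
      (\<forall>c. \<forall>x\<in>carrier V. f (xs[i := scl V c x]) = sW c (f (xs[i := x]))))"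

section \<open>Tensor powers of vector spaces\<close>

text \<open>
  Over a field, the \<open>N\<close>-th tensor power of \<open>V\<close> is the span, in the dual of the space of
  \<open>N\<close>-linear forms on \<open>V\<close>, of the evaluations \<open>x\<^sub>1 \<otimes> \<dots> \<otimes> x\<^sub>N : b \<mapsto> b(x\<^sub>1, \<dots>, x\<^sub>N)\<close>.
  Extending these evaluations by \<open>0\<close> to functions that are not \<open>N\<close>-linear forms makes all
  tensor powers subspaces of one function space.  The universal property is proved below.
\<close>

type_synonym ('a, 'k) tens = "('a list \<Rightarrow> 'k) \<Rightarrow> 'k"

definition pure_tensor :: "('a::ab_group_add, 'k::field, 'm) kalg_scheme \<Rightarrow> 'a list \<Rightarrow> ('a, 'k) tens"
  where "pure_tensor V xs = (\<lambda>b. if multilinear V (length xs) (*) b then b xs else 0)"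

definition tscale :: "'k::field \<Rightarrow> ('a, 'k) tens \<Rightarrow> ('a, 'k) tens"
  where "tscale c t = (\<lambda>b. c * t b)"

definition tspace :: "('a::ab_group_add, 'k::field, 'm) kalg_scheme \<Rightarrow> nat \<Rightarrow> ('a, 'k) tens set"
  where "tspace V N = module.span tscale (pure_tensor V ` tuples V N)"

text \<open>
  The linear map on the \<open>N\<close>-th tensor power induced by an \<open>N\<close>-linear map \<open>f\<close> into a space with
  scalar multiplication \<open>sW\<close>.
\<close>

definition tlift ::
  "('a::ab_group_add, 'k::field, 'm) kalg_scheme \<Rightarrow> nat \<Rightarrow> ('k \<Rightarrow> 'w::ab_group_add \<Rightarrow> 'w)
    \<Rightarrow> ('a list \<Rightarrow> 'w) \<Rightarrow> ('a, 'k) tens \<Rightarrow> 'w"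
  where "tlift V N sW f = (SOME L.
    (\<forall>s\<in>tspace V N. \<forall>t\<in>tspace V N. L (s + t) = L s + L t) \<and>
    (\<forall>c. \<forall>t\<in>tspace V N. L (tscale c t) = sW c (L t)) \<and>
    (\<forall>xs\<in>tuples V N. L (pure_tensor V xs) = f xs))"

text \<open>Concatenation \<open>V\<^bsup>\<otimes>M\<^esup> \<otimes> V\<^bsup>\<otimes>N\<^esup> \<rightarrow> V\<^bsup>\<otimes>(M+N)\<^esup>\<close>, and its iteration on elements of \<open>V\<^bsup>\<otimes>d\<^esup>\<close>.\<close>

definition tcat ::
  "('a::ab_group_add, 'k::field, 'm) kalg_scheme \<Rightarrow> nat \<Rightarrow> nat \<Rightarrow> ('a, 'k) tens \<Rightarrow> ('a, 'k) tens
    \<Rightarrow> ('a, 'k) tens"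
  where "tcat V M N s t =
    tlift V M tscale (\<lambda>xs. tlift V N tscale (\<lambda>ys. pure_tensor V (xs @ ys)) t) s"

primrec tconcat ::
  "('a::ab_group_add, 'k::field, 'm) kalg_scheme \<Rightarrow> nat \<Rightarrow> ('a, 'k) tens list \<Rightarrow> ('a, 'k) tens"
  where
    "tconcat V d [] = pure_tensor V []"
  | "tconcat V d (t # ts) = tcat V d (d * length ts) t (tconcat V d ts)"

definition tensor_algebra_power ::
  "('a::ab_group_add, 'k::field, 'm) kalg_scheme \<Rightarrow> nat \<Rightarrow> (('a, 'k) tens, 'k) kalg"
  where "tensor_algebra_power A N =
    \<lparr> carrier = tspace A N,
      mult = (\<lambda>s t. tlift A N tscale (\<lambda>xs. tlift A N tscale
                (\<lambda>ys. pure_tensor A (map2 (mult A) xs ys)) t) s),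
      one = pure_tensor A (replicate N (one A)),
      scl = tscale \<rparr>"

section \<open>Bialgebras\<close>

record ('a, 'k) bialg = "('a, 'k) kalg" +
  comul :: "'a \<Rightarrow> ('a, 'k) tens"
  counit :: "'a \<Rightarrow> 'k"

text \<open>Sweedler notation: \<open>sweedler B sW f a\<close> is \<open>f a\<^sub>(\<^sub>1\<^sub>) a\<^sub>(\<^sub>2\<^sub>)\<close>, for bilinear \<open>f\<close>.\<close>

definition sweedler ::
  "('a::ab_group_add, 'k::field) bialg \<Rightarrow> ('k \<Rightarrow> 'w::ab_group_add \<Rightarrow> 'w) \<Rightarrow> ('a \<Rightarrow> 'a \<Rightarrow> 'w) \<Rightarrow> 'a \<Rightarrow> 'w"
  where "sweedler B sW f a = tlift B 2 sW (\<lambda>xs. f (xs ! 0) (xs ! 1)) (comul B a)"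

locale bialgebra = monoid B + vector_space "scl B"
  for B :: "('a::ab_group_add, 'k::field) bialg" (structure) +
  assumes subspace_carrier: "subspace (carrier B)"
    and mult_linear_left: "y \<in> carrier B \<Longrightarrow> linear_on B (scl B) (\<lambda>x. x \<otimes> y)"
    and mult_linear_right: "x \<in> carrier B \<Longrightarrow> linear_on B (scl B) (\<lambda>y. x \<otimes> y)"
    and comul_closed: "a \<in> carrier B \<Longrightarrow> comul B a \<in> tspace B 2"
    and comul_linear: "linear_on B tscale (comul B)"
    and counit_linear: "counit B \<in> Hom_k B"
    and coassoc: "a \<in> carrier B \<Longrightarrow>
      sweedler B tscale (\<lambda>x y. tcat B 2 1 (comul B x) (pure_tensor B [y])) a =
      sweedler B tscale (\<lambda>x y. tcat B 1 2 (pure_tensor B [x]) (comul B y)) a"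
    and counit_left: "a \<in> carrier B \<Longrightarrow> sweedler B (scl B) (\<lambda>x y. scl B (counit B x) y) a = a"
    and counit_right: "a \<in> carrier B \<Longrightarrow> sweedler B (scl B) (\<lambda>x y. scl B (counit B y) x) a = a"
    and comul_mult: "\<lbrakk>a \<in> carrier B; b \<in> carrier B\<rbrakk> \<Longrightarrow>
      comul B (a \<otimes> b) = comul B a \<otimes>\<^bsub>tensor_algebra_power B 2\<^esub> comul B b"
    and comul_one: "comul B \<one> = \<one>\<^bsub>tensor_algebra_power B 2\<^esub>"
    and counit_mult: "\<lbrakk>a \<in> carrier B; b \<in> carrier B\<rbrakk> \<Longrightarrow>
      counit B (a \<otimes> b) = counit B a * counit B b"
    and counit_one: "counit B \<one> = 1"

text \<open>
  \<open>\<Delta>(h\<^sub>1 \<otimes> \<dots> \<otimes> h\<^sub>N)\<close> is obtained from \<open>\<Delta>(h\<^sub>1) \<otimes> \<dots> \<otimes> \<Delta>(h\<^sub>N) \<in> B\<^bsup>\<otimes>2N\<^esup>\<close> by the shuffle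
  \<open>x\<^sub>1 \<otimes> y\<^sub>1 \<otimes> \<dots> \<otimes> x\<^sub>N \<otimes> y\<^sub>N \<mapsto> (x\<^sub>1 \<otimes> \<dots> \<otimes> x\<^sub>N) \<otimes> (y\<^sub>1 \<otimes> \<dots> \<otimes> y\<^sub>N)\<close>.
\<close>

definition tensor_power ::
  "('a::ab_group_add, 'k::field) bialg \<Rightarrow> nat \<Rightarrow> (('a, 'k) tens, 'k) bialg"
  where "tensor_power B N = kalg.extend (tensor_algebra_power B N)
    (bialg.fields
      (tlift B N tscale (\<lambda>hs.
        tlift B (2 * N) tscale
          (\<lambda>zs. pure_tensor (tensor_algebra_power B N)
             [pure_tensor B (map (\<lambda>i. zs ! (2 * i)) [0..<N]),
              pure_tensor B (map (\<lambda>i. zs ! (2 * i + 1)) [0..<N])])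
          (tconcat B 2 (map (comul B) hs))))
      (tlift B N (*) (\<lambda>hs. prod_list (map (counit B) hs))))"

section \<open>Convolution\<close>

definition conv ::
  "('a::ab_group_add, 'k::field) bialg \<Rightarrow> ('a \<Rightarrow> 'k) \<Rightarrow> ('a \<Rightarrow> 'k) \<Rightarrow> 'a \<Rightarrow> 'k"
  where "conv D f g = (\<lambda>d. sweedler D (*) (\<lambda>x y. f x * g y) d)"

definition conv_prod :: "('a::ab_group_add, 'k::field) bialg \<Rightarrow> ('a \<Rightarrow> 'k) list \<Rightarrow> 'a \<Rightarrow> 'k"
  where "conv_prod D fs = foldr (conv D) fs (counit D)"

definition conv_invertible :: "('a::ab_group_add, 'k::field) bialg \<Rightarrow> ('a \<Rightarrow> 'k) \<Rightarrow> bool"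
  where "conv_invertible D f \<longleftrightarrow>
    (\<exists>g\<in>Hom_k D. \<forall>d\<in>carrier D. conv D f g d = counit D d \<and> conv D g f d = counit D d)"

text \<open>
  \<open>leg H N [i\<^sub>1, \<dots>, i\<^sub>r] f\<close> is \<open>f\<close> acting on the tensor factors \<open>i\<^sub>1, \<dots>, i\<^sub>r\<close> of the \<open>N\<close>-th
  tensor power, the factors being numbered from \<open>1\<close>.
\<close>

definition leg ::
  "('a::ab_group_add, 'k::field) bialg \<Rightarrow> nat \<Rightarrow> nat list \<Rightarrow> (('a, 'k) tens \<Rightarrow> 'k) \<Rightarrow> ('a, 'k) tens \<Rightarrow> 'k"
  where "leg H N is f = tlift H N (*) (\<lambda>hs.
    f (pure_tensor H (map (\<lambda>i. hs ! (i - 1)) is)) *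
    (\<Prod>j\<in>{1..N} - set is. counit H (hs ! (j - 1))))"

definition mult_id :: "('a::ab_group_add, 'k::field) bialg \<Rightarrow> ('a, 'k) tens \<Rightarrow> ('a, 'k) tens"
  where "mult_id B = tlift B 3 tscale (\<lambda>xs. pure_tensor B [xs ! 0 \<otimes>\<^bsub>B\<^esub> xs ! 1, xs ! 2])"

definition id_mult :: "('a::ab_group_add, 'k::field) bialg \<Rightarrow> ('a, 'k) tens \<Rightarrow> ('a, 'k) tens"
  where "id_mult B = tlift B 3 tscale (\<lambda>xs. pure_tensor B [xs ! 0, xs ! 1 \<otimes>\<^bsub>B\<^esub> xs ! 2])"

section \<open>Co-quasi-triangular structures and dual Drinfeld twists\<close>

locale co_quasi_triangular = bialgebra B
  for B :: "('a::ab_group_add, 'k::field) bialg" (structure) +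
  fixes R :: "('a, 'k) tens \<Rightarrow> 'k"
  assumes R_linear: "R \<in> Hom_k (tensor_power B 2)"
    and R_invertible: "conv_invertible (tensor_power B 2) R"
    and R_cocommutes: "\<lbrakk>a \<in> carrier B; a' \<in> carrier B\<rbrakk> \<Longrightarrow>
      sweedler B (scl B) (\<lambda>a1 a2. sweedler B (scl B)
        (\<lambda>a1' a2'. scl B (R (pure_tensor B [a1, a1'])) (a2 \<otimes> a2')) a') a =
      sweedler B (scl B) (\<lambda>a1 a2. sweedler B (scl B)
        (\<lambda>a1' a2'. scl B (R (pure_tensor B [a2, a2'])) (a1' \<otimes> a1)) a') a"
    and R_mult_id: "t \<in> tspace B 3 \<Longrightarrow>
      R (mult_id B t) = conv (tensor_power B 3) (leg B 3 [1, 3] R) (leg B 3 [2, 3] R) t"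
    and R_id_mult: "t \<in> tspace B 3 \<Longrightarrow>
      R (id_mult B t) = conv (tensor_power B 3) (leg B 3 [1, 3] R) (leg B 3 [1, 2] R) t"

locale dual_drinfeld_twist = bialgebra B
  for B :: "('a::ab_group_add, 'k::field) bialg" (structure) +
  fixes J :: "('a, 'k) tens \<Rightarrow> 'k"
  assumes J_linear: "J \<in> Hom_k (tensor_power B 2)"
    and J_invertible: "conv_invertible (tensor_power B 2) J"
    and J_one_right: "a \<in> carrier B \<Longrightarrow>
      sweedler B (scl B) (\<lambda>a1 a2. scl B (J (pure_tensor B [a1, \<one>])) a2) a =
      sweedler B (scl B) (\<lambda>a1 a2. scl B (J (pure_tensor B [a2, \<one>])) a1) a"
    and J_one_left: "a \<in> carrier B \<Longrightarrow>
      sweedler B (scl B) (\<lambda>a1 a2. scl B (J (pure_tensor B [\<one>, a1])) a2) a =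
      sweedler B (scl B) (\<lambda>a1 a2. scl B (J (pure_tensor B [\<one>, a2])) a1) a"
    and J_cocycle: "t \<in> tspace B 3 \<Longrightarrow>
      conv (tensor_power B 3) (J \<circ> mult_id B) (leg B 3 [1, 2] J) t =
      conv (tensor_power B 3) (J \<circ> id_mult B) (leg B 3 [2, 3] J) t"

section \<open>The functional attached to a colouring of pairs\<close>

definition transitive_colouring :: "nat \<Rightarrow> (nat \<times> nat \<Rightarrow> 'c) \<Rightarrow> bool"
  where "transitive_colouring n c \<longleftrightarrow>
    (\<forall>i j k. 1 \<le> i \<and> i < j \<and> j < k \<and> k \<le> n \<longrightarrow> c (i, k) \<in> {c (i, j), c (j, k)})"

definition J_col ::
  "('a::ab_group_add, 'k::field) bialg \<Rightarrow> ('c \<Rightarrow> ('a, 'k) tens \<Rightarrow> 'k) \<Rightarrow> nat \<Rightarrow> (nat \<times> nat \<Rightarrow> 'c)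
    \<Rightarrow> ('a, 'k) tens \<Rightarrow> 'k"
  where "J_col H R n c =
    conv_prod (tensor_power H (2 * n))
      (map (\<lambda>i. conv_prod (tensor_power H (2 * n))
                 (map (\<lambda>j. leg H (2 * n) [i, n + j] (R (c (j, i)))) (rev [1..<i])))
           [2..<n + 1])"

text \<open>The canonical isomorphism \<open>H\<^bsup>\<otimes>n\<^esup> \<otimes> H\<^bsup>\<otimes>n\<^esup> \<rightarrow> H\<^bsup>\<otimes>2n\<^esup>\<close>.\<close>

definition regroup ::
  "('a::ab_group_add, 'k::field) bialg \<Rightarrow> nat \<Rightarrow> (('a, 'k) tens, 'k) tens \<Rightarrow> ('a, 'k) tens"
  where "regroup H n = tlift (tensor_power H n) 2 tscale (\<lambda>ts. tcat H n n (ts ! 0) (ts ! 1))"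

section \<open>The universal property of tensor powers\<close>

lemma vector_space_tscale: "vector_space (tscale :: 'k::field \<Rightarrow> ('a, 'k) tens \<Rightarrow> _)"
  by unfold_locales (auto simp: tscale_def fun_eq_iff algebra_simps)

lemma vector_space_field: "vector_space ((*) :: 'k::field \<Rightarrow> 'k \<Rightarrow> 'k)"
  by unfold_locales (auto simp: algebra_simps)

lemma tlift_exists:
  fixes V :: "('a::ab_group_add, 'k::field, 'm) kalg_scheme"
    and sW :: "'k \<Rightarrow> 'w::ab_group_add \<Rightarrow> 'w"
  assumes W: "vector_space sW" and f: "multilinear V N sW f"
  shows "\<exists>L. Vector_Spaces.linear tscale sW L \<and> (\<forall>xs\<in>tuples V N. L (pure_tensor V xs) = f xs)"
proof -
  interpret T: vector_space "tscale :: 'k \<Rightarrow> ('a, 'k) tens \<Rightarrow> _" by (rule vector_space_tscale)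
  interpret W: vector_space sW by (rule W)
  interpret k: vector_space "(*) :: 'k \<Rightarrow> 'k \<Rightarrow> 'k" by (rule vector_space_field)
  interpret TW: vector_space_pair "tscale :: 'k \<Rightarrow> ('a, 'k) tens \<Rightarrow> _" sW by unfold_locales
  interpret Wk: vector_space_pair sW "(*) :: 'k \<Rightarrow> 'k \<Rightarrow> 'k" by unfold_locales
  let ?P = "pure_tensor V ` tuples V N"
  obtain Bs where Bs: "Bs \<subseteq> ?P" "T.independent Bs" "?P \<subseteq> T.span Bs"
    using T.maximal_independent_subset by blast
  define r where "r b = (SOME xs. xs \<in> tuples V N \<and> pure_tensor V xs = b)" for b
  have r: "r b \<in> tuples V N \<and> pure_tensor V (r b) = b" if "b \<in> ?P" for b
    unfolding r_def by (rule someI_ex) (use that in auto)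
  obtain L where L: "Vector_Spaces.linear tscale sW L" and LB: "\<forall>b\<in>Bs. L b = f (r b)"
    using TW.linear_independent_extend[OF Bs(2), of "\<lambda>b. f (r b)"] by blast
  interpret L: Vector_Spaces.linear tscale sW L by (rule L)
  have "L (pure_tensor V xs) = f xs" if xs: "xs \<in> tuples V N" for xs
  proof (rule ccontr)
    define w where "w = L (pure_tensor V xs) - f xs"
    assume "L (pure_tensor V xs) \<noteq> f xs"
    then have "w \<noteq> 0" by (simp add: w_def)
    then have "W.independent {w}"
      by (simp add: W.dependent_single)
    then obtain g where g: "Vector_Spaces.linear sW (*) g" and gw: "g w = 1"
      using Wk.linear_independent_extend[of "{w}" "\<lambda>_. 1"] by auto
    interpret g: Vector_Spaces.linear sW "(*)" g by (rule g)
    have ml: "multilinear V N (*) (\<lambda>ys. g (f ys))"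
      using f unfolding multilinear_def by (simp add: g.add g.scale)
    have ev: "pure_tensor V ys (\<lambda>ys. g (f ys)) = g (f ys)" if "ys \<in> tuples V N" for ys
      using that ml by (simp add: pure_tensor_def tuples_def)
    have "t (\<lambda>ys. g (f ys)) = g (L t)" if "t \<in> T.span Bs" for t
      using that
    proof (induction rule: T.span_induct_alt)
      case base
      show ?case by (subst L.zero) (simp add: g.zero)
    next
      case (step c b y)
      have "b \<in> ?P" using step Bs by auto
      then have "b (\<lambda>ys. g (f ys)) = g (L b)"
        using r[of b] ev[of "r b"] LB step by auto
      then show ?case
        using step unfolding L.add L.scale g.add g.scale by (simp add: tscale_def)
    qed
    then have "pure_tensor V xs (\<lambda>ys. g (f ys)) = g (L (pure_tensor V xs))"
      using Bs(3) xs by blast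
    then have "g w = 0"
      using ev[OF xs] by (simp add: w_def g.diff)
    then show False using gw by simp
  qed
  then show ?thesis using L by blast
qed

lemma
  fixes V :: "('a::ab_group_add, 'k::field, 'm) kalg_scheme"
    and sW :: "'k \<Rightarrow> 'w::ab_group_add \<Rightarrow> 'w"
  assumes "vector_space sW" and "multilinear V N sW f"
  shows tlift_add: "\<lbrakk>s \<in> tspace V N; t \<in> tspace V N\<rbrakk> \<Longrightarrow>
      tlift V N sW f (s + t) = tlift V N sW f s + tlift V N sW f t"
    and tlift_scale: "t \<in> tspace V N \<Longrightarrow> tlift V N sW f (tscale c t) = sW c (tlift V N sW f t)"
    and tlift_pure: "xs \<in> tuples V N \<Longrightarrow> tlift V N sW f (pure_tensor V xs) = f xs"
proof -
  let ?Q = "\<lambda>L. (\<forall>s\<in>tspace V N. \<forall>t\<in>tspace V N. L (s + t) = L s + L t) \<and>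
    (\<forall>c. \<forall>t\<in>tspace V N. L (tscale c t) = sW c (L t)) \<and>
    (\<forall>xs\<in>tuples V N. L (pure_tensor V xs) = f xs)"
  obtain L where "Vector_Spaces.linear tscale sW L"
    and "\<forall>xs\<in>tuples V N. L (pure_tensor V xs) = f xs"
    using tlift_exists[OF assms] by blast
  then have "?Q L"
    by (simp add: Vector_Spaces.linear_iff)
  then have Q: "?Q (tlift V N sW f)"
    unfolding tlift_def by (rule someI[where P = ?Q])
  show "\<lbrakk>s \<in> tspace V N; t \<in> tspace V N\<rbrakk> \<Longrightarrow>
      tlift V N sW f (s + t) = tlift V N sW f s + tlift V N sW f t"
    and "t \<in> tspace V N \<Longrightarrow> tlift V N sW f (tscale c t) = sW c (tlift V N sW f t)"
    and "xs \<in> tuples V N \<Longrightarrow> tlift V N sW f (pure_tensor V xs) = f xs"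
    using Q by blast+
qed

lemma tlift_unique:
  fixes V :: "('a::ab_group_add, 'k::field, 'm) kalg_scheme"
    and sW :: "'k \<Rightarrow> 'w::ab_group_add \<Rightarrow> 'w"
  assumes W: "vector_space sW"
    and f: "multilinear V N sW f"
    and add: "\<And>s t. \<lbrakk>s \<in> tspace V N; t \<in> tspace V N\<rbrakk> \<Longrightarrow> L (s + t) = L s + L t"
    and scale: "\<And>c t. t \<in> tspace V N \<Longrightarrow> L (tscale c t) = sW c (L t)"
    and pure: "\<And>xs. xs \<in> tuples V N \<Longrightarrow> L (pure_tensor V xs) = f xs"
    and t: "t \<in> tspace V N"
  shows "L t = tlift V N sW f t"
proof -
  interpret T: vector_space "tscale :: 'k \<Rightarrow> ('a, 'k) tens \<Rightarrow> _" by (rule vector_space_tscale)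
  interpret W: vector_space sW by (rule W)
  note sp = tspace_def[of V N]
  have z: "0 \<in> tspace V N" by (simp add: sp T.span_zero)
  have L0: "L 0 = 0" using add[OF z z] by simp
  have l0: "tlift V N sW f 0 = 0" using tlift_add[OF W f z z] by simp
  have "t \<in> T.span (pure_tensor V ` tuples V N)" using t by (simp add: sp)
  then have "t \<in> tspace V N \<and> L t = tlift V N sW f t"
  proof (induction rule: T.span_induct_alt)
    case base
    show ?case using z L0 l0 by metis
  next
    case (step c b y)
    then obtain xs where xs: "xs \<in> tuples V N" "b = pure_tensor V xs" by auto
    have b: "b \<in> tspace V N" and cb: "tscale c b \<in> tspace V N"
      using xs by (auto simp: sp intro!: T.span_base T.span_scale)
    have y: "y \<in> tspace V N" using step by simp
    have "tscale c b + y \<in> tspace V N"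
      using cb y by (auto simp: sp intro: T.span_add)
    moreover have "L b = tlift V N sW f b"
      using xs pure tlift_pure[OF W f] by simp
    ultimately show ?case
      using step by (metis add[OF cb y] scale[OF b] tlift_add[OF W f cb y] tlift_scale[OF W f b])
  qed
  then show ?thesis by simp
qed

end

theory Submission
  imports Defs
begin

text \<open>
  Write \<open>x\<^sub>i, y\<^sub>i, z\<^sub>i\<close> for the tensor factors of \<open>H\<^bsup>\<otimes>n\<^esup> \<otimes> H\<^bsup>\<otimes>n\<^esup> \<otimes> H\<^bsup>\<otimes>n\<^esup>\<close>.  Pulling functionals back along
  coalgebra maps is a homomorphism of convolution monoids, and multiplications, insertions of the
  unit and projections to some of the factors are coalgebra maps.  So every term of the cocycle
  equation becomes a product of legs of the \<open>\<R>\<close>'s in one monoid: multiplicativity splits the leg of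
  \<open>x\<^sub>iy\<^sub>i \<otimes> z\<^sub>j\<close> into the legs of \<open>x\<^sub>i \<otimes> z\<^sub>j\<close> and \<open>y\<^sub>i \<otimes> z\<^sub>j\<close>, and similarly for \<open>x\<^sub>i \<otimes> y\<^sub>jz\<^sub>j\<close>.  Legs without
  common factors commute, and if \<open>Q\<close> is one of \<open>R\<close> and \<open>S\<close>, then the mixed Yang--Baxter equation
  \<open>R\<^sub>1\<^sub>2 * Q\<^sub>1\<^sub>3 * S\<^sub>2\<^sub>3 = S\<^sub>2\<^sub>3 * Q\<^sub>1\<^sub>3 * R\<^sub>1\<^sub>2\<close> holds.  Transitivity of the colouring says that this covers
  all legs on \<open>x\<^sub>i, y\<^sub>j, z\<^sub>k\<close> with \<open>k < j < i\<close>, and then the cocycle equation is an identity of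
  triangular products in a monoid.  The unit conditions hold because \<open>\<R>(-, 1)\<close> and \<open>\<R>(1, -)\<close> are
  invertible idempotents, hence equal to the counit.
\<close>

section \<open>Linear and multilinear maps\<close>

text \<open>The cocycle equation lives on \<open>(H^n)^3\<close>, a tensor power of a tensor power,
  while the legs of the structures live on \<open>H^(3n)\<close>. Both sides are carried over by
  \<open>flatten\<close>, which is a coalgebra map and turns a word map on blocks of length
  \<open>n\<close> into a word map on single factors. One proof that all word maps are coalgebra
  maps then covers multiplications, units and projections. Comultiplications are computed with
  explicit finite Sweedler sums, indexed by the functions that choose one summand in each factor.

  The final identity only rearranges a product of legs. Between its two sides, two legs with a
  common factor change their relative order only if they belong to a triple \<open>x_i\<close>,
  \<open>y_j\<close>, \<open>z_k\<close> with \<open>k < j < i\<close>, where the Yang--Baxter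
  equation is available. The descending order inside the rows is responsible for this: for example,
  the legs on \<open>x_i, z_k\<close> and \<open>x_i, y_j\<close> with \<open>k \<ge> j\<close>
  stand in the same order on both sides.\<close>

interpretation tens: vector_space "tscale :: 'k::field \<Rightarrow> ('a, 'k) tens \<Rightarrow> _"
  by (rule vector_space_tscale)

text \<open>The linear part of \<open>bialgebra\<close> alone. Tensor powers, and tensor powers of
  those, are instances long before they are known to be bialgebras.\<close>

locale kvec = vector_space "scl V"
  for V :: "('a::ab_group_add, 'k::field, 'm) kalg_scheme" (structure) +
  assumes carrier_subspace: "subspace (carrier V)"

lemma linear_onI:
  assumes "\<And>x y. x \<in> carrier V \<Longrightarrow> y \<in> carrier V \<Longrightarrow> f (x + y) = f x + f y"
    and "\<And>c x. x \<in> carrier V \<Longrightarrow> f (scl V c x) = sW c (f x)"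
  shows "linear_on V sW f"
  using assms by (simp add: linear_on_def)

lemma linear_on_add:
  "linear_on V sW f \<Longrightarrow> x \<in> carrier V \<Longrightarrow> y \<in> carrier V \<Longrightarrow> f (x + y) = f x + f y"
  by (simp add: linear_on_def)

lemma linear_on_scale: "linear_on V sW f \<Longrightarrow> x \<in> carrier V \<Longrightarrow> f (scl V c x) = sW c (f x)"
  by (simp add: linear_on_def)

text \<open>Agreement on the carrier is all that is given, so the closure assumptions are there to
  keep \<open>x + y\<close> and \<open>scl V c x\<close> where \<open>f\<close> and \<open>g\<close>
  agree.\<close>

lemma linear_on_cong:
  assumes "linear_on V sW f" "\<And>x. x \<in> carrier V \<Longrightarrow> f x = g x"
    "\<And>x y. x \<in> carrier V \<Longrightarrow> y \<in> carrier V \<Longrightarrow> x + y \<in> carrier V"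
    "\<And>c x. x \<in> carrier V \<Longrightarrow> scl V c x \<in> carrier V"
  shows "linear_on V sW g"
  using assms by (simp add: linear_on_def)

lemma linear_on_compose:
  assumes "linear_on V (scl W) f" "\<And>x. x \<in> carrier V \<Longrightarrow> f x \<in> carrier W" "linear_on W sU g"
  shows "linear_on V sU (\<lambda>x. g (f x))"
  using assms by (simp add: linear_on_def)

lemma linear_on_post:
  assumes "linear_on V sW f" "Vector_Spaces.linear sW sU g"
  shows "linear_on V sU (\<lambda>x. g (f x))"
  using assms by (simp add: linear_on_def Vector_Spaces.linear_iff)

lemma linear_on_sum_fun:
  assumes W: "vector_space sW" and "\<And>k. k \<in> A \<Longrightarrow> linear_on V sW (f k)"
  shows "linear_on V sW (\<lambda>x. \<Sum>k\<in>A. f k x)"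
proof -
  interpret W: vector_space sW by (rule W)
  show ?thesis using assms(2)
    by (intro linear_onI)
      (simp_all add: linear_on_add[of V sW] linear_on_scale[of V sW] sum.distrib W.scale_sum_right)
qed

lemma linear_on_scale_fun:
  assumes W: "vector_space sW" and "linear_on V sW f"
  shows "linear_on V sW (\<lambda>x. sW c (f x))"
proof -
  interpret W: vector_space sW by (rule W)
  show ?thesis using assms(2)
    by (intro linear_onI) (simp_all add: linear_on_add linear_on_scale W.scale_right_distrib W.scale_left_commute)
qed

lemma linear_on_scale_by:
  assumes W: "vector_space sW" and "linear_on V (*) f"
  shows "linear_on V sW (\<lambda>x. sW (f x) w)"
proof -
  interpret W: vector_space sW by (rule W)
  show ?thesis using assms(2)
    by (intro linear_onI) (simp_all add: linear_on_add linear_on_scale W.scale_left_distrib)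
qed

context kvec
begin

lemma zero_closed [simp]: "0 \<in> carrier V"
  using carrier_subspace by (rule subspace_0)

lemma add_closed [simp]: "x \<in> carrier V \<Longrightarrow> y \<in> carrier V \<Longrightarrow> x + y \<in> carrier V"
  using carrier_subspace by (rule subspace_add)

lemma scl_closed [simp]: "x \<in> carrier V \<Longrightarrow> scl V c x \<in> carrier V"
  using carrier_subspace by (rule subspace_scale)

lemma sum_closed: "(\<And>k. k \<in> A \<Longrightarrow> f k \<in> carrier V) \<Longrightarrow> sum f A \<in> carrier V"
  using carrier_subspace by (rule subspace_sum)

lemma linear_on_zero:
  fixes f :: "'a \<Rightarrow> 'w::ab_group_add"
  shows "linear_on V sW f \<Longrightarrow> f 0 = 0"
  using linear_on_add[of V sW f 0 0] by simp

lemma linear_on_sum: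
  fixes f :: "'a \<Rightarrow> 'w::ab_group_add"
  assumes f: "linear_on V sW f" and "\<And>k. k \<in> A \<Longrightarrow> p k \<in> carrier V"
  shows "f (\<Sum>k\<in>A. p k) = (\<Sum>k\<in>A. f (p k))"
  using assms(2)
proof (induction A rule: infinite_finite_induct)
  case (insert k A)
  then have "sum p A \<in> carrier V" by (intro sum_closed) auto
  then show ?case using insert by (simp add: linear_on_add[OF f])
qed (simp_all add: linear_on_zero[OF f])

lemma linear_on_comb:
  fixes f :: "'a \<Rightarrow> 'w::ab_group_add"
  assumes f: "linear_on V sW f" and "\<And>k. k \<in> A \<Longrightarrow> p k \<in> carrier V"
  shows "f (\<Sum>k\<in>A. scl V (r k) (p k)) = (\<Sum>k\<in>A. sW (r k) (f (p k)))"
  using assms by (simp add: linear_on_sum[OF f] linear_on_scale[OF f])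

end

lemma multilinear_iff:
  "multilinear V N sW f \<longleftrightarrow> (\<forall>xs\<in>tuples V N. \<forall>i<N. linear_on V sW (\<lambda>x. f (xs[i := x])))"
  by (auto simp: multilinear_def linear_on_def)

lemma multilinearI:
  assumes "\<And>xs i. xs \<in> tuples V N \<Longrightarrow> i < N \<Longrightarrow> linear_on V sW (\<lambda>x. f (xs[i := x]))"
  shows "multilinear V N sW f"
  using assms by (simp add: multilinear_iff)

lemma multilinearD:
  "multilinear V N sW f \<Longrightarrow> xs \<in> tuples V N \<Longrightarrow> i < N \<Longrightarrow> linear_on V sW (\<lambda>x. f (xs[i := x]))"
  by (simp add: multilinear_iff)

lemma tuples_length: "xs \<in> tuples V N \<Longrightarrow> length xs = N"
  by (simp add: tuples_def)

lemma tuples_nth: "xs \<in> tuples V N \<Longrightarrow> i < N \<Longrightarrow> xs ! i \<in> carrier V"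
  by (auto simp: tuples_def)

lemma tuples_update: "xs \<in> tuples V N \<Longrightarrow> x \<in> carrier V \<Longrightarrow> xs[i := x] \<in> tuples V N"
  using set_update_subset_insert[of xs i x] by (auto simp: tuples_def)

lemma tuples_map: "(\<And>i. i \<in> set is \<Longrightarrow> v i \<in> carrier V) \<Longrightarrow> length is = N \<Longrightarrow> map v is \<in> tuples V N"
  by (auto simp: tuples_def)

lemma tuples_append: "xs \<in> tuples V M \<Longrightarrow> ys \<in> tuples V N \<Longrightarrow> xs @ ys \<in> tuples V (M + N)"
  by (auto simp: tuples_def)

lemma tuples_0 [simp]: "tuples V 0 = {[]}"
  by (auto simp: tuples_def)

lemma tuples_Suc: "tuples V (Suc N) = {x # xs |x xs. x \<in> carrier V \<and> xs \<in> tuples V N}"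
  by (auto simp: tuples_def length_Suc_conv)

lemma multilinear_cong:
  assumes f: "multilinear V N sW f" and eq: "\<And>xs. xs \<in> tuples V N \<Longrightarrow> f xs = g xs" and V: "kvec V"
  shows "multilinear V N sW g"
proof -
  interpret kvec V by (rule V)
  show ?thesis
  proof (rule multilinearI)
    fix xs i assume *: "xs \<in> tuples V N" "i < N"
    show "linear_on V sW (\<lambda>x. g (xs[i := x]))"
      by (rule linear_on_cong[OF multilinearD[OF f *]]) (use * in \<open>auto simp: eq tuples_update\<close>)
  qed
qed

lemma multilinear_post:
  assumes "multilinear V N sW f" "Vector_Spaces.linear sW sU g"
  shows "multilinear V N sU (\<lambda>xs. g (f xs))"
  by (intro multilinearI linear_on_post[OF multilinearD[OF assms(1)] assms(2)])

lemma multilinear_compose_linear: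
  assumes "multilinear V N (scl W) f" "\<And>xs. xs \<in> tuples V N \<Longrightarrow> f xs \<in> carrier W" "linear_on W sU g"
  shows "multilinear V N sU (\<lambda>xs. g (f xs))"
  by (intro multilinearI linear_on_compose[OF multilinearD[OF assms(1)] _ assms(3)])
    (auto intro: assms(2) tuples_update)

lemma multilinear_tail:
  assumes "multilinear V (Suc N) sW f" "x \<in> carrier V"
  shows "multilinear V N sW (\<lambda>xs. f (x # xs))"
proof (rule multilinearI)
  fix xs i assume "xs \<in> tuples V N" "i < N"
  then show "linear_on V sW (\<lambda>y. f (x # xs[i := y]))"
    using multilinearD[OF assms(1), of "x # xs" "Suc i"] assms(2) by (auto simp: tuples_Suc)
qed

lemma multilinear_head:
  assumes "multilinear V (Suc N) sW f" "xs \<in> tuples V N"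
  shows "linear_on V sW (\<lambda>x. f (x # xs))"
proof (rule linear_onI)
  fix x y assume xy: "x \<in> carrier V" "y \<in> carrier V"
  then show "f ((x + y) # xs) = f (x # xs) + f (y # xs)"
    using linear_on_add[OF multilinearD[OF assms(1), of "x # xs" 0]] assms(2)
    by (auto simp: tuples_Suc)
next
  fix c x assume x: "x \<in> carrier V"
  then show "f (scl V c x # xs) = sW c (f (x # xs))"
    using linear_on_scale[OF multilinearD[OF assms(1), of "x # xs" 0]] assms(2)
    by (auto simp: tuples_Suc)
qed

lemma multilinear_ConsI:
  assumes "\<And>xs. xs \<in> tuples V N \<Longrightarrow> linear_on V sW (\<lambda>x. f (x # xs))"
    and "\<And>x. x \<in> carrier V \<Longrightarrow> multilinear V N sW (\<lambda>xs. f (x # xs))"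
  shows "multilinear V (Suc N) sW f"
proof (rule multilinearI)
  fix xs i assume "xs \<in> tuples V (Suc N)" "i < Suc N"
  then obtain y ys where *: "xs = y # ys" "y \<in> carrier V" "ys \<in> tuples V N" by (auto simp: tuples_Suc)
  show "linear_on V sW (\<lambda>x. f (xs[i := x]))"
    using assms(1)[OF *(3)] multilinearD[OF assms(2)[OF *(2)] *(3)] \<open>i < Suc N\<close> *(1)
    by (cases i) auto
qed

lemma multilinear_0 [simp]: "multilinear V 0 sW f"
  by (simp add: multilinear_iff)

text \<open>Fixing a first entry in \<open>P\<close> leaves one slot less, and linearity in the head
  passes from \<open>P\<close> to its span. This form is needed when the slots hold tensors
  themselves, with \<open>P\<close> the set of pure ones.\<close>

lemma (in kvec) multilinear_ext:
  fixes f :: "'a list \<Rightarrow> 'w::ab_group_add"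
  assumes "multilinear V N sW f" "multilinear V N sW g"
    and "carrier V = span P"
    and "\<And>xs. length xs = N \<Longrightarrow> set xs \<subseteq> P \<Longrightarrow> f xs = g xs"
    and "xs \<in> tuples V N"
  shows "f xs = g xs"
  using assms(1,2,4,5)
proof (induction N arbitrary: f g xs)
  case 0
  then show ?case by (auto simp: tuples_def)
next
  case (Suc N)
  from Suc.prems(4) obtain y ys where xs: "xs = y # ys" "y \<in> carrier V" "ys \<in> tuples V N"
    by (auto simp: tuples_Suc)
  have P: "P \<subseteq> carrier V" using assms(3) span_superset by simp
  have lf: "linear_on V sW (\<lambda>x. f (x # ys))" and lg: "linear_on V sW (\<lambda>x. g (x # ys))"
    using Suc.prems(1,2) xs multilinear_head by blast+
  have base: "f (b # ys) = g (b # ys)" if "b \<in> P" for b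
  proof (rule Suc.IH[OF _ _ _ xs(3)])
    show "multilinear V N sW (\<lambda>ys. f (b # ys))" "multilinear V N sW (\<lambda>ys. g (b # ys))"
      using that P by (auto intro: multilinear_tail Suc.prems(1,2))
    show "f (b # zs) = g (b # zs)" if "length zs = N" "set zs \<subseteq> P" for zs
      using that \<open>b \<in> P\<close> by (intro Suc.prems(3)) auto
  qed
  have "y \<in> span P" using xs assms(3) by simp
  then have "y \<in> carrier V \<and> f (y # ys) = g (y # ys)"
  proof (induction rule: span_induct_alt)
    case base
    show ?case using linear_on_zero[OF lf] linear_on_zero[OF lg] by simp
  next
    case (step c b z)
    have "b \<in> carrier V" using step P by auto
    then show ?case using step base[of b]
      by (simp add: linear_on_add[OF lf] linear_on_add[OF lg] linear_on_scale[OF lf] linear_on_scale[OF lg])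
  qed
  then show ?case using xs by simp
qed

section \<open>Sums over families of indices\<close>

lemma sum_PiE_insert:
  assumes "i \<notin> I"
  shows "(\<Sum>g\<in>PiE (insert i I) A. F g) = (\<Sum>k\<in>A i. \<Sum>g\<in>PiE I A. F (g(i := k)))"
proof -
  have inj: "inj_on (\<lambda>(y, g). g(i := y)) (A i \<times> PiE I A)"
    using assms by (rule inj_combinator)
  have "(\<Sum>g\<in>PiE (insert i I) A. F g) = (\<Sum>z\<in>A i \<times> PiE I A. F ((\<lambda>(y, g). g(i := y)) z))"
    unfolding PiE_insert_eq by (subst sum.reindex[OF inj]) simp
  then show ?thesis by (simp add: sum.cartesian_product case_prod_unfold)
qed

lemma sum_PiE_insert_map:
  assumes "i \<notin> set is"
  shows "(\<Sum>g\<in>PiE (set (i # is)) A. F (g i) (map (\<lambda>l. p l (g l)) is)) =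
    (\<Sum>k\<in>A i. \<Sum>g\<in>PiE (set is) A. F k (map (\<lambda>l. p l (g l)) is))"
proof -
  have "map (\<lambda>l. p l ((g(i := k)) l)) is = map (\<lambda>l. p l (g l)) is" for g k
    using assms by auto
  then show ?thesis
    unfolding list.set(2) sum_PiE_insert[OF assms] by (simp only: fun_upd_same)
qed

text \<open>The distributive law: expanding means choosing one summand in each slot, and the
  extensional functions of \<open>PiE\<close> are these choices, each counted once.\<close>

lemma (in kvec) multilinear_sum_PiE:
  fixes f :: "'a list \<Rightarrow> 'w::ab_group_add"
  assumes "multilinear V (length is) sW f" "distinct is"
    and "\<And>i k. i \<in> set is \<Longrightarrow> k \<in> A i \<Longrightarrow> p i k \<in> carrier V"
  shows "f (map (\<lambda>i. \<Sum>k\<in>A i. p i k) is) = (\<Sum>g\<in>PiE (set is) A. f (map (\<lambda>i. p i (g i)) is))"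
  using assms
proof (induction "is" arbitrary: f)
  case Nil
  then show ?case by simp
next
  case (Cons i "is")
  have ml: "multilinear V (Suc (length is)) sW f" using Cons.prems by simp
  have tup: "map (\<lambda>i. \<Sum>k\<in>A i. p i k) is \<in> tuples V (length is)"
    using Cons.prems by (intro tuples_map sum_closed) auto
  have "f (map (\<lambda>i. \<Sum>k\<in>A i. p i k) (i # is)) =
      (\<Sum>k\<in>A i. f (p i k # map (\<lambda>i. \<Sum>k\<in>A i. p i k) is))"
    using Cons.prems by (simp add: linear_on_sum[OF multilinear_head[OF ml tup]])
  also have "\<dots> = (\<Sum>k\<in>A i. \<Sum>g\<in>PiE (set is) A. f (p i k # map (\<lambda>i. p i (g i)) is))"
    using Cons.prems by (intro sum.cong refl Cons.IH multilinear_tail[OF ml]) auto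
  also have "\<dots> = (\<Sum>g\<in>PiE (set (i # is)) A. f (map (\<lambda>i. p i (g i)) (i # is)))"
    using sum_PiE_insert_map[of i "is" "\<lambda>k xs. f (p i k # xs)" p A] Cons.prems by simp
  finally show ?case .
qed

lemma (in kvec) multilinear_prod_scale:
  fixes f :: "'a list \<Rightarrow> 'w::ab_group_add"
  assumes W: "vector_space sW" and "multilinear V (length is) sW f" "distinct is"
    and "\<And>i. i \<in> set is \<Longrightarrow> x i \<in> carrier V"
  shows "f (map (\<lambda>i. scl V (r i) (x i)) is) = sW (\<Prod>i\<in>set is. r i) (f (map x is))"
  using assms(2-)
proof (induction "is" arbitrary: f)
  case Nil
  interpret W: vector_space sW by (rule W)
  show ?case by simp
next
  case (Cons i "is")
  interpret W: vector_space sW by (rule W)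
  have ml: "multilinear V (Suc (length is)) sW f" using Cons.prems by simp
  have tup: "map (\<lambda>i. scl V (r i) (x i)) is \<in> tuples V (length is)"
    using Cons.prems by (intro tuples_map) auto
  show ?case
    using Cons.prems Cons.IH[OF multilinear_tail[OF ml]]
      linear_on_scale[OF multilinear_head[OF ml tup], of "x i" "r i"]
    by simp
qed

text \<open>Comultiplying twice leads to a choice \<open>g\<close> and then a choice
  \<open>h\<close> depending on it. Merged into one choice of dependent pairs, the sum is again
  organised by factors, so that an identity valid in each factor can be applied.\<close>

lemma sum_PiE_Sigma:
  assumes "finite I" and "\<And>i. i \<in> I \<Longrightarrow> finite (A i)"
    and "\<And>i k. i \<in> I \<Longrightarrow> k \<in> A i \<Longrightarrow> finite (B i k)"
  shows "(\<Sum>g\<in>PiE I A. \<Sum>h\<in>PiE I (\<lambda>i. B i (g i)). F g h) =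
    (\<Sum>e\<in>PiE I (\<lambda>i. Sigma (A i) (B i)). F (\<lambda>i\<in>I. fst (e i)) (\<lambda>i\<in>I. snd (e i)))"
proof -
  let ?D = "Sigma (PiE I A) (\<lambda>g. PiE I (\<lambda>i. B i (g i)))"
  have "(\<Sum>g\<in>PiE I A. \<Sum>h\<in>PiE I (\<lambda>i. B i (g i)). F g h) = (\<Sum>(g, h)\<in>?D. F g h)"
    using assms by (intro sum.Sigma finite_PiE ballI) (auto simp: PiE_iff)
  also have "\<dots> = (\<Sum>e\<in>PiE I (\<lambda>i. Sigma (A i) (B i)). F (\<lambda>i\<in>I. fst (e i)) (\<lambda>i\<in>I. snd (e i)))"
  proof (rule sum.reindex_bij_witness[where i = "\<lambda>e. (\<lambda>i\<in>I. fst (e i), \<lambda>i\<in>I. snd (e i))"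
          and j = "\<lambda>(g, h). \<lambda>i\<in>I. (g i, h i)"])
    fix z assume "z \<in> ?D"
    then obtain g h where z: "z = (g, h)" "g \<in> PiE I A" "h \<in> PiE I (\<lambda>i. B i (g i))" by auto
    then have *: "(\<lambda>i\<in>I. fst ((\<lambda>i\<in>I. (g i, h i)) i)) = g" "(\<lambda>i\<in>I. snd ((\<lambda>i\<in>I. (g i, h i)) i)) = h"
      by (auto simp: fun_eq_iff restrict_def PiE_iff extensional_def)
    show "(\<lambda>i\<in>I. fst ((case z of (g, h) \<Rightarrow> \<lambda>i\<in>I. (g i, h i)) i),
        \<lambda>i\<in>I. snd ((case z of (g, h) \<Rightarrow> \<lambda>i\<in>I. (g i, h i)) i)) = z"
      unfolding z(1) prod.case * ..
    show "(case z of (g, h) \<Rightarrow> \<lambda>i\<in>I. (g i, h i)) \<in> PiE I (\<lambda>i. Sigma (A i) (B i))"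
      using z by (auto simp: PiE_iff)
    show "F (\<lambda>i\<in>I. fst ((case z of (g, h) \<Rightarrow> \<lambda>i\<in>I. (g i, h i)) i))
        (\<lambda>i\<in>I. snd ((case z of (g, h) \<Rightarrow> \<lambda>i\<in>I. (g i, h i)) i)) = (case z of (g, h) \<Rightarrow> F g h)"
      unfolding z(1) prod.case * ..
  next
    fix e assume e: "e \<in> PiE I (\<lambda>i. Sigma (A i) (B i))"
    then show "(case (\<lambda>i\<in>I. fst (e i), \<lambda>i\<in>I. snd (e i)) of (g, h) \<Rightarrow> \<lambda>i\<in>I. (g i, h i)) = e"
      by (auto simp: fun_eq_iff restrict_def PiE_iff extensional_def)
    have "fst (e i) \<in> A i \<and> snd (e i) \<in> B i (fst (e i))" if "i \<in> I" for i
      using PiE_mem[OF e that] by auto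
    then show "(\<lambda>i\<in>I. fst (e i), \<lambda>i\<in>I. snd (e i)) \<in> ?D"
      by (auto simp: PiE_iff)
  qed
  finally show ?thesis .
qed

text \<open>A choice for each set \<open>S i\<close>, itself a choice for each of its elements, is
  one choice on the union because no element belongs to two sets. The sets will be the letters of
  words or the factors of blocks.\<close>

lemma sum_PiE_UN:
  assumes "\<And>i j. i \<in> I \<Longrightarrow> j \<in> I \<Longrightarrow> i \<noteq> j \<Longrightarrow> S i \<inter> S j = {}"
  shows "(\<Sum>g\<in>PiE I (\<lambda>i. PiE (S i) A). F g) =
    (\<Sum>h\<in>PiE (\<Union>i\<in>I. S i) A. F (\<lambda>i\<in>I. restrict h (S i)))"
proof -
  \<comment> \<open>The index of the only set that contains \<open>l\<close>.\<close>
  define w where "w l = (THE i. i \<in> I \<and> l \<in> S i)" for l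
  have w: "w l = i" if "i \<in> I" "l \<in> S i" for i l
    unfolding w_def using that assms by (intro the_equality) auto
  show ?thesis
  proof (rule sum.reindex_bij_witness[where i = "\<lambda>h. \<lambda>i\<in>I. restrict h (S i)"
        and j = "\<lambda>g. \<lambda>l\<in>(\<Union>i\<in>I. S i). g (w l) l"])
    fix g assume g: "g \<in> PiE I (\<lambda>i. PiE (S i) A)"
    have gi: "g i \<in> PiE (S i) A" if "i \<in> I" for i
      using PiE_mem[OF g that] .
    have "restrict (\<lambda>l\<in>(\<Union>i\<in>I. S i). g (w l) l) (S i) = g i" if "i \<in> I" for i
    proof
      fix l show "restrict (\<lambda>l\<in>(\<Union>i\<in>I. S i). g (w l) l) (S i) l = g i l"
        using w[OF that] that PiE_arb[OF gi[OF that]] by (cases "l \<in> S i") auto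
    qed
    then show eq: "(\<lambda>i\<in>I. restrict (\<lambda>l\<in>(\<Union>i\<in>I. S i). g (w l) l) (S i)) = g"
      using PiE_arb[OF g] by (auto simp: fun_eq_iff restrict_def)
    have "g (w l) l \<in> A l" if "i \<in> I" "l \<in> S i" for i l
      using PiE_mem[OF gi[OF that(1)] that(2)] w[OF that] by simp
    then show "(\<lambda>l\<in>(\<Union>i\<in>I. S i). g (w l) l) \<in> PiE (\<Union>i\<in>I. S i) A"
      by (intro restrict_PiE_iff[THEN iffD2]) auto
    show "F (\<lambda>i\<in>I. restrict (\<lambda>l\<in>(\<Union>i\<in>I. S i). g (w l) l) (S i)) = F g"
      by (simp only: eq)
  next
    fix h assume h: "h \<in> PiE (\<Union>i\<in>I. S i) A"
    show "(\<lambda>l\<in>(\<Union>i\<in>I. S i). (\<lambda>i\<in>I. restrict h (S i)) (w l) l) = h"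
    proof
      fix l show "(\<lambda>l\<in>(\<Union>i\<in>I. S i). (\<lambda>i\<in>I. restrict h (S i)) (w l) l) l = h l"
      proof (cases "l \<in> (\<Union>i\<in>I. S i)")
        case True
        then obtain i where i: "i \<in> I" "l \<in> S i" by auto
        then show ?thesis using w[OF i] by auto
      qed (use PiE_arb[OF h] in auto)
    qed
    show "(\<lambda>i\<in>I. restrict h (S i)) \<in> PiE I (\<lambda>i. PiE (S i) A)"
      by (intro restrict_PiE_iff[THEN iffD2] ballI PiE_mem[OF h]) auto
  qed
qed

lemma sum_PiE_drop:
  fixes e :: "'i \<Rightarrow> 'j \<Rightarrow> 'k::field"
  assumes W: "vector_space sW" and "finite V" "U \<inter> V = {}"
  shows "(\<Sum>g\<in>PiE (U \<union> V) A. sW (\<Prod>i\<in>V. e i (g i)) (F (restrict g U))) =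
    sW (\<Prod>i\<in>V. \<Sum>k\<in>A i. e i k) (\<Sum>g\<in>PiE U A. F g)"
  using assms(2,3)
proof (induction V)
  case empty
  interpret W: vector_space sW by (rule W)
  show ?case by (auto simp: PiE_restrict intro!: sum.cong)
next
  case (insert i V)
  interpret W: vector_space sW by (rule W)
  have i: "i \<notin> U \<union> V" and inter: "U \<inter> V = {}" using insert by auto
  have r: "restrict (g(i := k)) U = restrict g U" for g k
    using i by (auto simp: restrict_def fun_eq_iff)
  have p: "(\<Prod>l\<in>V. e l ((g(i := k)) l)) = (\<Prod>l\<in>V. e l (g l))" for g k
    using i by (intro prod.cong) auto
  have "(\<Sum>g\<in>PiE (U \<union> insert i V) A. sW (\<Prod>l\<in>insert i V. e l (g l)) (F (restrict g U))) =
      (\<Sum>k\<in>A i. \<Sum>g\<in>PiE (U \<union> V) A. sW (e i k) (sW (\<Prod>l\<in>V. e l (g l)) (F (restrict g U))))"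
    unfolding Un_insert_right sum_PiE_insert[OF i] using insert by (simp add: r p del: fun_upd_apply) simp
  also have "\<dots> = (\<Sum>k\<in>A i. sW (e i k) (sW (\<Prod>i\<in>V. \<Sum>k\<in>A i. e i k) (\<Sum>g\<in>PiE U A. F g)))"
    using insert by (simp only: W.scale_sum_right[symmetric] insert.IH[OF inter])
  also have "\<dots> = sW (\<Prod>i\<in>insert i V. \<Sum>k\<in>A i. e i k) (\<Sum>g\<in>PiE U A. F g)"
    using insert by (simp only: prod.insert[OF insert.hyps] W.scale_scale[symmetric] W.scale_sum_left)
  finally show ?case .
qed

lemma sum_PiE_3:
  "(\<Sum>g\<in>PiE {..<3::nat} A. F (g 0) (g 1) (g 2)) = (\<Sum>i\<in>A 0. \<Sum>j\<in>A 1. \<Sum>k\<in>A 2. F i j k)"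
proof -
  have *: "{..<3::nat} = insert 0 (insert 1 (insert 2 {}))" by auto
  show ?thesis unfolding * by (simp add: sum_PiE_insert)
qed

section \<open>Tensor powers\<close>

text \<open>
  Tensors are functions, and these rules would rewrite the zero and the sums of tensors pointwise.
\<close>

declare zero_fun_apply [simp del] plus_fun_apply [simp del]

lemma tensor_algebra_power_simps [simp]:
  "carrier (tensor_algebra_power A N) = tspace A N"
  "scl (tensor_algebra_power A N) = tscale"
  "one (tensor_algebra_power A N) = pure_tensor A (replicate N (one A))"
  by (simp_all add: tensor_algebra_power_def)

lemma tensor_power_simps [simp]:
  "carrier (tensor_power B N) = tspace B N"
  "scl (tensor_power B N) = tscale"
  "one (tensor_power B N) = pure_tensor B (replicate N (one B))"
  "mult (tensor_power B N) = mult (tensor_algebra_power B N)"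
  by (simp_all add: tensor_power_def kalg.defs bialg.defs tensor_algebra_power_def)

lemma counit_tensor_power:
  "counit (tensor_power B N) = tlift B N (*) (\<lambda>hs. prod_list (map (counit B) hs))"
  by (simp add: tensor_power_def kalg.defs bialg.defs)

lemma pure_tensor_cong:
  assumes "carrier V = carrier W" "scl V = scl W"
  shows "pure_tensor V = pure_tensor W"
  unfolding pure_tensor_def multilinear_def tuples_def assms by simp

lemma pure_tensor_algebra_power: "pure_tensor (tensor_algebra_power B N) = pure_tensor (tensor_power B N)"
  by (rule pure_tensor_cong) simp_all

lemma pure_tensor_closed [simp]: "xs \<in> tuples V N \<Longrightarrow> pure_tensor V xs \<in> tspace V N"
  unfolding tspace_def by (intro tens.span_base) simp

lemma kvec_tensor_algebra_power: "kvec (tensor_algebra_power V N)"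
proof -
  interpret v: vector_space "scl (tensor_algebra_power V N)"
    by (simp add: vector_space_tscale)
  show ?thesis
    by unfold_locales (simp add: tspace_def)
qed

lemma kvec_tensor_power: "kvec (tensor_power B N)"
proof -
  interpret v: vector_space "scl (tensor_power B N)"
    by (simp add: vector_space_tscale)
  show ?thesis
    by unfold_locales (simp add: tspace_def)
qed

lemma tspace_closed [simp]:
  shows "0 \<in> tspace V N"
    and "s \<in> tspace V N \<Longrightarrow> t \<in> tspace V N \<Longrightarrow> s + t \<in> tspace V N"
    and "t \<in> tspace V N \<Longrightarrow> tscale c t \<in> tspace V N"
  using kvec.zero_closed[OF kvec_tensor_algebra_power[of V N]]
    kvec.add_closed[OF kvec_tensor_algebra_power[of V N]]
    kvec.scl_closed[OF kvec_tensor_algebra_power[of V N]] by simp_all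

lemma tspace_sum: "(\<And>k. k \<in> A \<Longrightarrow> f k \<in> tspace V N) \<Longrightarrow> sum f A \<in> tspace V N"
  by (rule kvec.sum_closed[OF kvec_tensor_algebra_power[of V N], unfolded tensor_algebra_power_simps])

lemma tspace_induct [consumes 1, case_names zero step]:
  assumes "t \<in> tspace V N" "P 0"
    and "\<And>c xs t. xs \<in> tuples V N \<Longrightarrow> t \<in> tspace V N \<Longrightarrow> P t \<Longrightarrow> P (tscale c (pure_tensor V xs) + t)"
  shows "P t"
proof -
  have "t \<in> module.span tscale (pure_tensor V ` tuples V N)" using assms(1) by (simp add: tspace_def)
  then have "t \<in> tspace V N \<and> P t"
    by (induction rule: tens.span_induct_alt) (auto simp: assms(2) intro!: assms(3))
  then show ?thesis ..
qed

text \<open>Pure tensors span, so this is the standard reduction of an identity that is linear in a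
  tensor.\<close>

lemma linear_on_tspace_ext:
  fixes L :: "('a::ab_group_add, 'k::field) tens \<Rightarrow> 'w::ab_group_add"
  assumes "linear_on (tensor_algebra_power V N) sW L" "linear_on (tensor_algebra_power V N) sW L'"
    and "\<And>xs. xs \<in> tuples V N \<Longrightarrow> L (pure_tensor V xs) = L' (pure_tensor V xs)"
    and "t \<in> tspace V N"
  shows "L t = L' t"
  using assms(4)
proof (induction rule: tspace_induct)
  case zero
  show ?case
    using kvec.linear_on_zero[OF kvec_tensor_algebra_power assms(1)]
      kvec.linear_on_zero[OF kvec_tensor_algebra_power assms(2)] by simp
next
  case (step c xs t)
  then show ?case
    using linear_on_add[OF assms(1), of "tscale c (pure_tensor V xs)" t]
      linear_on_add[OF assms(2), of "tscale c (pure_tensor V xs)" t]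
      linear_on_scale[OF assms(1), of "pure_tensor V xs" c]
      linear_on_scale[OF assms(2), of "pure_tensor V xs" c] assms(3)
    by simp
qed

lemma linear_on_tensor_power: "linear_on (tensor_power B N) = linear_on (tensor_algebra_power B N)"
  by (intro ext) (simp add: linear_on_def)

lemma tlift_linear:
  assumes "vector_space sW" "multilinear V N sW f"
  shows "linear_on (tensor_algebra_power V N) sW (tlift V N sW f)"
  by (intro linear_onI) (simp_all add: tlift_add[OF assms] tlift_scale[OF assms])

lemma tlift_linear': "multilinear V N tscale f \<Longrightarrow> linear_on (tensor_algebra_power V N) tscale (tlift V N tscale f)"
  by (rule tlift_linear[OF vector_space_tscale])

lemma linear_on_tspace_closed:
  assumes L: "linear_on (tensor_algebra_power V N) (scl W) L" and W: "kvec W"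
    and pure: "\<And>xs. xs \<in> tuples V N \<Longrightarrow> L (pure_tensor V xs) \<in> carrier W" and "t \<in> tspace V N"
  shows "L t \<in> carrier W"
  using assms(4)
proof (induction rule: tspace_induct)
  case zero
  show ?case using kvec.linear_on_zero[OF kvec_tensor_algebra_power L] kvec.zero_closed[OF W] by simp
next
  case (step c xs t)
  then show ?case
    using linear_on_add[OF L, of "tscale c (pure_tensor V xs)" t]
      linear_on_scale[OF L, of "pure_tensor V xs" c] pure kvec.add_closed[OF W] kvec.scl_closed[OF W]
    by simp
qed

lemma tlift_closed:
  assumes f: "multilinear V N tscale f" "\<And>xs. xs \<in> tuples V N \<Longrightarrow> f xs \<in> tspace W M"
    and "t \<in> tspace V N"
  shows "tlift V N tscale f t \<in> tspace W M"
  using linear_on_tspace_closed[of V N "tensor_algebra_power W M" "tlift V N tscale f" t] assms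
  by (simp add: tlift_linear' kvec_tensor_algebra_power tlift_pure[OF vector_space_tscale])

lemma tlift_sum:
  assumes "vector_space sW" "multilinear V N sW f" "\<And>k. k \<in> A \<Longrightarrow> p k \<in> tuples V N"
  shows "tlift V N sW f (\<Sum>k\<in>A. pure_tensor V (p k)) = (\<Sum>k\<in>A. f (p k))"
  using kvec.linear_on_sum[OF kvec_tensor_algebra_power tlift_linear[OF assms(1,2)], of A "\<lambda>k. pure_tensor V (p k)"]
    assms(3) by (simp add: tlift_pure[OF assms(1,2)])

lemma tlift_cong:
  assumes "vector_space sW" "multilinear V N sW f" "multilinear V N sW g"
    "\<And>xs. xs \<in> tuples V N \<Longrightarrow> f xs = g xs" "t \<in> tspace V N"
  shows "tlift V N sW f t = tlift V N sW g t"
  by (rule linear_on_tspace_ext[OF tlift_linear[OF assms(1,2)] tlift_linear[OF assms(1,3)] _ assms(5)])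
    (simp add: tlift_pure[OF assms(1,2)] tlift_pure[OF assms(1,3)] assms(4))

text \<open>A pure tensor evaluates forms: at a multilinear \<open>b\<close> the claim is linearity
  of \<open>b\<close> in one slot, and at any other \<open>b\<close> both sides vanish.\<close>

lemma pure_tensor_multilinear: "multilinear V N tscale (pure_tensor V)"
proof (rule multilinearI, rule linear_onI)
  fix xs i x y assume *: "xs \<in> tuples V N" "i < N" "x \<in> carrier V" "y \<in> carrier V"
  show "pure_tensor V (xs[i := x + y]) = pure_tensor V (xs[i := x]) + pure_tensor V (xs[i := y])"
  proof
    fix b
    show "pure_tensor V (xs[i := x + y]) b = (pure_tensor V (xs[i := x]) + pure_tensor V (xs[i := y])) b"
      using linear_on_add[OF multilinearD, of V N "(*)" b xs i x y] * tuples_length[OF *(1)]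
      by (simp add: pure_tensor_def plus_fun_apply)
  qed
next
  fix xs i c x assume *: "xs \<in> tuples V N" "i < N" "x \<in> carrier V"
  show "pure_tensor V (xs[i := scl V c x]) = tscale c (pure_tensor V (xs[i := x]))"
  proof
    fix b
    show "pure_tensor V (xs[i := scl V c x]) b = tscale c (pure_tensor V (xs[i := x])) b"
      using linear_on_scale[OF multilinearD, of V N "(*)" b xs i x c] * tuples_length[OF *(1)]
      by (simp add: pure_tensor_def tscale_def)
  qed
qed

lemma linear_on_pure_slot:
  assumes "xs \<in> tuples V N" "i < N"
  shows "linear_on V tscale (\<lambda>x. pure_tensor V (xs[i := x]))"
  by (rule multilinearD[OF pure_tensor_multilinear assms])

lemma multilinear_pure_compose:
  assumes L: "linear_on (tensor_algebra_power V N) sW L"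
  shows "multilinear V N sW (\<lambda>xs. L (pure_tensor V xs))"
  by (rule multilinear_compose_linear[OF _ _ L]) (simp_all add: pure_tensor_multilinear)

text \<open>The coefficient of each term is absorbed into slot \<open>0\<close>, which exists
  because the degree is positive. In degree two this yields Sweedler sums without
  coefficients.\<close>

lemma (in kvec) tspace_Suc_sum:
  assumes "t \<in> tspace V (Suc N)"
  shows "\<exists>m p. (\<forall>k<m::nat. p k \<in> tuples V (Suc N)) \<and> t = (\<Sum>k<m. pure_tensor V (p k))"
  using assms
proof (induction rule: tspace_induct)
  case zero
  show ?case by (intro exI[of _ 0]) simp
next
  case (step c xs t)
  then obtain m p where mp: "\<forall>k<m::nat. p k \<in> tuples V (Suc N)" "t = (\<Sum>k<m. pure_tensor V (p k))" by blast
  define q where "q = p(m := xs[0 := scl V c (xs ! 0)])"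
  have xs0: "xs ! 0 \<in> carrier V" using step by (auto intro: tuples_nth)
  have "pure_tensor V (xs[0 := scl V c (xs ! 0)]) = tscale c (pure_tensor V xs)"
    using linear_on_scale[OF linear_on_pure_slot, OF step(1) _ xs0, of 0 c] by simp
  then have "tscale c (pure_tensor V xs) + t = (\<Sum>k<Suc m. pure_tensor V (q k))"
    using mp by (simp add: q_def add.commute)
  moreover have "\<forall>k<Suc m. q k \<in> tuples V (Suc N)"
    using mp step xs0 by (auto simp: q_def less_Suc_eq intro!: tuples_update)
  ultimately show ?case by blast
qed

text \<open>Lifts are determined by their values on pure tensors, so linearity in the parameter
  \<open>x\<close> can be checked there. Nested lifts, as in \<open>tcat\<close> and in the
  multiplication of a tensor power, become bilinear this way.\<close>

lemma tlift_linear_param: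
  fixes f :: "'x::ab_group_add \<Rightarrow> 'a::ab_group_add list \<Rightarrow> 'w::ab_group_add"
  assumes W: "vector_space sW" and X: "kvec X"
    and ml: "\<And>x. x \<in> carrier X \<Longrightarrow> multilinear V N sW (f x)"
    and lin: "\<And>ys. ys \<in> tuples V N \<Longrightarrow> linear_on X sW (\<lambda>x. f x ys)"
    and t: "t \<in> tspace V N"
  shows "linear_on X sW (\<lambda>x. tlift V N sW (f x) t)"
proof -
  interpret W: vector_space sW by (rule W)
  interpret X: kvec X by (rule X)
  note ext = linear_on_tspace_ext[OF tlift_linear[OF W ml] _ _ t]
  show ?thesis
  proof (rule linear_onI)
    fix x y assume xy: "x \<in> carrier X" "y \<in> carrier X"
    note lin2 = tlift_linear[OF W ml[OF xy(1)]] tlift_linear[OF W ml[OF xy(2)]]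
    show "tlift V N sW (f (x + y)) t = tlift V N sW (f x) t + tlift V N sW (f y) t"
      by (rule ext[where L' = "\<lambda>t. tlift V N sW (f x) t + tlift V N sW (f y) t"])
        (use xy lin2 lin in \<open>auto simp: tlift_pure[OF W] ml linear_on_def algebra_simps\<close>)
  next
    fix c x assume x: "x \<in> carrier X"
    note lin2 = tlift_linear[OF W ml[OF x]]
    show "tlift V N sW (f (scl X c x)) t = sW c (tlift V N sW (f x) t)"
      by (rule ext[where L' = "\<lambda>t. sW c (tlift V N sW (f x) t)", OF _ linear_on_scale_fun[OF W lin2]])
        (use x lin in \<open>auto simp: tlift_pure[OF W] ml linear_on_def\<close>)
  qed
qed

lemma tlift_multilinear_param:
  fixes f :: "'x::ab_group_add list \<Rightarrow> 'a::ab_group_add list \<Rightarrow> 'w::ab_group_add"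
  assumes W: "vector_space sW" and X: "kvec X"
    and ml: "\<And>xs. xs \<in> tuples X M \<Longrightarrow> multilinear V N sW (f xs)"
    and lin: "\<And>ys. ys \<in> tuples V N \<Longrightarrow> multilinear X M sW (\<lambda>xs. f xs ys)"
    and t: "t \<in> tspace V N"
  shows "multilinear X M sW (\<lambda>xs. tlift V N sW (f xs) t)"
proof (rule multilinearI)
  fix xs i assume *: "xs \<in> tuples X M" "i < M"
  show "linear_on X sW (\<lambda>x. tlift V N sW (f (xs[i := x])) t)"
    using * by (intro tlift_linear_param[OF W X]) (auto intro: ml tuples_update t multilinearD[OF lin])
qed

section \<open>Concatenation of tensors\<close>

lemma multilinear_append_left:
  assumes "multilinear V (M + N) sW f" "ys \<in> tuples V N"
  shows "multilinear V M sW (\<lambda>xs. f (xs @ ys))"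
proof (rule multilinearI)
  fix xs i assume *: "xs \<in> tuples V M" "i < M"
  show "linear_on V sW (\<lambda>x. f (xs[i := x] @ ys))"
    using multilinearD[OF assms(1) tuples_append[OF *(1) assms(2)], of i] * tuples_length[OF *(1)]
    by (simp add: list_update_append)
qed

lemma multilinear_append_right:
  assumes "multilinear V (M + N) sW f" "xs \<in> tuples V M"
  shows "multilinear V N sW (\<lambda>ys. f (xs @ ys))"
proof (rule multilinearI)
  fix ys i assume *: "ys \<in> tuples V N" "i < N"
  show "linear_on V sW (\<lambda>y. f (xs @ ys[i := y]))"
    using multilinearD[OF assms(1) tuples_append[OF assms(2) *(1)], of "M + i"] * tuples_length[OF assms(2)]
    by (simp add: list_update_append)
qed

context kvec
begin

lemma tcat_pure_left:
  assumes "xs \<in> tuples V M" "t \<in> tspace V N"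
  shows "tcat V M N (pure_tensor V xs) t = tlift V N tscale (\<lambda>ys. pure_tensor V (xs @ ys)) t"
  unfolding tcat_def
  by (rule tlift_pure[OF vector_space_tscale _ assms(1)], rule tlift_multilinear_param)
    (auto intro: vector_space_tscale assms multilinear_append_left multilinear_append_right
       pure_tensor_multilinear kvec_axioms)

lemma tcat_pure:
  assumes "xs \<in> tuples V M" "ys \<in> tuples V N"
  shows "tcat V M N (pure_tensor V xs) (pure_tensor V ys) = pure_tensor V (xs @ ys)"
  using assms
  by (simp add: tcat_pure_left tlift_pure[OF vector_space_tscale
        multilinear_append_right[OF pure_tensor_multilinear]])

lemma tcat_linear_left:
  assumes "t \<in> tspace V N"
  shows "linear_on (tensor_algebra_power V M) tscale (\<lambda>s. tcat V M N s t)"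
  unfolding tcat_def
  by (rule tlift_linear', rule tlift_multilinear_param)
    (auto intro: vector_space_tscale assms multilinear_append_left multilinear_append_right
       pure_tensor_multilinear kvec_axioms)

lemma tcat_linear_right:
  assumes "s \<in> tspace V M"
  shows "linear_on (tensor_algebra_power V N) tscale (\<lambda>t. tcat V M N s t)"
  unfolding tcat_def
proof (rule tlift_linear_param[OF vector_space_tscale kvec_tensor_algebra_power _ _ assms])
  fix t assume "t \<in> carrier (tensor_algebra_power V N)"
  then show "multilinear V M tscale (\<lambda>xs. tlift V N tscale (\<lambda>ys. pure_tensor V (xs @ ys)) t)"
    by (intro tlift_multilinear_param)
      (auto intro: vector_space_tscale multilinear_append_left multilinear_append_right
         pure_tensor_multilinear kvec_axioms)
next
  fix xs assume "xs \<in> tuples V M"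
  then show "linear_on (tensor_algebra_power V N) tscale (tlift V N tscale (\<lambda>ys. pure_tensor V (xs @ ys)))"
    by (intro tlift_linear' multilinear_append_right[OF pure_tensor_multilinear])
qed

lemma tcat_closed:
  assumes "s \<in> tspace V M" "t \<in> tspace V N"
  shows "tcat V M N s t \<in> tspace V (M + N)"
proof -
  have "tcat V M N s t \<in> carrier (tensor_algebra_power V (M + N))"
  proof (rule linear_on_tspace_closed[OF _ kvec_tensor_algebra_power _ assms(1)])
    show "linear_on (tensor_algebra_power V M) (scl (tensor_algebra_power V (M + N))) (\<lambda>s. tcat V M N s t)"
      by (simp add: tcat_linear_left assms(2))
    fix xs assume xs: "xs \<in> tuples V M"
    have "tlift V N tscale (\<lambda>ys. pure_tensor V (xs @ ys)) t \<in> tspace V (M + N)"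
      by (rule tlift_closed[OF multilinear_append_right[OF pure_tensor_multilinear xs] _ assms(2)])
        (simp add: tuples_append xs)
    then show "tcat V M N (pure_tensor V xs) t \<in> carrier (tensor_algebra_power V (M + N))"
      by (simp add: tcat_pure_left xs assms(2))
  qed
  then show ?thesis by simp
qed

lemma tconcat_closed: "set ts \<subseteq> tspace V d \<Longrightarrow> tconcat V d ts \<in> tspace V (d * length ts)"
  by (induction ts) (auto intro!: tcat_closed pure_tensor_closed)

lemma tconcat_multilinear: "multilinear (tensor_algebra_power V d) N tscale (tconcat V d)"
proof (induction N)
  case (Suc N)
  show ?case
  proof (rule multilinear_ConsI)
    fix ts assume ts: "ts \<in> tuples (tensor_algebra_power V d) N"
    then have "tconcat V d ts \<in> tspace V (d * N)"
      using tconcat_closed[of ts d] by (simp add: tuples_def)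
    then show "linear_on (tensor_algebra_power V d) tscale (\<lambda>t. tconcat V d (t # ts))"
      using tcat_linear_left[of "tconcat V d ts" "d * N" d] ts by (simp add: tuples_def)
  next
    fix t assume t: "t \<in> carrier (tensor_algebra_power V d)"
    have "multilinear (tensor_algebra_power V d) N tscale (\<lambda>ts. tcat V d (d * N) t (tconcat V d ts))"
    proof (rule multilinear_compose_linear[where W = "tensor_algebra_power V (d * N)" and g = "tcat V d (d * N) t"])
      show "linear_on (tensor_algebra_power V (d * N)) tscale (tcat V d (d * N) t)"
        using t tcat_linear_right[of t d "d * N"] by simp
      show "tconcat V d ts \<in> carrier (tensor_algebra_power V (d * N))"
        if "ts \<in> tuples (tensor_algebra_power V d) N" for ts
        using that tconcat_closed[of ts d] by (simp add: tuples_def)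
    qed (simp add: Suc)
    then show "multilinear (tensor_algebra_power V d) N tscale (\<lambda>ts. tconcat V d (t # ts))"
      by (rule multilinear_cong) (simp_all add: tuples_length kvec_tensor_algebra_power)
  qed
qed simp

lemma tconcat_pure:
  "(\<And>i. i \<in> set is \<Longrightarrow> P i \<in> tuples V d) \<Longrightarrow>
    tconcat V d (map (\<lambda>i. pure_tensor V (P i)) is) = pure_tensor V (concat (map P is))"
proof (induction "is")
  case (Cons i "is")
  have "concat (map P is) \<in> tuples V (d * length is)"
    using Cons.prems by (induction "is") (auto intro: tuples_append)
  then show ?case using Cons by (simp add: tcat_pure)
qed simp

lemma tconcat_sum_PiE:
  assumes "distinct is" "\<And>i k. i \<in> set is \<Longrightarrow> k \<in> A i \<Longrightarrow> P i k \<in> tuples V d"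
  shows "tconcat V d (map (\<lambda>i. \<Sum>k\<in>A i. pure_tensor V (P i k)) is) =
    (\<Sum>g\<in>PiE (set is) A. pure_tensor V (concat (map (\<lambda>i. P i (g i)) is)))"
proof -
  have "tconcat V d (map (\<lambda>i. \<Sum>k\<in>A i. pure_tensor V (P i k)) is) =
      (\<Sum>g\<in>PiE (set is) A. tconcat V d (map (\<lambda>i. pure_tensor V (P i (g i))) is))"
    using assms
    by (intro kvec.multilinear_sum_PiE[OF kvec_tensor_algebra_power tconcat_multilinear]) auto
  also have "\<dots> = (\<Sum>g\<in>PiE (set is) A. pure_tensor V (concat (map (\<lambda>i. P i (g i)) is)))"
    using assms by (intro sum.cong refl tconcat_pure) (auto intro: PiE_mem)
  finally show ?thesis .
qed

end

section \<open>Sweedler sums\<close>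

definition bilinear_on ::
  "('a::ab_group_add, 'k::field, 'm) kalg_scheme \<Rightarrow> ('k \<Rightarrow> 'w::ab_group_add \<Rightarrow> 'w) \<Rightarrow> ('a \<Rightarrow> 'a \<Rightarrow> 'w) \<Rightarrow> bool"
  where "bilinear_on V sW f \<longleftrightarrow> multilinear V 2 sW (\<lambda>xs. f (xs ! 0) (xs ! 1))"

text \<open>A concrete finite sum for \<Delta>(x). Fixing one turns Sweedler notation, which is a
  lift from the tensor square, into ordinary sums that can be reindexed.\<close>

definition comul_rep ::
  "('a::ab_group_add, 'k::field) bialg \<Rightarrow> 'a \<Rightarrow> 'i set \<Rightarrow> ('i \<Rightarrow> 'a) \<Rightarrow> ('i \<Rightarrow> 'a) \<Rightarrow> bool"
  where "comul_rep B x A p q \<longleftrightarrow> finite A \<and> (\<forall>k\<in>A. p k \<in> carrier B \<and> q k \<in> carrier B) \<and>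
    comul B x = (\<Sum>k\<in>A. pure_tensor B [p k, q k])"

lemma comul_repD:
  assumes "comul_rep B x A p q"
  shows "finite A" "k \<in> A \<Longrightarrow> p k \<in> carrier B" "k \<in> A \<Longrightarrow> q k \<in> carrier B"
    "comul B x = (\<Sum>k\<in>A. pure_tensor B [p k, q k])"
  using assms by (simp_all add: comul_rep_def)

lemma tuples_Cons [simp]: "x # xs \<in> tuples V (Suc N) \<longleftrightarrow> x \<in> carrier V \<and> xs \<in> tuples V N"
  by (auto simp: tuples_Suc)

lemma tuples_pair [simp]: "[x, y] \<in> tuples V 2 \<longleftrightarrow> x \<in> carrier V \<and> y \<in> carrier V"
  by (simp add: numeral_2_eq_2)

lemma tuples_triple [simp]: "[x, y, z] \<in> tuples V 3 \<longleftrightarrow> x \<in> carrier V \<and> y \<in> carrier V \<and> z \<in> carrier V"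
  by (simp add: numeral_3_eq_3)

lemma tuples_2E: "xs \<in> tuples V 2 \<Longrightarrow> (\<And>x y. xs = [x, y] \<Longrightarrow> x \<in> carrier V \<Longrightarrow> y \<in> carrier V \<Longrightarrow> P) \<Longrightarrow> P"
  by (auto simp: numeral_2_eq_2 tuples_Suc)

lemma tuples_3E:
  "xs \<in> tuples V 3 \<Longrightarrow> (\<And>x y z. xs = [x, y, z] \<Longrightarrow> x \<in> carrier V \<Longrightarrow> y \<in> carrier V \<Longrightarrow> z \<in> carrier V \<Longrightarrow> P) \<Longrightarrow> P"
  by (auto simp: numeral_3_eq_3 tuples_Suc)

lemma bilinear_onI:
  assumes "\<And>y. y \<in> carrier V \<Longrightarrow> linear_on V sW (\<lambda>x. f x y)"
    and "\<And>x. x \<in> carrier V \<Longrightarrow> linear_on V sW (\<lambda>y. f x y)"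
  shows "bilinear_on V sW f"
  unfolding bilinear_on_def
proof (rule multilinearI)
  fix xs i assume xs: "xs \<in> tuples V 2" and i: "i < (2::nat)"
  from xs obtain a b where ab: "xs = [a, b]" "a \<in> carrier V" "b \<in> carrier V" by (rule tuples_2E)
  have "i = 0 \<or> i = 1" using i by auto
  then show "linear_on V sW (\<lambda>x. f (xs[i := x] ! 0) (xs[i := x] ! 1))"
    using assms ab by auto
qed

lemma trilinearI:
  assumes "\<And>y z. y \<in> carrier V \<Longrightarrow> z \<in> carrier V \<Longrightarrow> linear_on V sW (\<lambda>x. f [x, y, z])"
    and "\<And>x z. x \<in> carrier V \<Longrightarrow> z \<in> carrier V \<Longrightarrow> linear_on V sW (\<lambda>y. f [x, y, z])"
    and "\<And>x y. x \<in> carrier V \<Longrightarrow> y \<in> carrier V \<Longrightarrow> linear_on V sW (\<lambda>z. f [x, y, z])"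
  shows "multilinear V 3 sW f"
proof (rule multilinearI)
  fix xs i assume xs: "xs \<in> tuples V 3" and i: "i < (3::nat)"
  from xs obtain a b c where abc: "xs = [a, b, c]" "a \<in> carrier V" "b \<in> carrier V" "c \<in> carrier V"
    by (rule tuples_3E)
  have "i = 0 \<or> i = 1 \<or> i = 2" using i by auto
  then show "linear_on V sW (\<lambda>x. f (xs[i := x]))"
    using assms abc by auto
qed

lemma sweedler_rep:
  assumes "vector_space sW" "bilinear_on B sW f" "comul_rep B x A p q"
  shows "sweedler B sW f x = (\<Sum>k\<in>A. f (p k) (q k))"
proof -
  have "sweedler B sW f x = (\<Sum>k\<in>A. (\<lambda>xs. f (xs ! 0) (xs ! 1)) [p k, q k])"
    unfolding sweedler_def comul_repD(4)[OF assms(3)]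
    using assms(1,2) comul_repD(2,3)[OF assms(3)]
    by (intro tlift_sum) (auto simp: bilinear_on_def)
  then show ?thesis by simp
qed

lemma Hom_k_iff: "f \<in> Hom_k V \<longleftrightarrow> linear_on V (*) f"
  by (simp add: Hom_k_def)

lemma bilinear_on_mult:
  fixes V :: "('a::ab_group_add, 'k::field, 'm) kalg_scheme"
  assumes "f \<in> Hom_k V" "g \<in> Hom_k V"
  shows "bilinear_on V (*) (\<lambda>x y. f x * g y)"
  using assms by (intro bilinear_onI linear_onI) (auto simp: Hom_k_def linear_on_def algebra_simps)

lemma conv_rep:
  fixes D :: "('a::ab_group_add, 'k::field) bialg"
  assumes "f \<in> Hom_k D" "g \<in> Hom_k D" "comul_rep D x A p q"
  shows "conv D f g x = (\<Sum>k\<in>A. f (p k) * g (q k))"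
  unfolding conv_def
  by (rule sweedler_rep[OF vector_space_field bilinear_on_mult[OF assms(1,2)] assms(3)])

text \<open>Just enough coalgebra structure for Sweedler sums to exist and to be linear in the
  element. Tensor powers have it at once, and their coassociativity and counit laws are then proved
  with these sums.\<close>

locale comul_space = kvec B
  for B :: "('a::ab_group_add, 'k::field) bialg" (structure) +
  assumes comul_closed': "a \<in> carrier B \<Longrightarrow> comul B a \<in> tspace B 2"
    and comul_linear': "linear_on B tscale (comul B)"
    and counit_linear': "counit B \<in> Hom_k B"

lemma bialgebra_comul_space: "bialgebra B \<Longrightarrow> comul_space B"
  by (simp add: bialgebra_def bialgebra_axioms_def comul_space_def comul_space_axioms_def
      kvec_def kvec_axioms_def)

sublocale bialgebra \<subseteq> comul_space B
  by (rule bialgebra_comul_space) (rule bialgebra_axioms)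

context comul_space
begin

lemma comul_rep_exists:
  assumes "x \<in> carrier B"
  shows "\<exists>m p q. comul_rep B x {..<m::nat} p q"
proof -
  obtain m P where mP: "\<forall>k<m::nat. P k \<in> tuples B 2" "comul B x = (\<Sum>k<m. pure_tensor B (P k))"
    using tspace_Suc_sum[of "comul B x" 1] comul_closed'[OF assms] by (auto simp: numeral_2_eq_2)
  have "P k = [P k ! 0, P k ! 1] \<and> P k ! 0 \<in> carrier B \<and> P k ! 1 \<in> carrier B" if "k < m" for k
    using mP(1) that by (auto elim!: tuples_2E[of "P k"])
  then show ?thesis
    using mP by (intro exI[of _ m] exI[of _ "\<lambda>k. P k ! 0"] exI[of _ "\<lambda>k. P k ! 1"])
      (auto simp: comul_rep_def intro!: sum.cong)
qed

lemma linear_on_pure_singleton: "linear_on B tscale (\<lambda>y. pure_tensor B [y])"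
  using linear_on_pure_slot[of "[0]" B 1 0] by simp

lemma linear_on_pure_pair:
  "y \<in> carrier B \<Longrightarrow> linear_on B tscale (\<lambda>x. pure_tensor B [x, y])"
  "x \<in> carrier B \<Longrightarrow> linear_on B tscale (\<lambda>y. pure_tensor B [x, y])"
  using linear_on_pure_slot[of "[0, y]" B 2 0] linear_on_pure_slot[of "[x, 0]" B 2 1] by simp_all

lemma bilinear_coassoc:
  "bilinear_on B tscale (\<lambda>x y. tcat B 2 1 (comul B x) (pure_tensor B [y]))"
  "bilinear_on B tscale (\<lambda>x y. tcat B 1 2 (pure_tensor B [x]) (comul B y))"
  by (rule bilinear_onI;
      rule linear_on_compose[where W = "tensor_algebra_power B 2" and f = "comul B"]
        linear_on_compose[where W = "tensor_algebra_power B 1" and f = "\<lambda>y. pure_tensor B [y]"];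
      simp add: comul_linear' comul_closed' linear_on_pure_singleton tcat_linear_left tcat_linear_right)+

lemma sweedler_coassoc_left:
  assumes "comul_rep B x A p q" "\<And>k. k \<in> A \<Longrightarrow> comul_rep B (p k) (A' k) (p' k) (q' k)"
  shows "sweedler B tscale (\<lambda>x y. tcat B 2 1 (comul B x) (pure_tensor B [y])) x =
    (\<Sum>k\<in>A. \<Sum>l\<in>A' k. pure_tensor B [p' k l, q' k l, q k])"
  unfolding sweedler_rep[OF vector_space_tscale bilinear_coassoc(1) assms(1)]
proof (rule sum.cong[OF refl])
  fix k assume k: "k \<in> A"
  have q: "[q k] \<in> tuples B 1" using comul_repD(3)[OF assms(1) k] by simp
  have "tcat B 2 1 (comul B (p k)) (pure_tensor B [q k]) =
      (\<Sum>l\<in>A' k. tcat B 2 1 (pure_tensor B [p' k l, q' k l]) (pure_tensor B [q k]))"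
    unfolding comul_repD(4)[OF assms(2)[OF k]]
    using comul_repD(2,3)[OF assms(2)[OF k]]
    by (intro kvec.linear_on_sum[OF kvec_tensor_algebra_power tcat_linear_left[OF pure_tensor_closed[OF q]]]) simp
  also have "\<dots> = (\<Sum>l\<in>A' k. pure_tensor B [p' k l, q' k l, q k])"
    using comul_repD(2,3)[OF assms(2)[OF k]] q by (intro sum.cong refl) (simp add: tcat_pure)
  finally show "tcat B 2 1 (comul B (p k)) (pure_tensor B [q k]) =
    (\<Sum>l\<in>A' k. pure_tensor B [p' k l, q' k l, q k])" .
qed

lemma sweedler_coassoc_right:
  assumes "comul_rep B x A p q" "\<And>k. k \<in> A \<Longrightarrow> comul_rep B (q k) (A' k) (p' k) (q' k)"
  shows "sweedler B tscale (\<lambda>x y. tcat B 1 2 (pure_tensor B [x]) (comul B y)) x =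
    (\<Sum>k\<in>A. \<Sum>l\<in>A' k. pure_tensor B [p k, p' k l, q' k l])"
  unfolding sweedler_rep[OF vector_space_tscale bilinear_coassoc(2) assms(1)]
proof (rule sum.cong[OF refl])
  fix k assume k: "k \<in> A"
  have p: "[p k] \<in> tuples B 1" using comul_repD(2)[OF assms(1) k] by simp
  have "tcat B 1 2 (pure_tensor B [p k]) (comul B (q k)) =
      (\<Sum>l\<in>A' k. tcat B 1 2 (pure_tensor B [p k]) (pure_tensor B [p' k l, q' k l]))"
    unfolding comul_repD(4)[OF assms(2)[OF k]]
    using comul_repD(2,3)[OF assms(2)[OF k]]
    by (intro kvec.linear_on_sum[OF kvec_tensor_algebra_power tcat_linear_right[OF pure_tensor_closed[OF p]]]) simp
  also have "\<dots> = (\<Sum>l\<in>A' k. pure_tensor B [p k, p' k l, q' k l])"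
    using comul_repD(2,3)[OF assms(2)[OF k]] p by (intro sum.cong refl) (simp add: tcat_pure)
  finally show "tcat B 1 2 (pure_tensor B [p k]) (comul B (q k)) =
    (\<Sum>l\<in>A' k. pure_tensor B [p k, p' k l, q' k l])" .
qed

end

section \<open>The comultiplication of a tensor power\<close>

lemma multilinear_map:
  assumes F: "multilinear W N sU F" and \<phi>: "linear_on V (scl W) \<phi>" "\<And>x. x \<in> carrier V \<Longrightarrow> \<phi> x \<in> carrier W"
  shows "multilinear V N sU (\<lambda>xs. F (map \<phi> xs))"
proof (rule multilinearI)
  fix xs i assume xs: "xs \<in> tuples V N" and i: "i < N"
  have "map \<phi> xs \<in> tuples W N" using xs \<phi>(2) by (auto simp: tuples_def)
  from linear_on_compose[OF \<phi> multilinearD[OF F this i]]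
  show "linear_on V sU (\<lambda>x. F (map \<phi> (xs[i := x])))" by (simp add: map_update)
qed

lemma nth_concat_blocks:
  "a < length is \<Longrightarrow> r < d \<Longrightarrow> concat (map (\<lambda>i. map (P i) [0..<d]) is) ! (d * a + r) = P (is ! a) r"
proof (induction "is" arbitrary: a)
  case (Cons i "is")
  show ?case
  proof (cases a)
    case 0
    then show ?thesis using Cons.prems by (simp add: nth_append)
  next
    case (Suc a')
    then show ?thesis using Cons by (simp add: nth_append)
  qed
qed simp

lemma upt_2: "[0..<2] = [0, 1]"
  by (simp add: numeral_2_eq_2)

lemma upt_3: "[0..<3] = [0, 1, 2]"
  by (simp add: numeral_3_eq_3)

text \<open>
  The shuffle \<open>B\<^bsup>\<otimes>dN\<^esup> \<rightarrow> (B\<^bsup>\<otimes>N\<^esup>)\<^bsup>\<otimes>d\<^esup>\<close>: the case \<open>d = 2\<close> enters the comultiplication of the tensor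
  power, and the case \<open>d = 3\<close> transports coassociativity from \<open>B\<close>.
\<close>

definition shuffle ::
  "('a::ab_group_add, 'k::field) bialg \<Rightarrow> nat \<Rightarrow> nat \<Rightarrow> ('a, 'k) tens \<Rightarrow> (('a, 'k) tens, 'k) tens"
  where "shuffle B d N = tlift B (d * N) tscale (\<lambda>zs. pure_tensor (tensor_power B N)
    (map (\<lambda>r. pure_tensor B (map (\<lambda>i. zs ! (d * i + r)) [0..<N])) [0..<d]))"

lemma comul_tensor_power:
  "comul (tensor_power B N) = tlift B N tscale (\<lambda>hs. shuffle B 2 N (tconcat B 2 (map (comul B) hs)))"
  unfolding shuffle_def pure_tensor_algebra_power[symmetric] upt_2
  by (simp add: tensor_power_def kalg.defs bialg.defs)

text \<open>An entry of the flat tuple lands in one row and one column of the table, so linearity in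
  it is linearity of the inner pure tensor followed by that of the outer one.\<close>

lemma shuffle_multilinear:
  "multilinear B (d * N) tscale (\<lambda>zs. pure_tensor (tensor_power B N)
    (map (\<lambda>r. pure_tensor B (map (\<lambda>i. zs ! (d * i + r)) [0..<N])) [0..<d]))"
proof (rule multilinearI)
  fix zs j assume zs: "zs \<in> tuples B (d * N)" and j: "j < d * N"
  \<comment> \<open>Index \<open>j = d * a + r\<close> holds component \<open>r\<close> of tensor
    factor \<open>a\<close>.\<close>
  define a r where "a = j div d" and "r = j mod d"
  have d: "0 < d" using j by (cases d) auto
  have a: "a < N" using j by (simp add: a_def less_mult_imp_div_less mult.commute)
  have r: "r < d" using d by (simp add: r_def)
  have jj: "j = d * a + r" by (simp add: a_def r_def)
  define row where "row s = map (\<lambda>i. zs ! (d * i + s)) [0..<N]" for s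
  have idx: "d * i + s < d * N" if "i < N" "s < d" for i s
  proof -
    have "d * i + s < d * Suc i" using that by simp
    also have "\<dots> \<le> d * N" using that by (intro mult_le_mono2) simp
    finally show ?thesis .
  qed
  have row: "row s \<in> tuples B N" if "s < d" for s
    unfolding row_def using that zs idx by (intro tuples_map) (auto intro: tuples_nth)
  have upd: "map (\<lambda>i. zs[j := x] ! (d * i + s)) [0..<N] = (if s = r then (row r)[a := x] else row s)"
    if "s < d" for s x
  proof (rule nth_equalityI)
    fix i assume "i < length (map (\<lambda>i. zs[j := x] ! (d * i + s)) [0..<N])"
    then have i: "i < N" by simp
    have "(d * i + s = j) = (i = a \<and> s = r)"
    proof
      assume "d * i + s = j"
      then have "(d * i + s) div d = a" "(d * i + s) mod d = r" by (simp_all add: a_def r_def)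
      then show "i = a \<and> s = r" using that by simp
    qed (simp add: jj)
    then show "map (\<lambda>i. zs[j := x] ! (d * i + s)) [0..<N] ! i =
        (if s = r then (row r)[a := x] else row s) ! i"
      using i idx[OF i that] tuples_length[OF zs] by (auto simp: row_def nth_list_update)
  qed (simp add: row_def)
  have "map (\<lambda>s. pure_tensor B (map (\<lambda>i. zs[j := x] ! (d * i + s)) [0..<N])) [0..<d] =
      (map (\<lambda>s. pure_tensor B (row s)) [0..<d])[r := pure_tensor B ((row r)[a := x])]" for x
    using upd by (intro nth_equalityI) (auto simp: nth_list_update)
  moreover have "linear_on B tscale (\<lambda>x. pure_tensor (tensor_power B N)
      ((map (\<lambda>s. pure_tensor B (row s)) [0..<d])[r := pure_tensor B ((row r)[a := x])]))"
  proof (rule linear_on_compose[where W = "tensor_power B N" and f = "\<lambda>x. pure_tensor B ((row r)[a := x])"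
        and g = "\<lambda>t. pure_tensor (tensor_power B N) ((map (\<lambda>s. pure_tensor B (row s)) [0..<d])[r := t])"])
    show "linear_on B (scl (tensor_power B N)) (\<lambda>x. pure_tensor B ((row r)[a := x]))"
      using linear_on_pure_slot[OF row[OF r] a] by simp
    show "pure_tensor B ((row r)[a := x]) \<in> carrier (tensor_power B N)" if "x \<in> carrier B" for x
      using that by (simp add: tuples_update row r)
    show "linear_on (tensor_power B N) tscale (\<lambda>t. pure_tensor (tensor_power B N)
        ((map (\<lambda>s. pure_tensor B (row s)) [0..<d])[r := t]))"
      using row r by (intro linear_on_pure_slot tuples_map) auto
  qed
  ultimately show "linear_on B tscale (\<lambda>x. pure_tensor (tensor_power B N)
      (map (\<lambda>r. pure_tensor B (map (\<lambda>i. zs[j := x] ! (d * i + r)) [0..<N])) [0..<d]))"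
    by simp
qed

lemma shuffle_linear: "linear_on (tensor_algebra_power B (d * N)) tscale (shuffle B d N)"
  unfolding shuffle_def by (rule tlift_linear'[OF shuffle_multilinear])

lemma tuples_concat_blocks:
  assumes "\<And>i r. i \<in> set is \<Longrightarrow> r < d \<Longrightarrow> P i r \<in> carrier B"
  shows "concat (map (\<lambda>i. map (P i) [0..<d]) is) \<in> tuples B (d * length is)"
  using assms by (induction "is") (auto intro!: tuples_append tuples_map)

lemma shuffle_pure:
  assumes "\<And>i r. i \<in> set is \<Longrightarrow> r < d \<Longrightarrow> P i r \<in> carrier B" and N: "length is = N"
  shows "shuffle B d N (pure_tensor B (concat (map (\<lambda>i. map (P i) [0..<d]) is))) =
    pure_tensor (tensor_power B N) (map (\<lambda>r. pure_tensor B (map (\<lambda>i. P i r) is)) [0..<d])"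
proof -
  have "map (\<lambda>a. concat (map (\<lambda>i. map (P i) [0..<d]) is) ! (d * a + r)) [0..<N] = map (\<lambda>i. P i r) is"
    if "r < d" for r
    using that N by (intro nth_equalityI) (auto simp: nth_concat_blocks)
  then have eq: "map (\<lambda>r. pure_tensor B (map (\<lambda>a. concat (map (\<lambda>i. map (P i) [0..<d]) is) ! (d * a + r)) [0..<N])) [0..<d]
      = map (\<lambda>r. pure_tensor B (map (\<lambda>i. P i r) is)) [0..<d]"
    by simp
  have tup: "concat (map (\<lambda>i. map (P i) [0..<d]) is) \<in> tuples B (d * N)"
    using tuples_concat_blocks[of "is" d P B] assms by simp
  show ?thesis
    unfolding shuffle_def tlift_pure[OF vector_space_tscale shuffle_multilinear tup] eq ..
qed

lemma (in kvec) tconcat_closed': "ts \<in> tuples (tensor_algebra_power V d) N \<Longrightarrow> tconcat V d ts \<in> tspace V (d * N)"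
  using tconcat_closed[of ts d] by (auto simp: tuples_def)

context comul_space
begin

text \<open>Concatenation is multilinear, so the sums are expanded before shuffling, and the shuffle
  has to be computed on pure tensors only.\<close>

lemma shuffle_sum_PiE:
  assumes "distinct is" "length is = N"
    and P: "\<And>i k r. i \<in> set is \<Longrightarrow> k \<in> A i \<Longrightarrow> r < d \<Longrightarrow> P i k r \<in> carrier B"
  shows "shuffle B d N (tconcat B d (map (\<lambda>i. \<Sum>k\<in>A i. pure_tensor B (map (P i k) [0..<d])) is)) =
    (\<Sum>g\<in>PiE (set is) A. pure_tensor (tensor_power B N)
      (map (\<lambda>r. pure_tensor B (map (\<lambda>i. P i (g i) r) is)) [0..<d]))"
proof -
  have g: "P i (g i) r \<in> carrier B" if "g \<in> PiE (set is) A" "i \<in> set is" "r < d" for g i r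
    using P[OF that(2) PiE_mem[OF that(1,2)] that(3)] .
  have "shuffle B d N (tconcat B d (map (\<lambda>i. \<Sum>k\<in>A i. pure_tensor B (map (P i k) [0..<d])) is)) =
      shuffle B d N (\<Sum>g\<in>PiE (set is) A. pure_tensor B (concat (map (\<lambda>i. map (P i (g i)) [0..<d]) is)))"
    using assms by (subst tconcat_sum_PiE) (auto intro: tuples_map)
  also have "\<dots> = (\<Sum>g\<in>PiE (set is) A. shuffle B d N
      (pure_tensor B (concat (map (\<lambda>i. map (P i (g i)) [0..<d]) is))))"
    using tuples_concat_blocks[of "is" d _ B] g assms(2)
    by (intro kvec.linear_on_sum[OF kvec_tensor_algebra_power shuffle_linear]) auto
  also have "\<dots> = (\<Sum>g\<in>PiE (set is) A. pure_tensor (tensor_power B N)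
      (map (\<lambda>r. pure_tensor B (map (\<lambda>i. P i (g i) r) is)) [0..<d]))"
    using g assms(2) by (intro sum.cong refl shuffle_pure) auto
  finally show ?thesis .
qed

lemma comul_tensor_power_multilinear:
  "multilinear B N tscale (\<lambda>hs. shuffle B 2 N (tconcat B 2 (map (comul B) hs)))"
proof (rule multilinear_map[where W = "tensor_algebra_power B 2"])
  show "multilinear (tensor_algebra_power B 2) N tscale (\<lambda>ts. shuffle B 2 N (tconcat B 2 ts))"
    by (rule multilinear_compose_linear[where W = "tensor_algebra_power B (2 * N)"
          and f = "tconcat B 2" and g = "shuffle B 2 N"])
      (simp_all add: tconcat_multilinear shuffle_linear tconcat_closed')
qed (simp_all add: comul_linear' comul_closed')

lemma comul_tensor_power_linear: "linear_on (tensor_power B N) tscale (comul (tensor_power B N))"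
  unfolding linear_on_tensor_power comul_tensor_power
  by (rule tlift_linear'[OF comul_tensor_power_multilinear])

text \<open>Splitting a pure tensor means choosing a summand of the comultiplication of
  \<open>v i\<close> in each factor and collecting left and right components separately. Nearly
  every later computation with comultiplications starts from this representation.\<close>

lemma comul_rep_tensor_power:
  assumes "distinct is" "length is = N" and v: "\<And>i. i \<in> set is \<Longrightarrow> v i \<in> carrier B"
    and r: "\<And>i. i \<in> set is \<Longrightarrow> comul_rep B (v i) (A i) (p i) (q i)"
  shows "comul_rep (tensor_power B N) (pure_tensor B (map v is)) (PiE (set is) A)
    (\<lambda>g. pure_tensor B (map (\<lambda>i. p i (g i)) is)) (\<lambda>g. pure_tensor B (map (\<lambda>i. q i (g i)) is))"
proof -
  \<comment> \<open>The two components are indexed by their position \<open>s\<close>, the form in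
    which \<open>shuffle\<close> accepts them.\<close>
  let ?P = "\<lambda>i k s. if s = (0::nat) then p i k else q i k"
  have "comul (tensor_power B N) (pure_tensor B (map v is)) =
      shuffle B 2 N (tconcat B 2 (map (comul B) (map v is)))"
    unfolding comul_tensor_power using assms(2) v
    by (intro tlift_pure[OF vector_space_tscale comul_tensor_power_multilinear] tuples_map) auto
  also have "map (comul B) (map v is) = map (\<lambda>i. \<Sum>k\<in>A i. pure_tensor B (map (?P i k) [0..<2])) is"
    using comul_repD(4)[OF r] by (simp add: numeral_2_eq_2)
  also have "shuffle B 2 N (tconcat B 2 \<dots>) = (\<Sum>g\<in>PiE (set is) A. pure_tensor (tensor_power B N)
      (map (\<lambda>s. pure_tensor B (map (\<lambda>i. ?P i (g i) s) is)) [0..<2]))"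
    using assms(1,2) comul_repD(2,3)[OF r] by (intro shuffle_sum_PiE) auto
  also have "\<dots> = (\<Sum>g\<in>PiE (set is) A. pure_tensor (tensor_power B N)
      [pure_tensor B (map (\<lambda>i. p i (g i)) is), pure_tensor B (map (\<lambda>i. q i (g i)) is)])"
    by (simp add: numeral_2_eq_2)
  finally have "comul (tensor_power B N) (pure_tensor B (map v is)) = \<dots>" .
  moreover have "finite (PiE (set is) A)"
    using comul_repD(1)[OF r] by (intro finite_PiE) auto
  moreover have "p i (g i) \<in> carrier B \<and> q i (g i) \<in> carrier B" if "g \<in> PiE (set is) A" "i \<in> set is" for g i
    using comul_repD(2,3)[OF r[OF that(2)] PiE_mem[OF that]] by simp
  ultimately show ?thesis
    using assms(2) by (auto simp: comul_rep_def intro!: pure_tensor_closed tuples_map)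
qed

end

section \<open>Tensor powers are bialgebras\<close>

text \<open>Only the bilinear product, without associativity or unit. The tensor square of a tensor
  power can then be multiplied while the bialgebra axioms of that power are still being
  proved.\<close>

locale kalg_space = kvec V
  for V :: "('a::ab_group_add, 'k::field, 'm) kalg_scheme" (structure) +
  assumes kmult_closed: "x \<in> carrier V \<Longrightarrow> y \<in> carrier V \<Longrightarrow> x \<otimes> y \<in> carrier V"
    and kmult_left: "y \<in> carrier V \<Longrightarrow> linear_on V (scl V) (\<lambda>x. x \<otimes> y)"
    and kmult_right: "x \<in> carrier V \<Longrightarrow> linear_on V (scl V) (\<lambda>y. x \<otimes> y)"

lemma (in bialgebra) bialgebra_kalg_space: "kalg_space B"
  apply (rule kalg_space.intro)
  apply (rule kvec_axioms)
  apply (rule kalg_space_axioms.intro)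
  apply (erule (1) m_closed)
  apply (erule mult_linear_left)
  apply (erule mult_linear_right)
  done

sublocale bialgebra \<subseteq> kalg_space B
  by (rule bialgebra_kalg_space)

lemma tuples_map2:
  assumes "\<And>x y. x \<in> carrier V \<Longrightarrow> y \<in> carrier V \<Longrightarrow> f x y \<in> carrier V"
    "xs \<in> tuples V N" "ys \<in> tuples V N"
  shows "map2 f xs ys \<in> tuples V N"
proof -
  have "f x y \<in> carrier V" if "(x, y) \<in> set (zip xs ys)" for x y
    using assms set_zip_leftD[OF that] set_zip_rightD[OF that] by (auto simp: tuples_def)
  then show ?thesis using assms(2,3) by (auto simp: tuples_def)
qed

context kalg_space
begin

lemma tmult_multilinear_right:
  assumes "xs \<in> tuples V N"
  shows "multilinear V N tscale (\<lambda>ys. pure_tensor V (map2 (mult V) xs ys))"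
proof (rule multilinearI)
  fix ys i assume ys: "ys \<in> tuples V N" and i: "i < N"
  have "map2 (mult V) xs (ys[i := y]) = (map2 (mult V) xs ys)[i := xs ! i \<otimes> y]" for y
    using i tuples_length[OF ys] tuples_length[OF assms]
    by (intro nth_equalityI) (auto simp: nth_list_update)
  moreover have "linear_on V tscale (\<lambda>y. pure_tensor V ((map2 (mult V) xs ys)[i := xs ! i \<otimes> y]))"
    using i ys assms tuples_nth[OF assms i]
    by (intro linear_on_compose[where W = V and f = "\<lambda>y. xs ! i \<otimes> y"
          and g = "\<lambda>y. pure_tensor V ((map2 (mult V) xs ys)[i := y])"])
      (auto intro: kmult_right kmult_closed linear_on_pure_slot tuples_map2)
  ultimately show "linear_on V tscale (\<lambda>y. pure_tensor V (map2 (mult V) xs (ys[i := y])))" by simp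
qed

lemma tmult_multilinear_left:
  assumes "ys \<in> tuples V N"
  shows "multilinear V N tscale (\<lambda>xs. pure_tensor V (map2 (mult V) xs ys))"
proof (rule multilinearI)
  fix xs i assume xs: "xs \<in> tuples V N" and i: "i < N"
  have "map2 (mult V) (xs[i := x]) ys = (map2 (mult V) xs ys)[i := x \<otimes> ys ! i]" for x
    using i tuples_length[OF xs] tuples_length[OF assms]
    by (intro nth_equalityI) (auto simp: nth_list_update)
  moreover have "linear_on V tscale (\<lambda>x. pure_tensor V ((map2 (mult V) xs ys)[i := x \<otimes> ys ! i]))"
    using i xs assms tuples_nth[OF assms i]
    by (intro linear_on_compose[where W = V and f = "\<lambda>x. x \<otimes> ys ! i"
          and g = "\<lambda>y. pure_tensor V ((map2 (mult V) xs ys)[i := y])"])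
      (auto intro: kmult_left kmult_closed linear_on_pure_slot tuples_map2)
  ultimately show "linear_on V tscale (\<lambda>x. pure_tensor V (map2 (mult V) (xs[i := x]) ys))" by simp
qed

lemma tmult_def:
  "s \<otimes>\<^bsub>tensor_algebra_power V N\<^esub> t = tlift V N tscale (\<lambda>xs. tlift V N tscale
    (\<lambda>ys. pure_tensor V (map2 (mult V) xs ys)) t) s"
  by (simp add: tensor_algebra_power_def)

lemma tmult_inner_multilinear:
  "t \<in> tspace V N \<Longrightarrow>
    multilinear V N tscale (\<lambda>xs. tlift V N tscale (\<lambda>ys. pure_tensor V (map2 (mult V) xs ys)) t)"
  by (rule tlift_multilinear_param)
    (auto intro: vector_space_tscale tmult_multilinear_right tmult_multilinear_left kvec_axioms)

lemma tmult_pure: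
  assumes "xs \<in> tuples V N" "ys \<in> tuples V N"
  shows "pure_tensor V xs \<otimes>\<^bsub>tensor_algebra_power V N\<^esub> pure_tensor V ys = pure_tensor V (map2 (mult V) xs ys)"
  unfolding tmult_def using assms
  by (simp add: tlift_pure[OF vector_space_tscale tmult_inner_multilinear]
      tlift_pure[OF vector_space_tscale tmult_multilinear_right])

lemma tmult_linear_left:
  "t \<in> tspace V N \<Longrightarrow> linear_on (tensor_algebra_power V N) tscale (\<lambda>s. s \<otimes>\<^bsub>tensor_algebra_power V N\<^esub> t)"
  unfolding tmult_def by (intro tlift_linear' tmult_inner_multilinear)

lemma tmult_linear_right:
  assumes "s \<in> tspace V N"
  shows "linear_on (tensor_algebra_power V N) tscale (\<lambda>t. s \<otimes>\<^bsub>tensor_algebra_power V N\<^esub> t)"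
  unfolding tmult_def
  by (rule tlift_linear_param[OF vector_space_tscale kvec_tensor_algebra_power _ _ assms])
    (simp_all add: tmult_inner_multilinear tlift_linear' tmult_multilinear_right)

lemma tmult_closed:
  assumes "s \<in> tspace V N" "t \<in> tspace V N"
  shows "s \<otimes>\<^bsub>tensor_algebra_power V N\<^esub> t \<in> tspace V N"
  unfolding tmult_def
proof (rule tlift_closed[OF tmult_inner_multilinear[OF assms(2)] _ assms(1)])
  fix xs assume "xs \<in> tuples V N"
  then show "tlift V N tscale (\<lambda>ys. pure_tensor V (map2 (mult V) xs ys)) t \<in> tspace V N"
    by (intro tlift_closed[OF tmult_multilinear_right _ assms(2)] pure_tensor_closed tuples_map2)
      (auto intro: kmult_closed)
qed

lemma tmult_sum:
  assumes "\<And>k. k \<in> A \<Longrightarrow> P k \<in> tuples V N" "\<And>l. l \<in> A' \<Longrightarrow> Q l \<in> tuples V N"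
  shows "(\<Sum>k\<in>A. pure_tensor V (P k)) \<otimes>\<^bsub>tensor_algebra_power V N\<^esub> (\<Sum>l\<in>A'. pure_tensor V (Q l)) =
    (\<Sum>k\<in>A. \<Sum>l\<in>A'. pure_tensor V (map2 (mult V) (P k) (Q l)))"
proof -
  have Q: "(\<Sum>l\<in>A'. pure_tensor V (Q l)) \<in> tspace V N"
    using assms by (intro tspace_sum) auto
  have "(\<Sum>k\<in>A. pure_tensor V (P k)) \<otimes>\<^bsub>tensor_algebra_power V N\<^esub> (\<Sum>l\<in>A'. pure_tensor V (Q l)) =
      (\<Sum>k\<in>A. pure_tensor V (P k) \<otimes>\<^bsub>tensor_algebra_power V N\<^esub> (\<Sum>l\<in>A'. pure_tensor V (Q l)))"
    using assms by (intro kvec.linear_on_sum[OF kvec_tensor_algebra_power tmult_linear_left[OF Q]]) auto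
  also have "\<dots> = (\<Sum>k\<in>A. \<Sum>l\<in>A'. pure_tensor V (P k) \<otimes>\<^bsub>tensor_algebra_power V N\<^esub> pure_tensor V (Q l))"
    using assms
    by (intro sum.cong refl kvec.linear_on_sum[OF kvec_tensor_algebra_power
          tmult_linear_right[OF pure_tensor_closed]]) auto
  also have "\<dots> = (\<Sum>k\<in>A. \<Sum>l\<in>A'. pure_tensor V (map2 (mult V) (P k) (Q l)))"
    using assms by (intro sum.cong refl tmult_pure) auto
  finally show ?thesis .
qed

end

lemma (in comul_space) sweedler_linear:
  assumes "vector_space sW" "bilinear_on B sW f"
  shows "linear_on B sW (sweedler B sW f)"
  unfolding sweedler_def
  by (rule linear_on_compose[where W = "tensor_algebra_power B 2" and f = "comul B"])
    (use assms in \<open>auto simp: comul_linear' comul_closed' bilinear_on_def intro: tlift_linear\<close>)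

context comul_space
begin

lemma counit_multilinear: "multilinear B N (*) (\<lambda>hs. prod_list (map (counit B) hs))"
proof (induction N)
  case (Suc N)
  show ?case
  proof (rule multilinear_ConsI)
    fix xs
    show "linear_on B (*) (\<lambda>x. prod_list (map (counit B) (x # xs)))"
      using counit_linear' by (simp add: Hom_k_def linear_on_def algebra_simps)
  next
    fix x
    have "Vector_Spaces.linear (*) (*) (\<lambda>y. counit B x * y)"
      by (simp add: Vector_Spaces.linear_iff vector_space_field algebra_simps)
    from multilinear_post[OF Suc this]
    show "multilinear B N (*) (\<lambda>xs. prod_list (map (counit B) (x # xs)))" by simp
  qed
qed simp

lemma counit_tensor_power_linear: "linear_on (tensor_power B N) (*) (counit (tensor_power B N))"
  unfolding linear_on_tensor_power counit_tensor_power
  by (rule tlift_linear[OF vector_space_field counit_multilinear])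

lemma counit_pure: "xs \<in> tuples B N \<Longrightarrow> counit (tensor_power B N) (pure_tensor B xs) = prod_list (map (counit B) xs)"
  unfolding counit_tensor_power by (rule tlift_pure[OF vector_space_field counit_multilinear])

lemma counit_pure_map:
  assumes "distinct is" "length is = N" "\<And>i. i \<in> set is \<Longrightarrow> v i \<in> carrier B"
  shows "counit (tensor_power B N) (pure_tensor B (map v is)) = (\<Prod>i\<in>set is. counit B (v i))"
  using assms
  by (subst counit_pure) (auto intro: tuples_map simp: prod.distinct_set_conv_list comp_def)

text \<open>Sweedler sums chosen for a whole family at once. Initial segments of the naturals serve
  as index sets, so that the choices for different elements have the same type.\<close>

lemma ex_comul_reps:
  assumes "\<And>i. i \<in> I \<Longrightarrow> v i \<in> carrier B"
  obtains m p q where "\<And>i. i \<in> I \<Longrightarrow> comul_rep B (v i) {..<m i::nat} (p i) (q i)"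
proof -
  have "\<forall>i. \<exists>m p q. i \<in> I \<longrightarrow> comul_rep B (v i) {..<m::nat} p q"
    using comul_rep_exists assms by blast
  then show ?thesis using that by metis
qed

lemma comul_tensor_power_closed:
  assumes "t \<in> tspace B N"
  shows "comul (tensor_power B N) t \<in> tspace (tensor_power B N) 2"
proof -
  have "comul (tensor_power B N) t \<in> carrier (tensor_algebra_power (tensor_power B N) 2)"
  proof (rule linear_on_tspace_closed[OF _ kvec_tensor_algebra_power _ assms])
    show "linear_on (tensor_algebra_power B N) (scl (tensor_algebra_power (tensor_power B N) 2))
      (comul (tensor_power B N))"
      using comul_tensor_power_linear[of N] by (simp add: linear_on_tensor_power)
    fix xs assume xs: "xs \<in> tuples B N"
    then have v: "\<And>i. i \<in> set [0..<N] \<Longrightarrow> xs ! i \<in> carrier B" by (auto intro: tuples_nth)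
    obtain m p q where r: "\<And>i. i \<in> set [0..<N] \<Longrightarrow> comul_rep B (xs ! i) {..<m i::nat} (p i) (q i)"
      by (rule ex_comul_reps[of "set [0..<N]" "(!) xs", OF v], assumption, rule that)
    have eq: "map ((!) xs) [0..<N] = xs" using tuples_length[OF xs] map_nth by blast
    have R: "comul_rep (tensor_power B N) (pure_tensor B xs) (PiE (set [0..<N]) (\<lambda>i. {..<m i}))
      (\<lambda>g. pure_tensor B (map (\<lambda>i. p i (g i)) [0..<N])) (\<lambda>g. pure_tensor B (map (\<lambda>i. q i (g i)) [0..<N]))"
      using comul_rep_tensor_power[of "[0..<N]" N "(!) xs", OF _ _ v r] unfolding eq by simp
    show "comul (tensor_power B N) (pure_tensor B xs) \<in> carrier (tensor_algebra_power (tensor_power B N) 2)"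
      unfolding comul_repD(4)[OF R] using comul_repD(2,3)[OF R] by (auto intro!: tspace_sum)
  qed
  then show ?thesis by simp
qed

lemma comul_space_tensor_power: "comul_space (tensor_power B N)"
  by (intro comul_space.intro kvec_tensor_power comul_space_axioms.intro)
    (simp_all add: comul_tensor_power_closed comul_tensor_power_linear Hom_k_def counit_tensor_power_linear)

end

lemma pure_tensor_nth_map: "xs \<in> tuples V N \<Longrightarrow> pure_tensor V xs = pure_tensor V (map ((!) xs) [0..<N])"
  using tuples_length map_nth by metis

context bialgebra
begin

lemma bilinear_counit:
  "bilinear_on B (scl B) (\<lambda>x y. scl B (counit B x) y)"
  "bilinear_on B (scl B) (\<lambda>x y. scl B (counit B y) x)"
  using counit_linear
  by (auto intro!: bilinear_onI linear_onI simp: Hom_k_def linear_on_def algebra_simps scale_left_commute)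

lemma counit_rep:
  assumes "x \<in> carrier B" "comul_rep B x A p q"
  shows "(\<Sum>k\<in>A. scl B (counit B (p k)) (q k)) = x" "(\<Sum>k\<in>A. scl B (counit B (q k)) (p k)) = x"
  using counit_left[OF assms(1)] counit_right[OF assms(1)]
    sweedler_rep[OF vector_space_axioms bilinear_counit(1) assms(2)]
    sweedler_rep[OF vector_space_axioms bilinear_counit(2) assms(2)] by simp_all

lemma comul_rep_mult:
  assumes "x \<in> carrier B" "y \<in> carrier B" "comul_rep B x A p q" "comul_rep B y A' p' q'"
  shows "comul_rep B (x \<otimes> y) (A \<times> A') (\<lambda>(k, l). p k \<otimes> p' l) (\<lambda>(k, l). q k \<otimes> q' l)"
  using comul_repD[OF assms(3)] comul_repD[OF assms(4)]
  by (auto simp: comul_rep_def comul_mult[OF assms(1,2)] tmult_sum sum.cartesian_product intro!: sum.cong)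

text \<open>With \<open>undefined\<close> as the only index, an extensional choice function over any
  set of factors is the constant \<open>\<lambda>_. undefined\<close>, which makes the
  comultiplication of the unit of a tensor power a one-term sum.\<close>

lemma comul_rep_one: "comul_rep B \<one> {undefined::nat} (\<lambda>_. \<one>) (\<lambda>_. \<one>)"
  by (simp add: comul_rep_def comul_one numeral_2_eq_2)

lemma coassoc_rep:
  assumes x: "x \<in> carrier B" and r: "comul_rep B x A p q"
    and r1: "\<And>k. k \<in> A \<Longrightarrow> comul_rep B (p k) (A1 k) (p1 k) (q1 k)"
    and r2: "\<And>k. k \<in> A \<Longrightarrow> comul_rep B (q k) (A2 k) (p2 k) (q2 k)"
  shows "(\<Sum>k\<in>A. \<Sum>l\<in>A1 k. pure_tensor B [p1 k l, q1 k l, q k]) =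
    (\<Sum>k\<in>A. \<Sum>l\<in>A2 k. pure_tensor B [p k, p2 k l, q2 k l])"
  using coassoc[OF x] sweedler_coassoc_left[OF r r1] sweedler_coassoc_right[OF r r2] by simp

end

text \<open>In the application the left side is a twofold comultiplication of a pure tensor. On the
  right, everything that happens in factor \<open>i\<close> has been gathered into a single tensor,
  where an identity of \<open>B\<close> can be inserted.\<close>

lemma (in comul_space) shuffle_nested_sum:
  assumes "distinct is" "length is = N"
    and fin: "\<And>i. i \<in> set is \<Longrightarrow> finite (A i)"
      "\<And>i k. i \<in> set is \<Longrightarrow> k \<in> A i \<Longrightarrow> finite (A' i k)"
    and P: "\<And>i k l s. i \<in> set is \<Longrightarrow> k \<in> A i \<Longrightarrow> l \<in> A' i k \<Longrightarrow> s < d \<Longrightarrow> P i k l s \<in> carrier B"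
  shows "(\<Sum>g\<in>PiE (set is) A. \<Sum>h\<in>PiE (set is) (\<lambda>i. A' i (g i)). pure_tensor (tensor_power B N)
      (map (\<lambda>s. pure_tensor B (map (\<lambda>i. P i (g i) (h i) s) is)) [0..<d])) =
    shuffle B d N (tconcat B d (map (\<lambda>i. \<Sum>k\<in>A i. \<Sum>l\<in>A' i k. pure_tensor B (map (P i k l) [0..<d])) is))"
proof -
  have "(\<Sum>g\<in>PiE (set is) A. \<Sum>h\<in>PiE (set is) (\<lambda>i. A' i (g i)). pure_tensor (tensor_power B N)
      (map (\<lambda>s. pure_tensor B (map (\<lambda>i. P i (g i) (h i) s) is)) [0..<d])) =
    (\<Sum>e\<in>PiE (set is) (\<lambda>i. Sigma (A i) (A' i)). pure_tensor (tensor_power B N)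
      (map (\<lambda>s. pure_tensor B (map (\<lambda>i. P i (fst (e i)) (snd (e i)) s) is)) [0..<d]))"
    using fin by (subst sum_PiE_Sigma)
      (auto intro!: sum.cong arg_cong[where f = "pure_tensor (tensor_power B N)"] arg_cong[where f = "pure_tensor B"])
  also have "\<dots> = shuffle B d N (tconcat B d (map (\<lambda>i. \<Sum>e\<in>Sigma (A i) (A' i).
      pure_tensor B (map (P i (fst e) (snd e)) [0..<d])) is))"
    using assms(1,2) P by (intro shuffle_sum_PiE[symmetric]) auto
  also have "map (\<lambda>i. \<Sum>e\<in>Sigma (A i) (A' i). pure_tensor B (map (P i (fst e) (snd e)) [0..<d])) is =
      map (\<lambda>i. \<Sum>k\<in>A i. \<Sum>l\<in>A' i k. pure_tensor B (map (P i k l) [0..<d])) is"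
    using fin by (intro map_cong refl) (simp add: sum.Sigma case_prod_unfold)
  finally show ?thesis .
qed

lemma map_nth3: "map ((!) [x, y, z]) [0..<3] = [x, y, z]"
  by (simp add: upt_3)

context bialgebra
begin

lemma tensor_power_coassoc:
  assumes xs: "xs \<in> tuples B N"
  defines "T \<equiv> tensor_power B N"
  shows "sweedler T tscale (\<lambda>x y. tcat T 2 1 (comul T x) (pure_tensor T [y])) (pure_tensor B xs) =
    sweedler T tscale (\<lambda>x y. tcat T 1 2 (pure_tensor T [x]) (comul T y)) (pure_tensor B xs)"
proof -
  interpret T: comul_space T unfolding T_def by (rule comul_space_tensor_power)
  let ?is = "[0..<N]" and ?I = "set [0..<N]"
  have v: "xs ! i \<in> carrier B" if "i \<in> ?I" for i
    using that xs by (auto intro: tuples_nth)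
  obtain m p q where r: "\<And>i. i \<in> ?I \<Longrightarrow> comul_rep B (xs ! i) {..<m i::nat} (p i) (q i)"
    by (rule ex_comul_reps[of ?I "(!) xs", OF v], assumption, rule that)
  have p: "p (fst z) (snd z) \<in> carrier B" and q: "q (fst z) (snd z) \<in> carrier B"
    if "z \<in> Sigma ?I (\<lambda>i. {..<m i})" for z
    using that comul_repD(2,3)[OF r] by (auto simp del: set_upt)
  \<comment> \<open>The second splitting is chosen for each summand \<open>k\<close> of each factor
    \<open>i\<close>, hence indexed by pairs \<open>(i, k)\<close>.\<close>
  obtain m1 p1 q1 where r1: "\<And>z. z \<in> Sigma ?I (\<lambda>i. {..<m i}) \<Longrightarrow>
      comul_rep B (p (fst z) (snd z)) {..<m1 z::nat} (p1 z) (q1 z)"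
    by (rule ex_comul_reps[of "Sigma ?I (\<lambda>i. {..<m i})" "\<lambda>z. p (fst z) (snd z)", OF p], assumption, rule that)
  obtain m2 p2 q2 where r2: "\<And>z. z \<in> Sigma ?I (\<lambda>i. {..<m i}) \<Longrightarrow>
      comul_rep B (q (fst z) (snd z)) {..<m2 z::nat} (p2 z) (q2 z)"
    by (rule ex_comul_reps[of "Sigma ?I (\<lambda>i. {..<m i})" "\<lambda>z. q (fst z) (snd z)", OF q], assumption, rule that)
  let ?A = "\<lambda>i. {..<m i}"
  let ?A1 = "\<lambda>i k. {..<m1 (i, k)}" and ?A2 = "\<lambda>i k. {..<m2 (i, k)}"
  have R: "comul_rep T (pure_tensor B xs) (PiE ?I ?A)
    (\<lambda>g. pure_tensor B (map (\<lambda>i. p i (g i)) ?is)) (\<lambda>g. pure_tensor B (map (\<lambda>i. q i (g i)) ?is))"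
    unfolding T_def pure_tensor_nth_map[OF xs]
    by (rule comul_rep_tensor_power) (use v r in auto)
  have R1: "comul_rep T (pure_tensor B (map (\<lambda>i. p i (g i)) ?is)) (PiE ?I (\<lambda>i. ?A1 i (g i)))
    (\<lambda>h. pure_tensor B (map (\<lambda>i. p1 (i, g i) (h i)) ?is))
    (\<lambda>h. pure_tensor B (map (\<lambda>i. q1 (i, g i) (h i)) ?is))"
    if "g \<in> PiE ?I ?A" for g
    unfolding T_def
    by (rule comul_rep_tensor_power)
      (use PiE_mem[OF that] comul_repD(2)[OF r] r1[of "(_, g _)"] in \<open>auto simp del: set_upt\<close>)
  have R2: "comul_rep T (pure_tensor B (map (\<lambda>i. q i (g i)) ?is)) (PiE ?I (\<lambda>i. ?A2 i (g i)))
    (\<lambda>h. pure_tensor B (map (\<lambda>i. p2 (i, g i) (h i)) ?is))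
    (\<lambda>h. pure_tensor B (map (\<lambda>i. q2 (i, g i) (h i)) ?is))"
    if "g \<in> PiE ?I ?A" for g
    unfolding T_def
    by (rule comul_rep_tensor_power)
      (use PiE_mem[OF that] comul_repD(3)[OF r] r2[of "(_, g _)"] in \<open>auto simp del: set_upt\<close>)
  have "sweedler T tscale (\<lambda>x y. tcat T 2 1 (comul T x) (pure_tensor T [y])) (pure_tensor B xs) =
    (\<Sum>g\<in>PiE ?I ?A. \<Sum>h\<in>PiE ?I (\<lambda>i. ?A1 i (g i)). pure_tensor T (map (\<lambda>s. pure_tensor B (map (\<lambda>i.
      [p1 (i, g i) (h i), q1 (i, g i) (h i), q i (g i)] ! s) ?is)) [0..<3]))"
    using T.sweedler_coassoc_left[OF R R1] by (simp add: upt_3)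
  also have "\<dots> = shuffle B 3 N (tconcat B 3 (map (\<lambda>i. \<Sum>k\<in>?A i. \<Sum>l\<in>?A1 i k.
      pure_tensor B (map ((!) [p1 (i, k) l, q1 (i, k) l, q i k]) [0..<3])) ?is))"
    unfolding T_def
  proof (rule shuffle_nested_sum)
    fix i k l s assume *: "i \<in> ?I" "k \<in> ?A i" "l \<in> ?A1 i k" "s < (3::nat)"
    then have "(i, k) \<in> Sigma ?I ?A" by auto
    from comul_repD(2,3)[OF r1[OF this], of l] comul_repD(3)[OF r[OF *(1)], of k]
    show "[p1 (i, k) l, q1 (i, k) l, q i k] ! s \<in> carrier B"
      using * by (auto simp: numeral_3_eq_3 less_Suc_eq)
  qed auto
  \<comment> \<open>Coassociativity of \<open>B\<close>, in each factor separately.\<close>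
  also have "map (\<lambda>i. \<Sum>k\<in>?A i. \<Sum>l\<in>?A1 i k. pure_tensor B (map ((!) [p1 (i, k) l, q1 (i, k) l, q i k]) [0..<3])) ?is =
      map (\<lambda>i. \<Sum>k\<in>?A i. \<Sum>l\<in>?A2 i k. pure_tensor B (map ((!) [p i k, p2 (i, k) l, q2 (i, k) l]) [0..<3])) ?is"
  proof (rule map_cong[OF refl])
    fix i assume i: "i \<in> ?I"
    show "(\<Sum>k\<in>?A i. \<Sum>l\<in>?A1 i k. pure_tensor B (map ((!) [p1 (i, k) l, q1 (i, k) l, q i k]) [0..<3])) =
        (\<Sum>k\<in>?A i. \<Sum>l\<in>?A2 i k. pure_tensor B (map ((!) [p i k, p2 (i, k) l, q2 (i, k) l]) [0..<3]))"
      using coassoc_rep[OF v[OF i] r[OF i], of "?A1 i" "\<lambda>k. p1 (i, k)" "\<lambda>k. q1 (i, k)"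
          "?A2 i" "\<lambda>k. p2 (i, k)" "\<lambda>k. q2 (i, k)"] r1[of "(i, _)"] r2[of "(i, _)"] i
      by (simp add: map_nth3)
  qed
  also have "shuffle B 3 N (tconcat B 3 \<dots>) =
    (\<Sum>g\<in>PiE ?I ?A. \<Sum>h\<in>PiE ?I (\<lambda>i. ?A2 i (g i)). pure_tensor T (map (\<lambda>s. pure_tensor B (map (\<lambda>i.
      [p i (g i), p2 (i, g i) (h i), q2 (i, g i) (h i)] ! s) ?is)) [0..<3]))"
    unfolding T_def
  proof (rule shuffle_nested_sum[symmetric])
    fix i k l s assume *: "i \<in> ?I" "k \<in> ?A i" "l \<in> ?A2 i k" "s < (3::nat)"
    then have "(i, k) \<in> Sigma ?I ?A" by auto
    from comul_repD(2,3)[OF r2[OF this], of l] comul_repD(2)[OF r[OF *(1)], of k]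
    show "[p i k, p2 (i, k) l, q2 (i, k) l] ! s \<in> carrier B"
      using * by (auto simp: numeral_3_eq_3 less_Suc_eq)
  qed auto
  also have "\<dots> = sweedler T tscale (\<lambda>x y. tcat T 1 2 (pure_tensor T [x]) (comul T y)) (pure_tensor B xs)"
    using T.sweedler_coassoc_right[OF R R2] by (simp add: upt_3)
  finally show ?thesis .
qed

end

section \<open>Associativity, unit, counit and compatibility axioms of tensor powers\<close>

lemma linear_on_bilinear_ext:
  fixes L :: "('a::ab_group_add, 'k::field) tens \<Rightarrow> ('a, 'k) tens \<Rightarrow> 'w::ab_group_add"
  assumes "\<And>t. t \<in> tspace V N \<Longrightarrow> linear_on (tensor_algebra_power V N) sW (\<lambda>s. L s t)"
    and "\<And>t. t \<in> tspace V N \<Longrightarrow> linear_on (tensor_algebra_power V N) sW (\<lambda>s. L' s t)"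
    and "\<And>s. s \<in> tspace V N \<Longrightarrow> linear_on (tensor_algebra_power V N) sW (\<lambda>t. L s t)"
    and "\<And>s. s \<in> tspace V N \<Longrightarrow> linear_on (tensor_algebra_power V N) sW (\<lambda>t. L' s t)"
    and "\<And>xs ys. xs \<in> tuples V N \<Longrightarrow> ys \<in> tuples V N \<Longrightarrow>
      L (pure_tensor V xs) (pure_tensor V ys) = L' (pure_tensor V xs) (pure_tensor V ys)"
    and s: "s \<in> tspace V N" and t: "t \<in> tspace V N"
  shows "L s t = L' s t"
proof (rule linear_on_tspace_ext[OF assms(1)[OF t] assms(2)[OF t] _ s])
  fix xs assume xs: "xs \<in> tuples V N"
  then have p: "pure_tensor V xs \<in> tspace V N" by simp
  show "L (pure_tensor V xs) t = L' (pure_tensor V xs) t"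
    by (rule linear_on_tspace_ext[OF assms(3)[OF p] assms(4)[OF p] assms(5)[OF xs] t])
qed

lemma (in kalg_space) tmult_assoc:
  assumes ass: "\<And>x y z. x \<in> carrier V \<Longrightarrow> y \<in> carrier V \<Longrightarrow> z \<in> carrier V \<Longrightarrow> (x \<otimes> y) \<otimes> z = x \<otimes> (y \<otimes> z)"
    and stu: "s \<in> tspace V N" "t \<in> tspace V N" "u \<in> tspace V N"
  defines "m \<equiv> mult (tensor_algebra_power V N)"
  shows "m (m s t) u = m s (m t u)"
proof -
  let ?T = "tensor_algebra_power V N"
  have L: "linear_on ?T tscale (\<lambda>s. m s t)" and R: "linear_on ?T tscale (\<lambda>s. m t s)" if "t \<in> tspace V N" for t
    using that tmult_linear_left tmult_linear_right by (simp_all add: m_def)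
  have c: "m s t \<in> tspace V N" if "s \<in> tspace V N" "t \<in> tspace V N" for s t
    using that tmult_closed by (simp add: m_def)
  have comp: "linear_on ?T tscale (\<lambda>x. g (f x))"
    if "linear_on ?T tscale f" "linear_on ?T tscale g" "\<And>x. x \<in> tspace V N \<Longrightarrow> f x \<in> tspace V N" for f g
    using linear_on_compose[of ?T ?T f tscale g] that by simp
  have pure: "m (m (pure_tensor V xs) (pure_tensor V ys)) (pure_tensor V zs) =
      m (pure_tensor V xs) (m (pure_tensor V ys) (pure_tensor V zs))"
    if *: "xs \<in> tuples V N" "ys \<in> tuples V N" "zs \<in> tuples V N" for xs ys zs
  proof -
    have "map2 (mult V) (map2 (mult V) xs ys) zs = map2 (mult V) xs (map2 (mult V) ys zs)"
      using * tuples_length[OF *(1)] tuples_length[OF *(2)] tuples_length[OF *(3)]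
      by (intro nth_equalityI) (auto intro!: ass tuples_nth)
    then show ?thesis using * by (simp add: m_def tmult_pure tuples_map2 kmult_closed)
  qed
  show ?thesis
  proof (rule linear_on_bilinear_ext[where L = "\<lambda>s t. m (m s t) u" and L' = "\<lambda>s t. m s (m t u)", OF _ _ _ _ _ stu(1,2)])
    fix xs ys assume *: "xs \<in> tuples V N" "ys \<in> tuples V N"
    show "m (m (pure_tensor V xs) (pure_tensor V ys)) u = m (pure_tensor V xs) (m (pure_tensor V ys) u)"
    proof (rule linear_on_tspace_ext[where L = "m (m (pure_tensor V xs) (pure_tensor V ys))"
          and L' = "\<lambda>u. m (pure_tensor V xs) (m (pure_tensor V ys) u)" and sW = tscale, OF _ _ _ stu(3)])
      show "linear_on ?T tscale (m (m (pure_tensor V xs) (pure_tensor V ys)))"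
        by (rule R, rule c) (simp_all add: *)
      show "linear_on ?T tscale (\<lambda>u. m (pure_tensor V xs) (m (pure_tensor V ys) u))"
        by (rule comp[of "m (pure_tensor V ys)" "m (pure_tensor V xs)"]) (simp_all add: * R c)
    qed (rule pure[OF *])
  next
    fix t assume t: "t \<in> tspace V N"
    show "linear_on ?T tscale (\<lambda>s. m (m s t) u)"
      by (rule comp[of "\<lambda>s. m s t" "\<lambda>s. m s u"]) (simp_all add: L c t stu)
    show "linear_on ?T tscale (\<lambda>s. m s (m t u))"
      by (rule L) (rule c[OF t stu(3)])
    show "linear_on ?T tscale (\<lambda>s. m (m t s) u)"
      by (rule comp[of "m t" "\<lambda>s. m s u"]) (simp_all add: L R c t stu)
    show "linear_on ?T tscale (\<lambda>s. m t (m s u))"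
      by (rule comp[of "\<lambda>s. m s u" "m t"]) (simp_all add: L R c t stu)
  qed
qed

context bialgebra
begin

lemma tuples_one: "replicate N \<one> \<in> tuples B N"
  by (auto simp: tuples_def)

lemma tensor_power_monoid: "monoid (tensor_power B N)"
proof (rule monoidI)
  fix s t u :: "('a, 'k) tens"
  assume s: "s \<in> carrier (tensor_power B N)"
  {
    assume "t \<in> carrier (tensor_power B N)"
    then show "s \<otimes>\<^bsub>tensor_power B N\<^esub> t \<in> carrier (tensor_power B N)"
      using s tmult_closed by simp
    moreover assume "u \<in> carrier (tensor_power B N)"
    ultimately show "s \<otimes>\<^bsub>tensor_power B N\<^esub> t \<otimes>\<^bsub>tensor_power B N\<^esub> u =
      s \<otimes>\<^bsub>tensor_power B N\<^esub> (t \<otimes>\<^bsub>tensor_power B N\<^esub> u)"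
      using s \<open>t \<in> _\<close> by (simp add: tmult_assoc m_assoc)
  }
  have id: "linear_on (tensor_algebra_power B N) tscale (\<lambda>s. s)" by (simp add: linear_on_def)
  note one = pure_tensor_closed[OF tuples_one]
  have "map2 (mult B) (replicate N \<one>) xs = xs" "map2 (mult B) xs (replicate N \<one>) = xs"
    if "xs \<in> tuples B N" for xs
    using tuples_nth[OF that] tuples_length[OF that] by (auto intro!: nth_equalityI)
  then have "\<one>\<^bsub>tensor_power B N\<^esub> \<otimes>\<^bsub>tensor_power B N\<^esub> s = s \<and> s \<otimes>\<^bsub>tensor_power B N\<^esub> \<one>\<^bsub>tensor_power B N\<^esub> = s"
    using s linear_on_tspace_ext[OF tmult_linear_left[OF one] id, of s]
      linear_on_tspace_ext[OF tmult_linear_right[OF one] id, of s]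
    by (simp add: tmult_pure tuples_one)
  then show "\<one>\<^bsub>tensor_power B N\<^esub> \<otimes>\<^bsub>tensor_power B N\<^esub> s = s" "s \<otimes>\<^bsub>tensor_power B N\<^esub> \<one>\<^bsub>tensor_power B N\<^esub> = s"
    by simp_all
qed (simp add: tuples_one)

lemma tensor_power_counit:
  assumes xs: "xs \<in> tuples B N"
  defines "T \<equiv> tensor_power B N"
  shows "sweedler T tscale (\<lambda>x y. tscale (counit T x) y) (pure_tensor B xs) = pure_tensor B xs"
    and "sweedler T tscale (\<lambda>x y. tscale (counit T y) x) (pure_tensor B xs) = pure_tensor B xs"
proof -
  interpret T: comul_space T unfolding T_def by (rule comul_space_tensor_power)
  let ?is = "[0..<N]" and ?I = "set [0..<N]"
  have v: "xs ! i \<in> carrier B" if "i \<in> ?I" for i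
    using that xs by (auto intro: tuples_nth)
  obtain m p q where r: "\<And>i. i \<in> ?I \<Longrightarrow> comul_rep B (xs ! i) {..<m i::nat} (p i) (q i)"
    by (rule ex_comul_reps[of ?I "(!) xs", OF v], assumption, rule that)
  let ?A = "\<lambda>i. {..<m i}"
  have R: "comul_rep T (pure_tensor B xs) (PiE ?I ?A)
    (\<lambda>g. pure_tensor B (map (\<lambda>i. p i (g i)) ?is)) (\<lambda>g. pure_tensor B (map (\<lambda>i. q i (g i)) ?is))"
    unfolding T_def pure_tensor_nth_map[OF xs]
    by (rule comul_rep_tensor_power) (use v r in auto)
  have p: "p i (g i) \<in> carrier B" and q: "q i (g i) \<in> carrier B" if "g \<in> PiE ?I ?A" "i \<in> ?I" for g i
    using comul_repD(2,3)[OF r[OF that(2)] PiE_mem[OF that]] .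
  have bil: "bilinear_on T tscale (\<lambda>x y. tscale (counit T x) y)" "bilinear_on T tscale (\<lambda>x y. tscale (counit T y) x)"
    using T.counit_linear' unfolding T_def
    by (auto intro!: bilinear_onI linear_onI
        simp: Hom_k_def linear_on_def tens.scale_left_distrib tens.scale_right_distrib tens.scale_left_commute)
  \<comment> \<open>One computation for both counit laws: \<open>a\<close> is the component that
    receives the counit and \<open>b\<close> the one that stays, and the counit law of
    \<open>B\<close> in each slot is expanded over all choices.\<close>
  have key: "pure_tensor B xs = (\<Sum>g\<in>PiE ?I ?A. tscale (counit T (pure_tensor B (map (\<lambda>i. a i (g i)) ?is)))
      (pure_tensor B (map (\<lambda>i. b i (g i)) ?is)))"
    if a: "\<And>i k. i \<in> ?I \<Longrightarrow> k \<in> ?A i \<Longrightarrow> a i k \<in> carrier B"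
      and b: "\<And>i k. i \<in> ?I \<Longrightarrow> k \<in> ?A i \<Longrightarrow> b i k \<in> carrier B"
      and ab: "\<And>i. i \<in> ?I \<Longrightarrow> (\<Sum>k\<in>?A i. scl B (counit B (a i k)) (b i k)) = xs ! i" for a b
  proof -
    have "pure_tensor B xs = pure_tensor B (map (\<lambda>i. \<Sum>k\<in>?A i. scl B (counit B (a i k)) (b i k)) ?is)"
      using ab by (subst pure_tensor_nth_map[OF xs]) (auto intro!: arg_cong[where f = "pure_tensor B"])
    also have "\<dots> = (\<Sum>g\<in>PiE ?I ?A. pure_tensor B (map (\<lambda>i. scl B (counit B (a i (g i))) (b i (g i))) ?is))"
      using b by (intro multilinear_sum_PiE[OF pure_tensor_multilinear]) auto
    also have "\<dots> = (\<Sum>g\<in>PiE ?I ?A. tscale (counit T (pure_tensor B (map (\<lambda>i. a i (g i)) ?is)))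
        (pure_tensor B (map (\<lambda>i. b i (g i)) ?is)))"
    proof (rule sum.cong[OF refl])
      fix g assume g: "g \<in> PiE ?I ?A"
      have a': "a i (g i) \<in> carrier B" and b': "b i (g i) \<in> carrier B" if "i \<in> ?I" for i
        using a[OF that PiE_mem[OF g that]] b[OF that PiE_mem[OF g that]] .
      show "pure_tensor B (map (\<lambda>i. scl B (counit B (a i (g i))) (b i (g i))) ?is) =
          tscale (counit T (pure_tensor B (map (\<lambda>i. a i (g i)) ?is))) (pure_tensor B (map (\<lambda>i. b i (g i)) ?is))"
        unfolding T_def using a' b'
        by (subst multilinear_prod_scale[OF vector_space_tscale pure_tensor_multilinear])
          (simp_all add: counit_pure_map del: set_upt)
    qed
    finally show ?thesis .
  qed
  show "sweedler T tscale (\<lambda>x y. tscale (counit T x) y) (pure_tensor B xs) = pure_tensor B xs"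
    using key[of p q] comul_repD(2,3)[OF r] counit_rep(1)[OF v r]
    unfolding sweedler_rep[OF vector_space_tscale bil(1) R] by simp
  show "sweedler T tscale (\<lambda>x y. tscale (counit T y) x) (pure_tensor B xs) = pure_tensor B xs"
    using key[of q p] comul_repD(2,3)[OF r] counit_rep(2)[OF v r]
    unfolding sweedler_rep[OF vector_space_tscale bil(2) R] by simp
qed

lemma map2_map_map: "map2 f (map g is) (map h is) = map (\<lambda>i. f (g i) (h i)) is"
  by (induction "is") auto

text \<open>On both sides a summand consists of one choice for each argument. A choice of pairs in
  every factor is a pair of choices, and products of pure tensors are formed slot by slot.\<close>

lemma tensor_power_comul_mult:
  assumes xs: "xs \<in> tuples B N" and ys: "ys \<in> tuples B N"
  defines "T \<equiv> tensor_power B N"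
  shows "comul T (pure_tensor B xs \<otimes>\<^bsub>T\<^esub> pure_tensor B ys) =
    comul T (pure_tensor B xs) \<otimes>\<^bsub>tensor_algebra_power T 2\<^esub> comul T (pure_tensor B ys)"
proof -
  interpret T: comul_space T unfolding T_def by (rule comul_space_tensor_power)
  interpret T: kalg_space T
    using tmult_closed[of _ N] tmult_linear_left[of _ N] tmult_linear_right[of _ N] T.kvec_axioms
    by (simp add: kalg_space_def kalg_space_axioms_def T_def linear_on_tensor_power)
  let ?is = "[0..<N]" and ?I = "set [0..<N]"
  have v: "xs ! i \<in> carrier B" and w: "ys ! i \<in> carrier B" if "i \<in> ?I" for i
    using that xs ys by (auto intro: tuples_nth)
  obtain m p q where r: "\<And>i. i \<in> ?I \<Longrightarrow> comul_rep B (xs ! i) {..<m i::nat} (p i) (q i)"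
    by (rule ex_comul_reps[of ?I "(!) xs", OF v], assumption, rule that)
  obtain m' p' q' where r': "\<And>i. i \<in> ?I \<Longrightarrow> comul_rep B (ys ! i) {..<m' i::nat} (p' i) (q' i)"
    by (rule ex_comul_reps[of ?I "(!) ys", OF w], assumption, rule that)
  let ?A = "\<lambda>i. {..<m i}" and ?A' = "\<lambda>i. {..<m' i}"
  have R: "comul_rep T (pure_tensor B xs) (PiE ?I ?A)
    (\<lambda>g. pure_tensor B (map (\<lambda>i. p i (g i)) ?is)) (\<lambda>g. pure_tensor B (map (\<lambda>i. q i (g i)) ?is))"
    unfolding T_def pure_tensor_nth_map[OF xs]
    by (rule comul_rep_tensor_power) (use v r in auto)
  have R': "comul_rep T (pure_tensor B ys) (PiE ?I ?A')
    (\<lambda>g. pure_tensor B (map (\<lambda>i. p' i (g i)) ?is)) (\<lambda>g. pure_tensor B (map (\<lambda>i. q' i (g i)) ?is))"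
    unfolding T_def pure_tensor_nth_map[OF ys]
    by (rule comul_rep_tensor_power) (use w r' in auto)
  have eq: "pure_tensor B xs \<otimes>\<^bsub>T\<^esub> pure_tensor B ys = pure_tensor B (map (\<lambda>i. xs ! i \<otimes> ys ! i) ?is)"
    using tuples_length[OF xs] tuples_length[OF ys] unfolding T_def
    by (auto simp: tmult_pure xs ys intro!: arg_cong[where f = "pure_tensor B"] nth_equalityI)
  have "comul_rep T (pure_tensor B (map (\<lambda>i. xs ! i \<otimes> ys ! i) ?is)) (PiE ?I (\<lambda>i. ?A i \<times> ?A' i))
    (\<lambda>g. pure_tensor B (map (\<lambda>i. (case g i of (k, l) \<Rightarrow> p i k \<otimes> p' i l)) ?is))
    (\<lambda>g. pure_tensor B (map (\<lambda>i. (case g i of (k, l) \<Rightarrow> q i k \<otimes> q' i l)) ?is))"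
    unfolding T_def
    by (rule comul_rep_tensor_power)
      (auto simp del: set_upt intro!: comul_rep_mult v w r r')
  then have "comul T (pure_tensor B xs \<otimes>\<^bsub>T\<^esub> pure_tensor B ys) = (\<Sum>e\<in>PiE ?I (\<lambda>i. ?A i \<times> ?A' i).
      pure_tensor T [pure_tensor B (map (\<lambda>i. p i (fst (e i)) \<otimes> p' i (snd (e i))) ?is),
        pure_tensor B (map (\<lambda>i. q i (fst (e i)) \<otimes> q' i (snd (e i))) ?is)])"
    unfolding eq by (simp only: comul_repD(4) case_prod_unfold)
  also have "\<dots> = (\<Sum>g\<in>PiE ?I ?A. \<Sum>h\<in>PiE ?I ?A'.
      pure_tensor T [pure_tensor B (map (\<lambda>i. p i (g i) \<otimes> p' i (h i)) ?is),
        pure_tensor B (map (\<lambda>i. q i (g i) \<otimes> q' i (h i)) ?is)])"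
    by (subst sum_PiE_Sigma) (auto simp: restrict_def intro!: sum.cong arg_cong[where f = "pure_tensor T"] arg_cong[where f = "pure_tensor B"])
  also have "\<dots> = (\<Sum>g\<in>PiE ?I ?A. \<Sum>h\<in>PiE ?I ?A'. pure_tensor T (map2 (mult T)
      [pure_tensor B (map (\<lambda>i. p i (g i)) ?is), pure_tensor B (map (\<lambda>i. q i (g i)) ?is)]
      [pure_tensor B (map (\<lambda>i. p' i (h i)) ?is), pure_tensor B (map (\<lambda>i. q' i (h i)) ?is)]))"
  proof (intro sum.cong refl)
    fix g h assume g: "g \<in> PiE ?I ?A" and h: "h \<in> PiE ?I ?A'"
    have gh: "p i (g i) \<in> carrier B \<and> q i (g i) \<in> carrier B \<and> p' i (h i) \<in> carrier B \<and> q' i (h i) \<in> carrier B"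
      if "i \<in> ?I" for i
      using comul_repD(2,3)[OF r[OF that] PiE_mem[OF g that]] comul_repD(2,3)[OF r'[OF that] PiE_mem[OF h that]]
      by simp
    have t: "map (\<lambda>i. p i (g i)) ?is \<in> tuples B N" "map (\<lambda>i. q i (g i)) ?is \<in> tuples B N"
      "map (\<lambda>i. p' i (h i)) ?is \<in> tuples B N" "map (\<lambda>i. q' i (h i)) ?is \<in> tuples B N"
      using gh by (auto intro: tuples_map)
    show "pure_tensor T [pure_tensor B (map (\<lambda>i. p i (g i) \<otimes> p' i (h i)) ?is),
        pure_tensor B (map (\<lambda>i. q i (g i) \<otimes> q' i (h i)) ?is)] =
      pure_tensor T (map2 (mult T)
      [pure_tensor B (map (\<lambda>i. p i (g i)) ?is), pure_tensor B (map (\<lambda>i. q i (g i)) ?is)]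
      [pure_tensor B (map (\<lambda>i. p' i (h i)) ?is), pure_tensor B (map (\<lambda>i. q' i (h i)) ?is)])"
      using t by (simp add: T_def tmult_pure map2_map_map)
  qed
  also have "\<dots> = comul T (pure_tensor B xs) \<otimes>\<^bsub>tensor_algebra_power T 2\<^esub> comul T (pure_tensor B ys)"
    unfolding comul_repD(4)[OF R] comul_repD(4)[OF R']
    using comul_repD(2,3)[OF R] comul_repD(2,3)[OF R'] by (subst T.tmult_sum) auto
  finally show ?thesis .
qed

lemma tensor_power_comul_one:
  fixes N :: nat
  defines "T \<equiv> tensor_power B N"
  shows "comul T \<one>\<^bsub>T\<^esub> = \<one>\<^bsub>tensor_algebra_power T 2\<^esub>"
proof -
  have rep: "map (\<lambda>i. \<one>) [0..<N] = replicate N \<one>" by (simp add: map_replicate_const)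
  have u: "PiE (set [0..<N]) (\<lambda>i. {undefined::nat}) = {\<lambda>_. undefined}"
    by (rule PiE_singleton) (simp add: extensional_def)
  have "comul_rep T (pure_tensor B (map (\<lambda>i. \<one>) [0..<N])) (PiE (set [0..<N]) (\<lambda>i. {undefined::nat}))
    (\<lambda>g. pure_tensor B (map (\<lambda>i. \<one>) [0..<N])) (\<lambda>g. pure_tensor B (map (\<lambda>i. \<one>) [0..<N]))"
    unfolding T_def by (rule comul_rep_tensor_power) (auto intro: comul_rep_one)
  from comul_repD(4)[OF this] show ?thesis
    unfolding rep u by (simp add: T_def numeral_2_eq_2)
qed

text \<open>The axioms that relate elements are linear in each of them and so reduce to pure
  tensors. The result makes the construction iterable: everything proved for tensor powers of a
  bialgebra also applies to tensor powers of \<open>H^n\<close>.\<close>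

theorem bialgebra_tensor_power: "bialgebra (tensor_power B N)"
proof -
  define T where "T = tensor_power B N"
  interpret T: comul_space T unfolding T_def by (rule comul_space_tensor_power)
  interpret T: monoid T unfolding T_def by (rule tensor_power_monoid)
  have simps [simp]: "carrier T = tspace B N" "scl T = tscale"
    and lin: "linear_on T = linear_on (tensor_algebra_power B N)"
    by (simp_all add: T_def linear_on_tensor_power)
  have mult: "mult T = mult (tensor_algebra_power B N)" by (simp add: T_def)
  interpret T: kalg_space T
    using tmult_closed[of _ N] tmult_linear_left[of _ N] tmult_linear_right[of _ N] T.kvec_axioms
    by (simp add: kalg_space_def kalg_space_axioms_def lin mult)
  let ?L = "linear_on (tensor_algebra_power B N)"
  have id: "?L tscale (\<lambda>s. s)" by (simp add: linear_on_def)
  have bil: "bilinear_on T tscale (\<lambda>x y. tscale (counit T x) y)" "bilinear_on T tscale (\<lambda>x y. tscale (counit T y) x)"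
    using T.counit_linear'
    by (auto intro!: bilinear_onI linear_onI
        simp: Hom_k_def linear_on_def tens.scale_left_distrib tens.scale_right_distrib tens.scale_left_commute)
  note sl = T.sweedler_linear[OF vector_space_tscale, unfolded lin]
  have "bialgebra T"
  proof (intro bialgebra.intro bialgebra_axioms.intro T.monoid_axioms T.vector_space_axioms)
    show "T.subspace (carrier T)" by (rule T.carrier_subspace)
    show "y \<in> carrier T \<Longrightarrow> linear_on T (scl T) (\<lambda>x. x \<otimes>\<^bsub>T\<^esub> y)" for y by (rule T.kmult_left)
    show "x \<in> carrier T \<Longrightarrow> linear_on T (scl T) (\<lambda>y. x \<otimes>\<^bsub>T\<^esub> y)" for x by (rule T.kmult_right)
    show "a \<in> carrier T \<Longrightarrow> comul T a \<in> tspace T 2" for a by (rule T.comul_closed')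
    show "linear_on T tscale (comul T)" by (rule T.comul_linear')
    show "counit T \<in> Hom_k T" by (rule T.counit_linear')
    show "comul T \<one>\<^bsub>T\<^esub> = \<one>\<^bsub>tensor_algebra_power T 2\<^esub>"
      unfolding T_def by (rule tensor_power_comul_one)
    show "counit T \<one>\<^bsub>T\<^esub> = 1"
      by (simp add: T_def counit_pure tuples_one map_replicate counit_one)
  next
    fix a assume a: "a \<in> carrier T"
    show "sweedler T tscale (\<lambda>x y. tcat T 2 1 (comul T x) (pure_tensor T [y])) a =
      sweedler T tscale (\<lambda>x y. tcat T 1 2 (pure_tensor T [x]) (comul T y)) a"
      by (rule linear_on_tspace_ext[OF sl[OF T.bilinear_coassoc(1)] sl[OF T.bilinear_coassoc(2)]])
        (unfold T_def, rule tensor_power_coassoc, assumption, use a in simp)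
    show "sweedler T (scl T) (\<lambda>x y. scl T (counit T x) y) a = a"
      unfolding simps by (rule linear_on_tspace_ext[OF sl[OF bil(1)] id])
        (use a in \<open>simp_all add: T_def tensor_power_counit\<close>)
    show "sweedler T (scl T) (\<lambda>x y. scl T (counit T y) x) a = a"
      unfolding simps by (rule linear_on_tspace_ext[OF sl[OF bil(2)] id])
        (use a in \<open>simp_all add: T_def tensor_power_counit\<close>)
    fix b assume b: "b \<in> carrier T"
    let ?T2 = "tensor_algebra_power T 2"
    have comp: "?L sW (\<lambda>x. g (f x))" if "?L tscale f" "?L sW g" "\<And>x. x \<in> tspace B N \<Longrightarrow> f x \<in> tspace B N"
      for f and g :: "_ \<Rightarrow> 'w::ab_group_add" and sW
      using linear_on_compose[of "tensor_algebra_power B N" "tensor_algebra_power B N" f sW g] that by simp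
    have comp2: "?L tscale (\<lambda>x. g (comul T x))" if "linear_on ?T2 tscale g" for g :: "_ \<Rightarrow> ((_, _) tens, _) tens"
      using linear_on_compose[of T ?T2 "comul T" tscale g] that T.comul_closed' T.comul_linear' by (simp add: lin)
    have ml: "?L tscale (\<lambda>s. s \<otimes>\<^bsub>T\<^esub> t)" "?L tscale (\<lambda>s. t \<otimes>\<^bsub>T\<^esub> s)" if "t \<in> tspace B N" for t
      using that by (simp_all add: mult tmult_linear_left tmult_linear_right)
    have cl: "s \<otimes>\<^bsub>T\<^esub> t \<in> tspace B N" if "s \<in> tspace B N" "t \<in> tspace B N" for s t
      using that by (simp add: mult tmult_closed)
    have cc: "comul T x \<in> tspace T 2" if "x \<in> tspace B N" for x using that T.comul_closed' by simp
    have cml: "?L tscale (comul T)" using T.comul_linear' by (simp add: lin)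
    have cul: "?L (*) (counit T)" using T.counit_linear' by (simp add: Hom_k_def lin)
    show "comul T (a \<otimes>\<^bsub>T\<^esub> b) = comul T a \<otimes>\<^bsub>?T2\<^esub> comul T b"
    proof (rule linear_on_bilinear_ext[where L = "\<lambda>a b. comul T (a \<otimes>\<^bsub>T\<^esub> b)" and
          L' = "\<lambda>a b. comul T a \<otimes>\<^bsub>?T2\<^esub> comul T b" and V = B and N = N and sW = tscale])
      fix t assume t: "t \<in> tspace B N"
      show "?L tscale (\<lambda>s. comul T (s \<otimes>\<^bsub>T\<^esub> t))"
        using t by (intro comp[of "\<lambda>s. s \<otimes>\<^bsub>T\<^esub> t" tscale "comul T"] ml cml cl)
      show "?L tscale (\<lambda>s. comul T (t \<otimes>\<^bsub>T\<^esub> s))"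
        using t by (intro comp[of "\<lambda>s. t \<otimes>\<^bsub>T\<^esub> s" tscale "comul T"] ml cml cl)
      show "?L tscale (\<lambda>s. comul T s \<otimes>\<^bsub>?T2\<^esub> comul T t)" using t
        by (intro comp2[of "\<lambda>x. x \<otimes>\<^bsub>?T2\<^esub> comul T t"] T.tmult_linear_left cc)
      show "?L tscale (\<lambda>s. comul T t \<otimes>\<^bsub>?T2\<^esub> comul T s)" using t
        by (intro comp2[of "\<lambda>x. comul T t \<otimes>\<^bsub>?T2\<^esub> x"] T.tmult_linear_right cc)
    qed (use a b tensor_power_comul_mult[where N = N, folded T_def] in simp_all)
    show "counit T (a \<otimes>\<^bsub>T\<^esub> b) = counit T a * counit T b"
    proof (rule linear_on_bilinear_ext[where L = "\<lambda>a b. counit T (a \<otimes>\<^bsub>T\<^esub> b)" and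
          L' = "\<lambda>a b. counit T a * counit T b" and V = B and N = N and sW = "(*)"])
      fix t assume t: "t \<in> tspace B N"
      show "?L (*) (\<lambda>s. counit T (s \<otimes>\<^bsub>T\<^esub> t))" 
        using t by (intro comp[of "\<lambda>s. s \<otimes>\<^bsub>T\<^esub> t" "(*)" "counit T"] cul ml cl)
      show "?L (*) (\<lambda>s. counit T (t \<otimes>\<^bsub>T\<^esub> s))" 
        using t by (intro comp[of "\<lambda>s. t \<otimes>\<^bsub>T\<^esub> s" "(*)" "counit T"] cul ml cl)
      show "?L (*) (\<lambda>s. counit T s * counit T t)" "?L (*) (\<lambda>s. counit T t * counit T s)"
        using cul by (simp_all add: linear_on_def algebra_simps)
    next
      fix xs ys assume xs: "xs \<in> tuples B N" and ys: "ys \<in> tuples B N"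
      have "xs ! i \<in> carrier B \<and> ys ! i \<in> carrier B" if "i < N" for i
        using that xs ys by (auto intro: tuples_nth)
      then have "map (counit B) (map2 (mult B) xs ys) = map2 (*) (map (counit B) xs) (map (counit B) ys)"
        using tuples_length[OF xs] tuples_length[OF ys]
        by (intro nth_equalityI) (auto simp: counit_mult)
      moreover have "prod_list (map2 (*) as bs) = prod_list as * prod_list bs"
        if "length as = length bs" for as bs :: "'k list"
        using that by (induction as bs rule: list_induct2) (auto simp: algebra_simps)
      ultimately show "counit T (pure_tensor B xs \<otimes>\<^bsub>T\<^esub> pure_tensor B ys) =
          counit T (pure_tensor B xs) * counit T (pure_tensor B ys)"
        using tuples_length[OF xs] tuples_length[OF ys] xs ys
        by (simp add: T_def tmult_pure counit_pure tuples_map2)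
    qed (use a b in simp_all)
  qed
  then show ?thesis by (simp add: T_def)
qed

end

section \<open>The convolution monoid\<close>

text \<open>Functionals are normalised outside the carrier, so that equality of functionals is equality.\<close>

definition conv_monoid :: "('a::ab_group_add, 'k::field) bialg \<Rightarrow> ('a \<Rightarrow> 'k) monoid"
  where "conv_monoid D = \<lparr>carrier = Hom_k D \<inter> extensional (carrier D),
    mult = (\<lambda>f g. restrict (conv D f g) (carrier D)), one = restrict (counit D) (carrier D)\<rparr>"

lemma conv_monoid_simps:
  "carrier (conv_monoid D) = Hom_k D \<inter> extensional (carrier D)"
  "f \<otimes>\<^bsub>conv_monoid D\<^esub> g = restrict (conv D f g) (carrier D)"
  "\<one>\<^bsub>conv_monoid D\<^esub> = restrict (counit D) (carrier D)"
  by (simp_all add: conv_monoid_def)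

context comul_space
begin

lemma Hom_k_cong: "f \<in> Hom_k B \<Longrightarrow> (\<And>x. x \<in> carrier B \<Longrightarrow> f x = g x) \<Longrightarrow> g \<in> Hom_k B"
  using linear_on_cong[of B "(*)" f g] by (simp add: Hom_k_def)

lemma Hom_k_restrict: "f \<in> Hom_k B \<Longrightarrow> restrict f (carrier B) \<in> Hom_k B"
  by (rule Hom_k_cong) auto

lemma restrict_closed: "f \<in> Hom_k B \<Longrightarrow> restrict f (carrier B) \<in> carrier (conv_monoid B)"
  by (simp add: conv_monoid_simps Hom_k_restrict)

lemma conv_Hom_k: "f \<in> Hom_k B \<Longrightarrow> g \<in> Hom_k B \<Longrightarrow> conv B f g \<in> Hom_k B"
  using sweedler_linear[OF vector_space_field bilinear_on_mult[of f B g]]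
  by (simp add: Hom_k_def conv_def)

lemma conv_cong:
  assumes fg: "f \<in> Hom_k B" "g \<in> Hom_k B" "\<And>x. x \<in> carrier B \<Longrightarrow> f x = f' x"
    "\<And>x. x \<in> carrier B \<Longrightarrow> g x = g' x" and x: "x \<in> carrier B"
  shows "conv B f g x = conv B f' g' x"
proof -
  obtain m p q where r: "comul_rep B x {..<m::nat} p q" using comul_rep_exists[OF x] by blast
  have "f' \<in> Hom_k B" "g' \<in> Hom_k B" using Hom_k_cong fg by blast+
  then show ?thesis
    using comul_repD(2,3)[OF r] fg by (simp add: conv_rep[OF _ _ r])
qed

lemma conv_restrict:
  "f \<in> Hom_k B \<Longrightarrow> g \<in> Hom_k B \<Longrightarrow>
    restrict f (carrier B) \<otimes>\<^bsub>conv_monoid B\<^esub> restrict g (carrier B) = restrict (conv B f g) (carrier B)"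
  unfolding conv_monoid_simps by (intro restrict_ext conv_cong Hom_k_restrict) auto

end

context bialgebra
begin

lemma conv_assoc:
  assumes f: "f \<in> Hom_k B" and g: "g \<in> Hom_k B" and h: "h \<in> Hom_k B" and x: "x \<in> carrier B"
  shows "conv B (conv B f g) h x = conv B f (conv B g h) x"
proof -
  obtain m p q where r: "comul_rep B x {..<m::nat} p q" using comul_rep_exists[OF x] by blast
  note pq = comul_repD(2,3)[OF r]
  obtain m1 p1 q1 where r1: "\<And>k. k \<in> {..<m} \<Longrightarrow> comul_rep B (p k) {..<m1 k::nat} (p1 k) (q1 k)"
    by (rule ex_comul_reps[of "{..<m}" p, OF pq(1)], assumption, rule that)
  obtain m2 p2 q2 where r2: "\<And>k. k \<in> {..<m} \<Longrightarrow> comul_rep B (q k) {..<m2 k::nat} (p2 k) (q2 k)"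
    by (rule ex_comul_reps[of "{..<m}" q, OF pq(2)], assumption, rule that)
  \<comment> \<open>The trilinear form which turns the two sides of coassociativity into the two
    iterated convolutions.\<close>
  let ?F = "\<lambda>xs. f (xs ! 0) * g (xs ! 1) * h (xs ! 2)"
  have ml: "multilinear B 3 (*) ?F"
    using f g h by (intro trilinearI linear_onI) (simp_all add: Hom_k_def linear_on_def algebra_simps)
  have sum: "tlift B 3 (*) ?F (\<Sum>k<m. \<Sum>l<n k. pure_tensor B (P k l)) = (\<Sum>k<m. \<Sum>l<n k. ?F (P k l))"
    if "\<And>k l. k < m \<Longrightarrow> l < n k \<Longrightarrow> P k l \<in> tuples B 3" for n :: "nat \<Rightarrow> nat" and P
  proof -
    have "tlift B 3 (*) ?F (\<Sum>k<m. \<Sum>l<n k. pure_tensor B (P k l)) =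
        (\<Sum>k<m. tlift B 3 (*) ?F (\<Sum>l<n k. pure_tensor B (P k l)))"
      using that by (intro kvec.linear_on_sum[OF kvec_tensor_algebra_power tlift_linear[OF vector_space_field ml]])
        (auto intro!: tspace_sum)
    also have "\<dots> = (\<Sum>k<m. \<Sum>l<n k. ?F (P k l))"
      using that by (intro sum.cong refl tlift_sum[OF vector_space_field ml]) auto
    finally show ?thesis .
  qed
  have "conv B (conv B f g) h x = (\<Sum>k<m. \<Sum>l<m1 k. f (p1 k l) * g (q1 k l) * h (q k))"
    by (simp add: conv_rep[OF conv_Hom_k[OF f g] h r] conv_rep[OF f g r1] sum_distrib_right)
  also have "\<dots> = tlift B 3 (*) ?F (\<Sum>k<m. \<Sum>l<m1 k. pure_tensor B [p1 k l, q1 k l, q k])"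
    using pq comul_repD(2,3)[OF r1] by (subst sum) auto
  also have "\<dots> = tlift B 3 (*) ?F (\<Sum>k<m. \<Sum>l<m2 k. pure_tensor B [p k, p2 k l, q2 k l])"
    using coassoc_rep[OF x r r1 r2] by simp
  also have "\<dots> = (\<Sum>k<m. \<Sum>l<m2 k. f (p k) * g (p2 k l) * h (q2 k l))"
    using pq comul_repD(2,3)[OF r2] by (subst sum) auto
  also have "\<dots> = conv B f (conv B g h) x"
    by (simp add: conv_rep[OF f conv_Hom_k[OF g h] r] conv_rep[OF g h r2] sum_distrib_left mult.assoc)
  finally show ?thesis .
qed

lemma conv_counit:
  assumes f: "f \<in> Hom_k B" and x: "x \<in> carrier B"
  shows "conv B (counit B) f x = f x" "conv B f (counit B) x = f x"
proof -
  obtain m p q where r: "comul_rep B x {..<m::nat} p q" using comul_rep_exists[OF x] by blast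
  note pq = comul_repD(2,3)[OF r]
  have lf: "linear_on B (*) f" using f by (simp add: Hom_k_def)
  show "conv B (counit B) f x = f x"
    using linear_on_comb[OF lf, of "{..<m}" q "\<lambda>k. counit B (p k)"] pq
    by (simp add: conv_rep[OF counit_linear f r] counit_rep(1)[OF x r])
  show "conv B f (counit B) x = f x"
    using linear_on_comb[OF lf, of "{..<m}" p "\<lambda>k. counit B (q k)"] pq
    by (simp add: conv_rep[OF f counit_linear r] counit_rep(2)[OF x r] mult.commute)
qed

lemma monoid_conv_monoid: "monoid (conv_monoid B)"
proof (rule monoidI)
  fix f g h assume f: "f \<in> carrier (conv_monoid B)"
  then have f': "f \<in> Hom_k B" "restrict f (carrier B) = f"
    by (simp_all add: conv_monoid_simps extensional_restrict)
  note one = restrict_closed[OF counit_linear, folded conv_monoid_simps(3)]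
  show "\<one>\<^bsub>conv_monoid B\<^esub> \<otimes>\<^bsub>conv_monoid B\<^esub> f = f" "f \<otimes>\<^bsub>conv_monoid B\<^esub> \<one>\<^bsub>conv_monoid B\<^esub> = f"
    using conv_restrict[OF counit_linear f'(1)] conv_restrict[OF f'(1) counit_linear] f'(2)
      restrict_ext[of "carrier B" "conv B (counit B) f" f, OF conv_counit(1)[OF f'(1)]]
      restrict_ext[of "carrier B" "conv B f (counit B)" f, OF conv_counit(2)[OF f'(1)]]
    by (simp_all add: conv_monoid_simps(3))
  assume g: "g \<in> carrier (conv_monoid B)"
  then have g': "g \<in> Hom_k B" "restrict g (carrier B) = g"
    by (simp_all add: conv_monoid_simps extensional_restrict)
  show "f \<otimes>\<^bsub>conv_monoid B\<^esub> g \<in> carrier (conv_monoid B)"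
    using restrict_closed[OF conv_Hom_k[OF f'(1) g'(1)]] by (simp only: conv_monoid_simps(2))
  assume h: "h \<in> carrier (conv_monoid B)"
  then have h': "h \<in> Hom_k B" "restrict h (carrier B) = h"
    by (simp_all add: conv_monoid_simps extensional_restrict)
  show "f \<otimes>\<^bsub>conv_monoid B\<^esub> g \<otimes>\<^bsub>conv_monoid B\<^esub> h = f \<otimes>\<^bsub>conv_monoid B\<^esub> (g \<otimes>\<^bsub>conv_monoid B\<^esub> h)"
    using conv_restrict[OF conv_Hom_k[OF f'(1) g'(1)] h'(1)] conv_restrict[OF f'(1) conv_Hom_k[OF g'(1) h'(1)]]
      restrict_ext[of "carrier B", OF conv_assoc[OF f'(1) g'(1) h'(1)]] f'(2) g'(2) h'(2)
      conv_restrict[OF f'(1) g'(1)] conv_restrict[OF g'(1) h'(1)] by simp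
qed (simp add: conv_monoid_simps Hom_k_restrict counit_linear)

lemma conv_invertible_iff:
  assumes f: "f \<in> Hom_k B"
  shows "conv_invertible B f \<longleftrightarrow> restrict f (carrier B) \<in> Units (conv_monoid B)"
proof
  assume "conv_invertible B f"
  then obtain g where g: "g \<in> Hom_k B"
    "\<And>d. d \<in> carrier B \<Longrightarrow> conv B f g d = counit B d" "\<And>d. d \<in> carrier B \<Longrightarrow> conv B g f d = counit B d"
    by (auto simp: conv_invertible_def)
  show "restrict f (carrier B) \<in> Units (conv_monoid B)"
    unfolding Units_def
  proof (intro CollectI conjI bexI)
    show "restrict g (carrier B) \<otimes>\<^bsub>conv_monoid B\<^esub> restrict f (carrier B) = \<one>\<^bsub>conv_monoid B\<^esub>"
      unfolding conv_restrict[OF g(1) f] conv_monoid_simps(3) by (rule restrict_ext) (rule g(3))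
    show "restrict f (carrier B) \<otimes>\<^bsub>conv_monoid B\<^esub> restrict g (carrier B) = \<one>\<^bsub>conv_monoid B\<^esub>"
      unfolding conv_restrict[OF f g(1)] conv_monoid_simps(3) by (rule restrict_ext) (rule g(2))
  qed (simp_all only: restrict_closed f g(1))
next
  assume "restrict f (carrier B) \<in> Units (conv_monoid B)"
  then obtain g where g: "g \<in> Hom_k B" "restrict g (carrier B) = g"
    and inv: "g \<otimes>\<^bsub>conv_monoid B\<^esub> restrict f (carrier B) = \<one>\<^bsub>conv_monoid B\<^esub>"
      "restrict f (carrier B) \<otimes>\<^bsub>conv_monoid B\<^esub> g = \<one>\<^bsub>conv_monoid B\<^esub>"
    by (auto simp: Units_def conv_monoid_simps(1) extensional_restrict)
  show "conv_invertible B f"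
    unfolding conv_invertible_def
  proof (intro bexI[OF _ g(1)] ballI conjI)
    fix d assume "d \<in> carrier B"
    then show "conv B f g d = counit B d" "conv B g f d = counit B d"
      using inv conv_restrict[OF f g(1)] conv_restrict[OF g(1) f] unfolding g(2) conv_monoid_simps(3)
      by (metis restrict_apply')+
  qed
qed

lemma conv_prod_Hom_k: "set fs \<subseteq> Hom_k B \<Longrightarrow> conv_prod B fs \<in> Hom_k B"
  by (induction fs) (auto simp: conv_prod_def counit_linear intro: conv_Hom_k)

lemma conv_prod_restrict:
  "set fs \<subseteq> Hom_k B \<Longrightarrow> restrict (conv_prod B fs) (carrier B) =
    foldr (mult (conv_monoid B)) (map (\<lambda>f. restrict f (carrier B)) fs) \<one>\<^bsub>conv_monoid B\<^esub>"
proof (induction fs)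
  case Nil
  then show ?case by (simp add: conv_prod_def conv_monoid_simps del: restrict_apply)
next
  case (Cons f fs)
  then show ?case
    using conv_restrict[of f "conv_prod B fs"] conv_prod_Hom_k[of fs]
    by (simp add: conv_prod_def del: restrict_apply)
qed

end

section \<open>Coalgebra maps\<close>

text \<open>The lift is \<phi> \<otimes> \<phi>, so this is compatibility with comultiplication and
  counit, required on the carrier only.\<close>

definition coalg_map ::
  "('a::ab_group_add, 'k::field) bialg \<Rightarrow> ('b::ab_group_add, 'k) bialg \<Rightarrow> ('a \<Rightarrow> 'b) \<Rightarrow> bool"
  where "coalg_map D E \<phi> \<longleftrightarrow> linear_on D (scl E) \<phi> \<and>
    (\<forall>x\<in>carrier D. \<phi> x \<in> carrier E \<and> counit E (\<phi> x) = counit D x \<and>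
      comul E (\<phi> x) = tlift D 2 tscale (\<lambda>xs. pure_tensor E (map \<phi> xs)) (comul D x))"

lemma multilinear_pure_map:
  assumes "linear_on D (scl E) \<phi>" "\<And>x. x \<in> carrier D \<Longrightarrow> \<phi> x \<in> carrier E"
  shows "multilinear D N tscale (\<lambda>xs. pure_tensor E (map \<phi> xs))"
  by (rule multilinear_map[OF pure_tensor_multilinear assms])

lemma tlift_pure_map_rep:
  assumes "linear_on D (scl E) \<phi>" "\<And>x. x \<in> carrier D \<Longrightarrow> \<phi> x \<in> carrier E" "comul_rep D x A p q"
  shows "tlift D 2 tscale (\<lambda>xs. pure_tensor E (map \<phi> xs)) (comul D x) =
    (\<Sum>k\<in>A. pure_tensor E [\<phi> (p k), \<phi> (q k)])"
proof -
  have "tlift D 2 tscale (\<lambda>xs. pure_tensor E (map \<phi> xs)) (comul D x) =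
      (\<Sum>k\<in>A. pure_tensor E (map \<phi> [p k, q k]))"
    unfolding comul_repD(4)[OF assms(3)]
    by (rule tlift_sum[OF vector_space_tscale multilinear_pure_map[OF assms(1,2)]])
      (use comul_repD(2,3)[OF assms(3)] in auto)
  then show ?thesis by simp
qed

lemma coalg_mapD:
  assumes "coalg_map D E \<phi>"
  shows "linear_on D (scl E) \<phi>" "x \<in> carrier D \<Longrightarrow> \<phi> x \<in> carrier E"
    "x \<in> carrier D \<Longrightarrow> counit E (\<phi> x) = counit D x"
  using assms by (simp_all add: coalg_map_def)

lemma coalg_map_rep:
  assumes \<phi>: "coalg_map D E \<phi>" and x: "x \<in> carrier D" and r: "comul_rep D x A p q"
  shows "comul_rep E (\<phi> x) A (\<lambda>k. \<phi> (p k)) (\<lambda>k. \<phi> (q k))"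
  using tlift_pure_map_rep[OF coalg_mapD(1,2)[OF \<phi>] r] comul_repD[OF r] coalg_mapD(2)[OF \<phi>] \<phi> x
  by (auto simp: comul_rep_def coalg_map_def)

lemma coalg_map_Hom_k: "coalg_map D E \<phi> \<Longrightarrow> f \<in> Hom_k E \<Longrightarrow> f \<circ> \<phi> \<in> Hom_k D"
  unfolding Hom_k_iff comp_def
  by (rule linear_on_compose[of D E \<phi>]) (auto simp: coalg_map_def)

lemma (in comul_space) conv_coalg_map:
  assumes \<phi>: "coalg_map B E \<phi>" and f: "f \<in> Hom_k E" and g: "g \<in> Hom_k E" and x: "x \<in> carrier B"
  shows "conv B (f \<circ> \<phi>) (g \<circ> \<phi>) x = conv E f g (\<phi> x)"
proof -
  obtain m p q where r: "comul_rep B x {..<m::nat} p q" using comul_rep_exists[OF x] by blast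
  show ?thesis
    by (simp add: conv_rep[OF coalg_map_Hom_k[OF \<phi> f] coalg_map_Hom_k[OF \<phi> g] r]
        conv_rep[OF f g coalg_map_rep[OF \<phi> x r]])
qed

text \<open>Both conditions are linear, so pure tensors suffice, and there the comultiplication is a
  sum over choices. The assumption \<open>cm\<close> asks for this sum after \<phi> has been applied
  to its components.\<close>

lemma (in bialgebra) coalg_map_tensor_powerI:
  assumes E: "comul_space E" and lin: "linear_on (tensor_power B N) (scl E) \<phi>"
    and cl: "\<And>xs. xs \<in> tuples B N \<Longrightarrow> \<phi> (pure_tensor B xs) \<in> carrier E"
    and cu: "\<And>xs. xs \<in> tuples B N \<Longrightarrow>
      counit E (\<phi> (pure_tensor B xs)) = counit (tensor_power B N) (pure_tensor B xs)"
    and cm: "\<And>v m p q. (\<And>i. i \<in> set [0..<N] \<Longrightarrow> v i \<in> carrier B) \<Longrightarrow>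
      (\<And>i. i \<in> set [0..<N] \<Longrightarrow> comul_rep B (v i) {..<m i::nat} (p i) (q i)) \<Longrightarrow>
      comul E (\<phi> (pure_tensor B (map v [0..<N]))) = (\<Sum>g\<in>PiE (set [0..<N]) (\<lambda>i. {..<m i}).
        pure_tensor E [\<phi> (pure_tensor B (map (\<lambda>i. p i (g i)) [0..<N])),
          \<phi> (pure_tensor B (map (\<lambda>i. q i (g i)) [0..<N]))])"
  shows "coalg_map (tensor_power B N) E \<phi>"
proof -
  interpret E: comul_space E by (rule E)
  let ?T = "tensor_power B N"
  interpret T: comul_space ?T by (rule comul_space_tensor_power)
  have lin': "linear_on (tensor_algebra_power B N) (scl E) \<phi>"
    using lin by (simp add: linear_on_tensor_power)
  have cl': "\<phi> x \<in> carrier E" if "x \<in> tspace B N" for x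
    by (rule linear_on_tspace_closed[OF lin' E.kvec_axioms cl that])
  let ?G = "tlift ?T 2 tscale (\<lambda>xs. pure_tensor E (map \<phi> xs))"
  have ml: "multilinear ?T 2 tscale (\<lambda>xs. pure_tensor E (map \<phi> xs))"
    by (rule multilinear_pure_map[OF lin]) (simp add: cl')
  have pure: "comul E (\<phi> (pure_tensor B xs)) = ?G (comul ?T (pure_tensor B xs))" if xs: "xs \<in> tuples B N" for xs
  proof -
    have v: "xs ! i \<in> carrier B" if "i \<in> set [0..<N]" for i
      using that xs by (auto intro: tuples_nth)
    obtain m p q where r: "\<And>i. i \<in> set [0..<N] \<Longrightarrow> comul_rep B (xs ! i) {..<m i::nat} (p i) (q i)"
      by (rule ex_comul_reps[of "set [0..<N]" "(!) xs", OF v], assumption, rule that)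
    have R: "comul_rep ?T (pure_tensor B xs) (PiE (set [0..<N]) (\<lambda>i. {..<m i}))
      (\<lambda>g. pure_tensor B (map (\<lambda>i. p i (g i)) [0..<N])) (\<lambda>g. pure_tensor B (map (\<lambda>i. q i (g i)) [0..<N]))"
      unfolding pure_tensor_nth_map[OF xs]
      by (rule comul_rep_tensor_power) (use v r in auto)
    have "?G (comul ?T (pure_tensor B xs)) = (\<Sum>g\<in>PiE (set [0..<N]) (\<lambda>i. {..<m i}).
        pure_tensor E [\<phi> (pure_tensor B (map (\<lambda>i. p i (g i)) [0..<N])),
          \<phi> (pure_tensor B (map (\<lambda>i. q i (g i)) [0..<N]))])"
      by (rule tlift_pure_map_rep[OF lin _ R]) (simp add: cl')
    also have "\<dots> = comul E (\<phi> (pure_tensor B xs))"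
      unfolding pure_tensor_nth_map[OF xs] by (rule cm[OF v r, symmetric])
    finally show ?thesis ..
  qed
  have lG: "linear_on (tensor_algebra_power ?T 2) tscale ?G" by (rule tlift_linear'[OF ml])
  show ?thesis
    unfolding coalg_map_def
  proof (intro conjI ballI lin)
    fix x assume "x \<in> carrier ?T"
    then have x: "x \<in> tspace B N" by simp
    show "\<phi> x \<in> carrier E" by (rule cl'[OF x])
    show "counit E (\<phi> x) = counit ?T x"
    proof (rule linear_on_tspace_ext[where L = "\<lambda>x. counit E (\<phi> x)" and L' = "counit ?T", OF _ _ cu x])
      show "linear_on (tensor_algebra_power B N) (*) (\<lambda>x. counit E (\<phi> x))"
        by (rule linear_on_compose[OF lin', of "(*)" "counit E"])
          (use cl' E.counit_linear' in \<open>auto simp: Hom_k_def\<close>)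
      show "linear_on (tensor_algebra_power B N) (*) (counit ?T)"
        using T.counit_linear' by (simp add: Hom_k_def linear_on_tensor_power)
    qed
    show "comul E (\<phi> x) = ?G (comul ?T x)"
    proof (rule linear_on_tspace_ext[where L = "\<lambda>x. comul E (\<phi> x)" and L' = "\<lambda>x. ?G (comul ?T x)", OF _ _ pure x])
      show "linear_on (tensor_algebra_power B N) tscale (\<lambda>x. comul E (\<phi> x))"
        by (rule linear_on_compose[OF lin', of tscale "comul E"])
          (use cl' E.comul_linear' in auto)
      show "linear_on (tensor_algebra_power B N) tscale (\<lambda>x. ?G (comul ?T x))"
        by (rule linear_on_compose[of _ "tensor_algebra_power ?T 2" "comul ?T" tscale ?G])
          (use T.comul_linear' T.comul_closed' lG in \<open>auto simp: linear_on_tensor_power\<close>)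
    qed
  qed
qed

text \<open>The restriction puts the result back among the normalised functionals, so that pulling
  back is a map between convolution monoids.\<close>

definition pullback ::
  "('a::ab_group_add, 'k::field) bialg \<Rightarrow> ('a \<Rightarrow> 'b) \<Rightarrow> ('b \<Rightarrow> 'k) \<Rightarrow> 'a \<Rightarrow> 'k"
  where "pullback D \<phi> f = restrict (f \<circ> \<phi>) (carrier D)"

lemma (in comul_space) pullback_hom:
  assumes \<phi>: "coalg_map B E \<phi>"
  shows "pullback B \<phi> \<in> hom (conv_monoid E) (conv_monoid B)"
proof (rule homI)
  fix f g assume f: "f \<in> carrier (conv_monoid E)" and g: "g \<in> carrier (conv_monoid E)"
  then have f': "f \<in> Hom_k E" and g': "g \<in> Hom_k E" by (simp_all add: conv_monoid_simps)
  note F = coalg_map_Hom_k[OF \<phi> f'] and G = coalg_map_Hom_k[OF \<phi> g']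
  show "pullback B \<phi> f \<in> carrier (conv_monoid B)"
    unfolding pullback_def by (rule restrict_closed[OF F])
  show "pullback B \<phi> (f \<otimes>\<^bsub>conv_monoid E\<^esub> g) = pullback B \<phi> f \<otimes>\<^bsub>conv_monoid B\<^esub> pullback B \<phi> g"
    unfolding pullback_def conv_restrict[OF F G]
    by (rule restrict_ext)
      (simp add: conv_monoid_simps conv_coalg_map[OF \<phi> f' g'] coalg_mapD(2)[OF \<phi>])
qed

lemma pullback_one:
  assumes \<phi>: "coalg_map D E \<phi>"
  shows "pullback D \<phi> \<one>\<^bsub>conv_monoid E\<^esub> = \<one>\<^bsub>conv_monoid D\<^esub>"
  unfolding pullback_def conv_monoid_simps
  by (rule restrict_ext) (simp add: coalg_mapD(2,3)[OF \<phi>])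

lemma pullback_restrict:
  assumes \<phi>: "coalg_map D E \<phi>"
  shows "pullback D \<phi> (restrict f (carrier E)) = restrict (f \<circ> \<phi>) (carrier D)"
  unfolding pullback_def by (rule restrict_ext) (simp add: coalg_mapD(2)[OF \<phi>])

lemma (in comul_space) pullback_Units:
  assumes \<phi>: "coalg_map B E \<phi>" and f: "f \<in> Units (conv_monoid E)"
  shows "pullback B \<phi> f \<in> Units (conv_monoid B)"
proof -
  obtain g where g: "f \<in> carrier (conv_monoid E)" "g \<in> carrier (conv_monoid E)"
    "g \<otimes>\<^bsub>conv_monoid E\<^esub> f = \<one>\<^bsub>conv_monoid E\<^esub>" "f \<otimes>\<^bsub>conv_monoid E\<^esub> g = \<one>\<^bsub>conv_monoid E\<^esub>"
    using f by (auto simp: Units_def)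
  note h = pullback_hom[OF \<phi>]
  show ?thesis
    unfolding Units_def
    using g hom_in_carrier[OF h] hom_mult[OF h, symmetric] pullback_one[OF \<phi>]
    by (intro CollectI conjI bexI[of _ "pullback B \<phi> g"]) simp_all
qed

section \<open>Maps given by words in the tensor factors\<close>

text \<open>
  A list \<open>ws\<close> of words without common letters in the indices \<open>0, \<dots>, N - 1\<close> gives the map that
  multiplies the factors along each word and applies the counit to the factors in no word.
  Legs, multiplications of factors and insertions of the unit are of this form.
\<close>

definition wprod :: "('a::ab_group_add, 'k::field) bialg \<Rightarrow> (nat \<Rightarrow> 'a) \<Rightarrow> nat list \<Rightarrow> 'a"
  where "wprod B v w = foldr (\<lambda>i y. v i \<otimes>\<^bsub>B\<^esub> y) w \<one>\<^bsub>B\<^esub>"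

definition disjoint_words :: "nat \<Rightarrow> nat list list \<Rightarrow> bool"
  where "disjoint_words N ws \<longleftrightarrow> distinct (concat ws) \<and> set (concat ws) \<subseteq> {..<N}"

definition wmap_tuple :: "('a::ab_group_add, 'k::field) bialg \<Rightarrow> nat \<Rightarrow> nat list list \<Rightarrow> 'a list \<Rightarrow> ('a, 'k) tens"
  where "wmap_tuple B N ws = (\<lambda>xs. tscale (\<Prod>j\<in>{..<N} - set (concat ws). counit B (xs ! j))
    (pure_tensor B (map (wprod B ((!) xs)) ws)))"

definition wmap ::
  "('a::ab_group_add, 'k::field) bialg \<Rightarrow> nat \<Rightarrow> nat list list \<Rightarrow> ('a, 'k) tens \<Rightarrow> ('a, 'k) tens"
  where "wmap B N ws = tlift B N tscale (wmap_tuple B N ws)"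

lemma wprod_simps [simp]:
  "wprod B v [] = \<one>\<^bsub>B\<^esub>"
  "wprod B v (i # w) = v i \<otimes>\<^bsub>B\<^esub> wprod B v w"
  by (simp_all add: wprod_def)

lemma wprod_cong: "(\<And>i. i \<in> set w \<Longrightarrow> v i = v' i) \<Longrightarrow> wprod B v w = wprod B v' w"
  by (induction w) auto

lemma disjoint_nth_concat:
  "distinct (concat ws) \<Longrightarrow> l < length ws \<Longrightarrow> l' < length ws \<Longrightarrow> l \<noteq> l' \<Longrightarrow> set (ws ! l) \<inter> set (ws ! l') = {}"
proof (induction ws arbitrary: l l')
  case (Cons w ws)
  have w: "set w \<inter> set (ws ! l) = {}" if "l < length ws" for l
    using Cons.prems(1) that nth_mem[OF that] by fastforce
  show ?case
    using Cons.prems Cons.IH[of "l - 1" "l' - 1"] w[of "l - 1"] w[of "l' - 1"]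
    by (cases l; cases l') auto
qed simp

lemma distinct_nth_concat: "distinct (concat ws) \<Longrightarrow> l < length ws \<Longrightarrow> distinct (ws ! l)"
  by (simp add: distinct_concat_iff)

context bialgebra
begin

lemma wprod_closed: "(\<And>i. i \<in> set w \<Longrightarrow> v i \<in> carrier B) \<Longrightarrow> wprod B v w \<in> carrier B"
  by (induction w) auto

text \<open>A letter occurs only once in the word, so the variable factor enters the product
  once.\<close>

lemma wprod_linear:
  "distinct w \<Longrightarrow> j \<in> set w \<Longrightarrow> (\<And>i. i \<in> set w \<Longrightarrow> v i \<in> carrier B) \<Longrightarrow>
    linear_on B (scl B) (\<lambda>x. wprod B (v(j := x)) w)"
proof (induction w)
  case (Cons a w)
  show ?case
  proof (cases "a = j")
    case True
    then have "wprod B (v(j := x)) w = wprod B v w" for x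
      using Cons.prems by (intro wprod_cong) auto
    then have "(\<lambda>x. wprod B (v(j := x)) (a # w)) = (\<lambda>x. x \<otimes> wprod B v w)"
      using True by (simp del: fun_upd_apply) simp
    then show ?thesis
      using Cons.prems by (simp only:) (intro mult_linear_left wprod_closed, auto)
  next
    case False
    have cl: "wprod B (v(j := x)) w \<in> carrier B" if "x \<in> carrier B" for x
      using that Cons.prems by (intro wprod_closed) auto
    have "linear_on B (scl B) (\<lambda>x. wprod B (v(j := x)) w)"
      using False Cons.prems by (intro Cons.IH) auto
    from linear_on_compose[OF this cl mult_linear_right, of "v a"]
    show ?thesis using False Cons.prems(3)[of a] by (simp add: fun_upd_other del: fun_upd_apply)
  qed
qed simp

lemma counit_wprod: "(\<And>i. i \<in> set w \<Longrightarrow> v i \<in> carrier B) \<Longrightarrow>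
    counit B (wprod B v w) = prod_list (map (\<lambda>i. counit B (v i)) w)"
  by (induction w) (auto simp: counit_one counit_mult wprod_closed)

text \<open>Comultiplication is multiplicative, so every letter splits on its own, and the
  components are multiplied along the same word on the left and on the right.\<close>

lemma comul_rep_wprod:
  assumes "distinct w" "\<And>i. i \<in> set w \<Longrightarrow> v i \<in> carrier B"
    and "\<And>i. i \<in> set w \<Longrightarrow> comul_rep B (v i) (A i) (p i) (q i)"
  shows "comul_rep B (wprod B v w) (PiE (set w) A)
    (\<lambda>g. wprod B (\<lambda>i. p i (g i)) w) (\<lambda>g. wprod B (\<lambda>i. q i (g i)) w)"
  using assms
proof (induction w)
  case Nil
  show ?case by (simp add: comul_rep_def comul_one numeral_2_eq_2)
next
  case (Cons a w)
  have IH: "comul_rep B (wprod B v w) (PiE (set w) A)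
    (\<lambda>g. wprod B (\<lambda>i. p i (g i)) w) (\<lambda>g. wprod B (\<lambda>i. q i (g i)) w)"
    using Cons by simp
  have upd: "wprod B (\<lambda>i. r i ((g(a := k)) i)) w = wprod B (\<lambda>i. r i (g i)) w" for r g k
    using Cons.prems(1) by (intro wprod_cong) auto
  have fin: "finite (PiE (set (a # w)) A)"
    using comul_repD(1)[OF Cons.prems(3)] by (intro finite_PiE) auto
  have mem: "p i (g i) \<in> carrier B" "q i (g i) \<in> carrier B" if "g \<in> PiE (set (a # w)) A" "i \<in> set (a # w)" for g i
    using comul_repD(2,3)[OF Cons.prems(3)[OF that(2)] PiE_mem[OF that]] .
  have "comul_rep B (v a \<otimes> wprod B v w) (A a \<times> PiE (set w) A)
      (\<lambda>(k, l). p a k \<otimes> wprod B (\<lambda>i. p i (l i)) w) (\<lambda>(k, l). q a k \<otimes> wprod B (\<lambda>i. q i (l i)) w)"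
    using Cons.prems by (intro comul_rep_mult IH wprod_closed) auto
  from comul_repD(4)[OF this]
  have "comul B (v a \<otimes> wprod B v w) = (\<Sum>k\<in>A a. \<Sum>g\<in>PiE (set w) A.
      pure_tensor B [p a k \<otimes> wprod B (\<lambda>i. p i (g i)) w, q a k \<otimes> wprod B (\<lambda>i. q i (g i)) w])"
    by (simp add: sum.cartesian_product case_prod_unfold)
  also have "\<dots> = (\<Sum>g\<in>PiE (set (a # w)) A.
      pure_tensor B [wprod B (\<lambda>i. p i (g i)) (a # w), wprod B (\<lambda>i. q i (g i)) (a # w)])"
    using Cons.prems(1) by (simp add: sum_PiE_insert upd del: fun_upd_apply) simp
  finally show ?case
    unfolding comul_rep_def using fin mem by (auto intro!: m_closed wprod_closed)
qed

text \<open>Slot \<open>j\<close> enters once: through its counit if it is in no word, and otherwise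
  through the one word that contains it, that is, through a single slot of the pure tensor.\<close>

lemma wmap_tuple_multilinear:
  assumes ws: "disjoint_words N ws"
  shows "multilinear B N tscale (wmap_tuple B N ws)"
proof (rule multilinearI)
  fix xs j assume xs: "xs \<in> tuples B N" and j: "j < N"
  let ?U = "set (concat ws)"
  have U: "?U \<subseteq> {..<N}" and dist: "distinct (concat ws)" using ws by (simp_all add: disjoint_words_def)
  have len: "length xs = N" by (rule tuples_length[OF xs])
  have xsc: "xs ! i \<in> carrier B" if "i < N" for i by (rule tuples_nth[OF xs that])
  have wcl: "wprod B ((!) xs) w \<in> carrier B" if "w \<in> set ws" for w
    using that U xsc by (intro wprod_closed) auto
  show "linear_on B tscale (\<lambda>x. wmap_tuple B N ws (xs[j := x]))"
  proof (cases "j \<in> ?U")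
    case False
    have "wprod B ((!) (xs[j := x])) w = wprod B ((!) xs) w" if "w \<in> set ws" for w x
      using that False by (intro wprod_cong) (metis UN_I nth_list_update_neq set_concat)
    then have eq: "map (wprod B ((!) (xs[j := x]))) ws = map (wprod B ((!) xs)) ws" for x by simp
    have "(\<Prod>i\<in>{..<N} - ?U. counit B (xs[j := x] ! i)) =
        counit B x * (\<Prod>i\<in>{..<N} - ?U - {j}. counit B (xs ! i))" for x
      using j False len by (subst prod.remove[of _ j]) auto
    then show ?thesis
      unfolding wmap_tuple_def eq
      using counit_linear
      by (intro linear_onI) (simp_all add: Hom_k_def linear_on_def distrib_right tens.scale_left_distrib)
  next
    case True
    then obtain l where l: "l < length ws" "j \<in> set (ws ! l)"
      by (metis UN_E in_set_conv_nth set_concat)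
    have "(\<Prod>i\<in>{..<N} - ?U. counit B (xs[j := x] ! i)) = (\<Prod>i\<in>{..<N} - ?U. counit B (xs ! i))" for x
      using True by (intro prod.cong refl) (metis DiffD2 nth_list_update_neq)
    moreover have "map (wprod B ((!) (xs[j := x]))) ws =
        (map (wprod B ((!) xs)) ws)[l := wprod B (((!) xs)(j := x)) (ws ! l)]" for x
    proof (rule nth_equalityI)
      fix l' assume "l' < length (map (wprod B ((!) (xs[j := x]))) ws)"
      then have l': "l' < length ws" by simp
      show "map (wprod B ((!) (xs[j := x]))) ws ! l' =
          (map (wprod B ((!) xs)) ws)[l := wprod B (((!) xs)(j := x)) (ws ! l)] ! l'"
      proof (cases "l' = l")
        case True
        then show ?thesis using l' j len by (auto intro!: wprod_cong simp: nth_list_update)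
      next
        case False
        then have "j \<notin> set (ws ! l')" using disjoint_nth_concat[OF dist l(1) l'] l(2) by auto
        then have "wprod B ((!) (xs[j := x])) (ws ! l') = wprod B ((!) xs) (ws ! l')"
          by (intro wprod_cong) (metis nth_list_update_neq)
        then show ?thesis using False l' by simp
      qed
    qed simp
    moreover have "linear_on B tscale (\<lambda>x. pure_tensor B
        ((map (wprod B ((!) xs)) ws)[l := wprod B (((!) xs)(j := x)) (ws ! l)]))"
    proof (rule linear_on_compose[where W = B and f = "\<lambda>x. wprod B (((!) xs)(j := x)) (ws ! l)"
          and g = "\<lambda>y. pure_tensor B ((map (wprod B ((!) xs)) ws)[l := y])"])
      have *: "xs ! i \<in> carrier B" if "i \<in> set (ws ! l)" for i
      proof -
        have "i \<in> ?U" using that nth_mem[OF l(1)] by auto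
        then show ?thesis using U by (intro xsc) auto
      qed
      show "linear_on B (scl B) (\<lambda>x. wprod B (((!) xs)(j := x)) (ws ! l))"
        using * l distinct_nth_concat[OF dist l(1)] by (intro wprod_linear) auto
      show "wprod B (((!) xs)(j := x)) (ws ! l) \<in> carrier B" if "x \<in> carrier B" for x
        using * that by (intro wprod_closed) auto
      show "linear_on B tscale (\<lambda>y. pure_tensor B ((map (wprod B ((!) xs)) ws)[l := y]))"
        using wcl l by (intro linear_on_pure_slot tuples_map) auto
    qed
    ultimately show ?thesis
      unfolding wmap_tuple_def by (auto intro!: linear_on_scale_fun vector_space_tscale)
  qed
qed

lemma wmap_linear: "disjoint_words N ws \<Longrightarrow> linear_on (tensor_power B N) tscale (wmap B N ws)"
  unfolding wmap_def linear_on_tensor_power by (rule tlift_linear'[OF wmap_tuple_multilinear])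

lemma wmap_pure:
  assumes "disjoint_words N ws" "\<And>i. i < N \<Longrightarrow> v i \<in> carrier B"
  shows "wmap B N ws (pure_tensor B (map v [0..<N])) =
    tscale (\<Prod>j\<in>{..<N} - set (concat ws). counit B (v j)) (pure_tensor B (map (wprod B v) ws))"
proof -
  have "map (wprod B ((!) (map v [0..<N]))) ws = map (wprod B v) ws"
    using assms(1) by (intro map_cong refl wprod_cong) (auto simp: disjoint_words_def subset_iff)
  moreover have "(\<Prod>j\<in>{..<N} - set (concat ws). counit B (map v [0..<N] ! j)) =
      (\<Prod>j\<in>{..<N} - set (concat ws). counit B (v j))"
    by (intro prod.cong) auto
  moreover have tup: "map v [0..<N] \<in> tuples B N" using assms(2) by (intro tuples_map) auto
  ultimately show ?thesis
    unfolding wmap_def tlift_pure[OF vector_space_tscale wmap_tuple_multilinear[OF assms(1)] tup]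
    by (simp only: wmap_tuple_def)
qed

lemma wprod_tuple:
  assumes "disjoint_words N ws" "\<And>i. i < N \<Longrightarrow> v i \<in> carrier B"
  shows "map (wprod B v) ws \<in> tuples B (length ws)"
  using assms by (intro tuples_map wprod_closed) (auto simp: disjoint_words_def)

lemma coalg_map_wmap:
  assumes ws: "disjoint_words N ws"
  defines "E \<equiv> tensor_power B (length ws)"
  shows "coalg_map (tensor_power B N) E (wmap B N ws)"
proof (rule coalg_map_tensor_powerI)
  let ?U = "set (concat ws)"
  have U: "?U \<subseteq> {..<N}" and dist: "distinct (concat ws)" using ws by (simp_all add: disjoint_words_def)
  have split: "set [0..<N] = ?U \<union> ({..<N} - ?U)" using U by auto
  show E: "comul_space E" unfolding E_def by (rule comul_space_tensor_power)
  interpret E: comul_space E by (rule E)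
  have sE: "scl E = tscale" "carrier E = tspace B (length ws)" by (simp_all add: E_def)
  show "linear_on (tensor_power B N) (scl E) (wmap B N ws)"
    unfolding sE by (rule wmap_linear[OF ws])
  {
    fix xs assume xs: "xs \<in> tuples B N"
    have xsc: "xs ! i \<in> carrier B" if "i < N" for i by (rule tuples_nth[OF xs that])
    note wp = wmap_pure[OF ws, of "(!) xs", OF xsc, folded pure_tensor_nth_map[OF xs]]
    note tup = wprod_tuple[OF ws, of "(!) xs", OF xsc]
    show "wmap B N ws (pure_tensor B xs) \<in> carrier E"
      using tup by (simp add: wp sE)
    have "counit E (wmap B N ws (pure_tensor B xs)) =
        (\<Prod>j\<in>{..<N} - ?U. counit B (xs ! j)) * prod_list (map (counit B) (map (wprod B ((!) xs)) ws))"
      using tup linear_on_scale[of E "(*)" "counit E"] E.counit_linear'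
      by (simp add: wp sE Hom_k_def) (simp add: E_def counit_pure)
    also have "map (counit B) (map (wprod B ((!) xs)) ws) =
        map (\<lambda>w. prod_list (map (\<lambda>i. counit B (xs ! i)) w)) ws"
      using U xsc by (auto intro!: counit_wprod)
    also have "prod_list \<dots> = prod_list (map (\<lambda>i. counit B (xs ! i)) (concat ws))"
      by (induction ws) auto
    also have "\<dots> = (\<Prod>i\<in>?U. counit B (xs ! i))"
      using prod.distinct_set_conv_list[OF dist, of "\<lambda>i. counit B (xs ! i)"] by simp
    also have "(\<Prod>j\<in>{..<N} - ?U. counit B (xs ! j)) * \<dots> = (\<Prod>i<N. counit B (xs ! i))"
      using prod.subset_diff[OF U, of "\<lambda>i. counit B (xs ! i)"] by simp
    also have "\<dots> = counit (tensor_power B N) (pure_tensor B xs)"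
      unfolding pure_tensor_nth_map[OF xs] using xsc
      by (subst counit_pure_map) (auto simp: atLeast0LessThan)
    finally show "counit E (wmap B N ws (pure_tensor B xs)) = counit (tensor_power B N) (pure_tensor B xs)" .
  }
  fix v m p q
  assume v: "\<And>i. i \<in> set [0..<N] \<Longrightarrow> v i \<in> carrier B"
    and r: "\<And>i. i \<in> set [0..<N] \<Longrightarrow> comul_rep B (v i) {..<m i::nat} (p i) (q i)"
  let ?A = "\<lambda>i. {..<m i}"
  \<comment> \<open>The summand of the comultiplication of the image that belongs to
    \<open>h\<close>; it depends on the choices at the used letters only.\<close>
  define G where "G h = pure_tensor E [pure_tensor B (map (wprod B (\<lambda>i. p i (h i))) ws),
    pure_tensor B (map (wprod B (\<lambda>i. q i (h i))) ws)]" for h :: "nat \<Rightarrow> nat"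
  have vN: "v i \<in> carrier B" if "i < N" for i using v that by simp
  have wl: "i < N" if "l < length ws" "i \<in> set (ws ! l)" for i l
  proof -
    have "i \<in> ?U" using that nth_mem[OF that(1)] by auto
    then show ?thesis using U by auto
  qed
  have tup: "map (wprod B v) ws \<in> tuples B (length ws)" by (rule wprod_tuple[OF ws vN])
  have un: "(\<Union>l\<in>set [0..<length ws]. set (ws ! l)) = ?U"
  proof -
    have "set ws = (!) ws ` set [0..<length ws]" by (metis map_nth set_map)
    then have "set ` set ws = (\<lambda>l. set (ws ! l)) ` set [0..<length ws]" by (simp only: image_image)
    then show ?thesis by simp
  qed
  have eqm: "map (\<lambda>l. wprod B (f l) (ws ! l)) [0..<length ws] = map (wprod B f') ws"
    if "\<And>l i. l < length ws \<Longrightarrow> i \<in> set (ws ! l) \<Longrightarrow> f l i = f' i" for f f'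
    using that by (intro nth_equalityI) (auto intro!: wprod_cong)
  have "comul_rep E (pure_tensor B (map (\<lambda>l. wprod B v (ws ! l)) [0..<length ws]))
      (PiE (set [0..<length ws]) (\<lambda>l. PiE (set (ws ! l)) ?A))
      (\<lambda>g. pure_tensor B (map (\<lambda>l. wprod B (\<lambda>i. p i (g l i)) (ws ! l)) [0..<length ws]))
      (\<lambda>g. pure_tensor B (map (\<lambda>l. wprod B (\<lambda>i. q i (g l i)) (ws ! l)) [0..<length ws]))"
    unfolding E_def
    by (rule comul_rep_tensor_power; (rule comul_rep_wprod)?)
      (auto simp: wl distinct_nth_concat[OF dist] intro!: wprod_closed vN r)
  from comul_repD(4)[OF this]
  have "comul E (pure_tensor B (map (wprod B v) ws)) =
      (\<Sum>g\<in>PiE (set [0..<length ws]) (\<lambda>l. PiE (set (ws ! l)) ?A). pure_tensor E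
        [pure_tensor B (map (\<lambda>l. wprod B (\<lambda>i. p i (g l i)) (ws ! l)) [0..<length ws]),
         pure_tensor B (map (\<lambda>l. wprod B (\<lambda>i. q i (g l i)) (ws ! l)) [0..<length ws])])"
    by (subst (asm) eqm) auto
  also have "\<dots> = (\<Sum>h\<in>PiE ?U ?A. G h)"
    unfolding G_def
    by (subst sum_PiE_UN, use disjoint_nth_concat[OF dist] in force, unfold un,
        intro sum.cong refl arg_cong[where f = "pure_tensor E"] arg_cong2[where f = Cons] arg_cong[where f = "pure_tensor B"] eqm)
      auto
  finally have comul_w: "comul E (pure_tensor B (map (wprod B v) ws)) = (\<Sum>h\<in>PiE ?U ?A. G h)" .
  have "(\<Sum>g\<in>PiE (set [0..<N]) ?A. pure_tensor E
      [wmap B N ws (pure_tensor B (map (\<lambda>i. p i (g i)) [0..<N])),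
       wmap B N ws (pure_tensor B (map (\<lambda>i. q i (g i)) [0..<N]))]) =
    (\<Sum>g\<in>PiE (?U \<union> ({..<N} - ?U)) ?A.
      tscale (\<Prod>j\<in>{..<N} - ?U. counit B (p j (g j)) * counit B (q j (g j))) (G (restrict g ?U)))"
    unfolding split
  proof (rule sum.cong[OF refl])
    fix g assume "g \<in> PiE (?U \<union> ({..<N} - ?U)) ?A"
    then have g: "g \<in> PiE (set [0..<N]) ?A" unfolding split .
    have pc: "p i (g i) \<in> carrier B" and qc: "q i (g i) \<in> carrier B" if "i < N" for i
      using comul_repD(2,3)[OF r PiE_mem[OF g], of i] that by auto
    note tp = wprod_tuple[OF ws, of "\<lambda>i. p i (g i)", OF pc]
    note tq = wprod_tuple[OF ws, of "\<lambda>i. q i (g i)", OF qc]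
    let ?P = "pure_tensor B (map (wprod B (\<lambda>i. p i (g i))) ws)"
    let ?Q = "pure_tensor B (map (wprod B (\<lambda>i. q i (g i))) ws)"
    have PQ: "?P \<in> carrier E" "?Q \<in> carrier E" using tp tq by (simp_all add: sE)
    have "G (restrict g ?U) = pure_tensor E [?P, ?Q]"
      unfolding G_def
      by (intro arg_cong[where f = "pure_tensor E"] arg_cong2[where f = Cons] arg_cong[where f = "pure_tensor B"]
          map_cong refl wprod_cong) auto
    moreover have "pure_tensor E [tscale c ?P, tscale d ?Q] = tscale (c * d) (pure_tensor E [?P, ?Q])" for c d
      using linear_on_scale[OF E.linear_on_pure_pair(1), of "tscale d ?Q" ?P c]
        linear_on_scale[OF E.linear_on_pure_pair(2), of ?P ?Q d] PQ E.scl_closed[of ?Q d] by (simp add: sE)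
    ultimately show "pure_tensor E
      [wmap B N ws (pure_tensor B (map (\<lambda>i. p i (g i)) [0..<N])),
       wmap B N ws (pure_tensor B (map (\<lambda>i. q i (g i)) [0..<N]))] =
      tscale (\<Prod>j\<in>{..<N} - ?U. counit B (p j (g j)) * counit B (q j (g j))) (G (restrict g ?U))"
      using wmap_pure[of N ws "\<lambda>i. p i (g i)", OF ws pc] wmap_pure[of N ws "\<lambda>i. q i (g i)", OF ws qc]
      by (simp only: prod.distrib)
  qed
  also have "\<dots> = tscale (\<Prod>j\<in>{..<N} - ?U. \<Sum>k\<in>?A j. counit B (p j k) * counit B (q j k)) (\<Sum>h\<in>PiE ?U ?A. G h)"
    by (rule sum_PiE_drop[OF vector_space_tscale]) auto
  also have "(\<Prod>j\<in>{..<N} - ?U. \<Sum>k\<in>?A j. counit B (p j k) * counit B (q j k)) =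
      (\<Prod>j\<in>{..<N} - ?U. counit B (v j))"
  proof (rule prod.cong[OF refl])
    fix j assume "j \<in> {..<N} - ?U"
    then have j: "j \<in> set [0..<N]" by simp
    have "linear_on B (*) (counit B)" using counit_linear by (simp add: Hom_k_def)
    from linear_on_comb[OF this, of "?A j" "q j" "\<lambda>k. counit B (p j k)"]
    show "(\<Sum>k\<in>?A j. counit B (p j k) * counit B (q j k)) = counit B (v j)"
      using counit_rep(1)[OF v[OF j] r[OF j]] comul_repD(3)[OF r[OF j]] by simp
  qed
  also have "tscale (\<Prod>j\<in>{..<N} - ?U. counit B (v j)) (\<Sum>h\<in>PiE ?U ?A. G h) =
      comul E (wmap B N ws (pure_tensor B (map v [0..<N])))"
    using linear_on_scale[OF E.comul_linear', of "pure_tensor B (map (wprod B v) ws)"] tup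
      wmap_pure[of N ws v, OF ws vN] comul_w by (simp add: sE)
  finally show "comul E (wmap B N ws (pure_tensor B (map v [0..<N]))) =
    (\<Sum>g\<in>PiE (set [0..<N]) ?A. pure_tensor E
      [wmap B N ws (pure_tensor B (map (\<lambda>i. p i (g i)) [0..<N])),
       wmap B N ws (pure_tensor B (map (\<lambda>i. q i (g i)) [0..<N]))])" ..
qed

end

section \<open>Composition of word maps\<close>

lemma UN_Diff_disjoint:
  assumes "J \<subseteq> I" "\<And>i j. i \<in> I \<Longrightarrow> j \<in> I \<Longrightarrow> i \<noteq> j \<Longrightarrow> S i \<inter> S j = {}"
  shows "(\<Union>i\<in>I - J. S i) = (\<Union>i\<in>I. S i) - (\<Union>i\<in>J. S i)"
proof -
  have "x \<notin> S j" if "x \<in> S i" "i \<in> I - J" "j \<in> J" for x i j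
    using assms(2)[of i j] assms(1) that by blast
  then show ?thesis by blast
qed

lemma prod_list_eq_set: "distinct is \<Longrightarrow> prod_list (map f is) = (\<Prod>i\<in>set is. f i)"
  by (simp add: prod.distinct_set_conv_list)

context bialgebra
begin

lemma wprod_append:
  "(\<And>i. i \<in> set w \<union> set w' \<Longrightarrow> v i \<in> carrier B) \<Longrightarrow> wprod B v (w @ w') = wprod B v w \<otimes> wprod B v w'"
  by (induction w) (auto simp: m_assoc wprod_closed)

lemma wprod_concat:
  "(\<And>i. i \<in> set (concat us) \<Longrightarrow> v i \<in> carrier B) \<Longrightarrow>
    wprod B v (concat us) = foldr (\<lambda>u y. wprod B v u \<otimes> y) us \<one>"
proof (induction us)
  case (Cons u us)
  then show ?case using wprod_append[of u "concat us" v] by simp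
qed simp

end

text \<open>A letter of \<open>vs\<close> is a position in \<open>ws\<close>. Substituting for it
  the word at that position describes the map of \<open>ws\<close> followed by the map of
  \<open>vs\<close>.\<close>

definition compose_words :: "nat list list \<Rightarrow> nat list list \<Rightarrow> nat list list"
  where "compose_words ws vs = map (\<lambda>v. concat (map ((!) ws) v)) vs"

lemma concat_compose_words: "concat (compose_words ws vs) = concat (map ((!) ws) (concat vs))"
  by (induction vs) (simp_all add: compose_words_def)

lemma set_nth_subset_concat: "l < length ws \<Longrightarrow> set (ws ! l) \<subseteq> set (concat ws)"
  unfolding set_concat using nth_mem[of l ws] by blast

lemma distinct_concat_nth:
  assumes "distinct (concat ws)" "distinct us" "set us \<subseteq> {..<length ws}"
  shows "distinct (concat (map ((!) ws) us))"
  using assms(2,3)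
proof (induction us)
  case (Cons u us)
  have "set (ws ! u) \<inter> set (ws ! u') = {}" if "u' \<in> set us" for u'
    using Cons.prems that by (intro disjoint_nth_concat[OF assms(1)]) auto
  then show ?case
    using Cons distinct_nth_concat[OF assms(1)] by auto
qed simp

lemma disjoint_words_compose:
  assumes "disjoint_words N ws" "disjoint_words (length ws) vs"
  shows "disjoint_words N (compose_words ws vs)"
  unfolding disjoint_words_def concat_compose_words
proof
  show "distinct (concat (map ((!) ws) (concat vs)))"
    using assms by (intro distinct_concat_nth) (simp_all add: disjoint_words_def)
  have "set (ws ! l) \<subseteq> {..<N}" if "l \<in> set (concat vs)" for l
    using that assms set_nth_subset_concat[of l ws] unfolding disjoint_words_def by blast
  then show "set (concat (map ((!) ws) (concat vs))) \<subseteq> {..<N}" by auto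
qed

context bialgebra
begin

lemma wmap_compose:
  assumes ws: "disjoint_words N ws" and vs: "disjoint_words (length ws) vs" and t: "t \<in> tspace B N"
  shows "wmap B (length ws) vs (wmap B N ws t) = wmap B N (compose_words ws vs) t"
proof -
  let ?M = "length ws"
  note cs = disjoint_words_compose[OF ws vs]
  have dw: "distinct (concat ws)" "set (concat ws) \<subseteq> {..<N}" using ws by (simp_all add: disjoint_words_def)
  have dv: "distinct (concat vs)" "set (concat vs) \<subseteq> {..<?M}" using vs by (simp_all add: disjoint_words_def)
  have lin: "linear_on (tensor_algebra_power B N) tscale (wmap B N ws)"
    "linear_on (tensor_algebra_power B ?M) tscale (wmap B ?M vs)"
    "linear_on (tensor_algebra_power B N) tscale (wmap B N (compose_words ws vs))"
    using wmap_linear[OF ws] wmap_linear[OF vs] wmap_linear[OF cs] by (simp_all add: linear_on_tensor_power)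
  have cl: "wmap B N ws t \<in> tspace B ?M" if "t \<in> tspace B N" for t
    using coalg_mapD(2)[OF coalg_map_wmap[OF ws], of t] that by simp
  show ?thesis
  proof (rule linear_on_tspace_ext[where L = "\<lambda>t. wmap B ?M vs (wmap B N ws t)", OF _ lin(3) _ t])
    show "linear_on (tensor_algebra_power B N) tscale (\<lambda>t. wmap B ?M vs (wmap B N ws t))"
      by (rule linear_on_compose[of _ "tensor_algebra_power B ?M" "wmap B N ws"]) (use lin cl in auto)
    fix xs assume xs: "xs \<in> tuples B N"
    define v where "v = (!) xs"
    have v: "v i \<in> carrier B" if "i < N" for i unfolding v_def by (rule tuples_nth[OF xs that])
    define V where "V l = wprod B v (ws ! l)" for l
    have wl: "i < N" if "l < ?M" "i \<in> set (ws ! l)" for i l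
      using set_nth_subset_concat[OF that(1)] that(2) dw(2) by auto
    have V: "V l \<in> carrier B" if "l < ?M" for l
      unfolding V_def using that by (intro wprod_closed v) (rule wl)
    have map_V: "map (wprod B v) ws = map V [0..<?M]"
      unfolding V_def by (intro nth_equalityI) auto
    have tup: "map V [0..<?M] \<in> tuples B ?M" using V by (intro tuples_map) auto
    \<comment> \<open>By associativity a product of products along words is the product along the
      concatenated word.\<close>
    have words: "map (wprod B V) vs = map (wprod B v) (compose_words ws vs)"
    proof -
      have "wprod B V u = wprod B v (concat (map ((!) ws) u))" if "u \<in> set vs" for u
      proof -
        have "set u \<subseteq> {..<?M}" using that dv(2) by auto
        then have "\<And>i. i \<in> set (concat (map ((!) ws) u)) \<Longrightarrow> v i \<in> carrier B"
          using wl v by auto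
        from wprod_concat[of "map ((!) ws) u" v, OF this] show ?thesis
          by (simp add: wprod_def[of B V] V_def foldr_map comp_def)
      qed
      then show ?thesis by (simp add: compose_words_def)
    qed
    \<comment> \<open>A factor is lost in the composite if it lies in no word of \<open>ws\<close>,
      or in a word that \<open>vs\<close> omits; the counit of such a word is the product of the
      counits of its letters.\<close>
    have unused: "(\<Prod>l\<in>{..<?M} - set (concat vs). counit B (V l)) * (\<Prod>j\<in>{..<N} - set (concat ws). counit B (v j))
      = (\<Prod>j\<in>{..<N} - set (concat (compose_words ws vs)). counit B (v j))"
    proof -
      have "counit B (V l) = (\<Prod>i\<in>set (ws ! l). counit B (v i))" if "l < ?M" for l
        unfolding V_def using that wl v distinct_nth_concat[OF dw(1) that]
        by (subst counit_wprod) (auto simp: prod_list_eq_set)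
      then have "(\<Prod>l\<in>{..<?M} - set (concat vs). counit B (V l)) =
          (\<Prod>l\<in>{..<?M} - set (concat vs). \<Prod>i\<in>set (ws ! l). counit B (v i))"
        by (intro prod.cong) auto
      also have "\<dots> = (\<Prod>j\<in>(\<Union>l\<in>{..<?M} - set (concat vs). set (ws ! l)). counit B (v j))"
        using disjoint_nth_concat[OF dw(1)] by (intro prod.UNION_disjoint[symmetric]) auto
      also have "(\<Union>l\<in>{..<?M} - set (concat vs). set (ws ! l)) = set (concat ws) - set (concat (compose_words ws vs))"
      proof -
        have "set (concat ws) = (\<Union>l\<in>{..<?M}. set (ws ! l))"
          by (auto simp: set_conv_nth[of ws])
        moreover have "set (concat (compose_words ws vs)) = (\<Union>l\<in>set (concat vs). set (ws ! l))"
          unfolding concat_compose_words by simp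
        moreover have "(\<Union>l\<in>{..<?M} - set (concat vs). set (ws ! l)) =
            (\<Union>l\<in>{..<?M}. set (ws ! l)) - (\<Union>l\<in>set (concat vs). set (ws ! l))"
          by (rule UN_Diff_disjoint[OF dv(2) disjoint_nth_concat[OF dw(1)]]) auto
        ultimately show ?thesis by (simp only:)
      qed
      finally have "(\<Prod>l\<in>{..<?M} - set (concat vs). counit B (V l)) =
        (\<Prod>j\<in>set (concat ws) - set (concat (compose_words ws vs)). counit B (v j))" .
      moreover have "{..<N} - set (concat (compose_words ws vs)) =
          (set (concat ws) - set (concat (compose_words ws vs))) \<union> ({..<N} - set (concat ws))"
        using dw(2) dv(2) set_nth_subset_concat[of _ ws] unfolding concat_compose_words by fastforce
      ultimately show ?thesis
        by (simp add: prod.union_disjoint[symmetric] Int_Diff Diff_Int_distrib2 del: set_concat)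
    qed
    have "wmap B N ws (pure_tensor B xs) =
        tscale (\<Prod>j\<in>{..<N} - set (concat ws). counit B (v j)) (pure_tensor B (map V [0..<?M]))"
      using wmap_pure[of N ws v, OF ws v] pure_tensor_nth_map[OF xs, folded v_def] map_V by simp
    then have "wmap B ?M vs (wmap B N ws (pure_tensor B xs)) =
        tscale (\<Prod>j\<in>{..<N} - set (concat ws). counit B (v j)) (wmap B ?M vs (pure_tensor B (map V [0..<?M])))"
      using linear_on_scale[OF lin(2)] tup by simp
    also have "\<dots> = tscale (\<Prod>j\<in>{..<N} - set (concat (compose_words ws vs)). counit B (v j))
        (pure_tensor B (map (wprod B v) (compose_words ws vs)))"
      using wmap_pure[of ?M vs V, OF vs V] by (simp add: words unused[symmetric] mult.commute del: set_concat)
    also have "\<dots> = wmap B N (compose_words ws vs) (pure_tensor B xs)"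
      using wmap_pure[of N _ v, OF cs v] pure_tensor_nth_map[OF xs, folded v_def] by simp
    finally show "wmap B ?M vs (wmap B N ws (pure_tensor B xs)) = wmap B N (compose_words ws vs) (pure_tensor B xs)" .
  qed
qed

end

section \<open>Regrouping tensor powers of tensor powers\<close>

lemma multilinear_space_cong:
  "carrier V = carrier W \<Longrightarrow> scl V = scl W \<Longrightarrow> multilinear V N sW f = multilinear W N sW f"
  by (simp add: multilinear_def tuples_def)

lemma concat_map_blocks: "concat (map (\<lambda>l. map v [l * n..<Suc l * n]) [0..<m]) = map v [0..<m * n]"
proof (induction m)
  case (Suc m)
  have "[0..<Suc m * n] = [0..<m * n] @ [m * n..<Suc m * n]"
    using upt_add_eq_append[of 0 "m * n" n] by (simp add: add.commute)
  then show ?case using Suc by simp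
qed simp

definition block :: "('a::ab_group_add, 'k::field) bialg \<Rightarrow> nat \<Rightarrow> (nat \<Rightarrow> 'a) \<Rightarrow> nat \<Rightarrow> ('a, 'k) tens"
  where "block B n v l = pure_tensor B (map v [l * n..<Suc l * n])"

text \<open>The canonical map from \<open>(B^n)^m\<close> to \<open>B^(mn)\<close>. It extends
  \<open>regroup\<close> from two blocks to any number, as the unit conditions are evaluated on one
  block and the cocycle equation on three.\<close>

definition flatten ::
  "('a::ab_group_add, 'k::field) bialg \<Rightarrow> nat \<Rightarrow> nat \<Rightarrow> (('a, 'k) tens, 'k) tens \<Rightarrow> ('a, 'k) tens"
  where "flatten B n m = tlift (tensor_power B n) m tscale (tconcat B n)"

context comul_space
begin

lemma block_closed:
  assumes "\<And>i. i < m * n \<Longrightarrow> v i \<in> carrier B" "l < m"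
  shows "block B n v l \<in> tspace B n"
proof -
  have "Suc l * n \<le> m * n" using assms(2) by (intro mult_le_mono1) simp
  then have "i < m * n" if "i < Suc l * n" for i using that by linarith
  then show ?thesis
    unfolding block_def using assms(1) by (intro pure_tensor_closed tuples_map) auto
qed

text \<open>Pure tensors of pure tensors span \<open>(B^n)^m\<close>. Listing all their entries in
  one family \<open>v\<close> makes them comparable with pure tensors of
  \<open>B^(mn)\<close>.\<close>

lemma tensor_power_power_ext:
  fixes L :: "(('a, 'k) tens, 'k) tens \<Rightarrow> 'w::ab_group_add"
  assumes L: "linear_on (tensor_algebra_power (tensor_power B n) m) sW L"
    "linear_on (tensor_algebra_power (tensor_power B n) m) sW L'"
    and eq: "\<And>v. (\<And>i. i < m * n \<Longrightarrow> v i \<in> carrier B) \<Longrightarrow>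
      L (pure_tensor (tensor_power B n) (map (block B n v) [0..<m])) =
      L' (pure_tensor (tensor_power B n) (map (block B n v) [0..<m]))"
    and t: "t \<in> tspace (tensor_power B n) m"
  shows "L t = L' t"
proof (rule linear_on_tspace_ext[OF L _ t])
  let ?T = "tensor_power B n"
  interpret T: kvec ?T by (rule kvec_tensor_power)
  fix ts assume ts: "ts \<in> tuples ?T m"
  show "L (pure_tensor ?T ts) = L' (pure_tensor ?T ts)"
  proof (rule T.multilinear_ext[OF multilinear_pure_compose[OF L(1)] multilinear_pure_compose[OF L(2)] _ _ ts])
    show "carrier ?T = T.span (pure_tensor B ` tuples B n)" by (simp add: tspace_def)
    fix ts assume ts: "length ts = m" "set ts \<subseteq> pure_tensor B ` tuples B n"
    have "\<forall>l. \<exists>xs. l < m \<longrightarrow> xs \<in> tuples B n \<and> pure_tensor B xs = ts ! l"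
      using ts by (metis (no_types, lifting) imageE nth_mem subsetD)
    then obtain xs where xs: "\<And>l. l < m \<Longrightarrow> xs l \<in> tuples B n" "\<And>l. l < m \<Longrightarrow> pure_tensor B (xs l) = ts ! l"
      by metis
    \<comment> \<open>Entry \<open>i\<close> of the flat family is entry \<open>i mod n\<close> of
      block \<open>i div n\<close>.\<close>
    define v where "v i = xs (i div n) ! (i mod n)" for i
    have v: "v i \<in> carrier B" if "i < m * n" for i
    proof -
      have "n > 0" using that by (cases n) auto
      then show ?thesis
        unfolding v_def using that by (intro tuples_nth[OF xs(1)]) (auto simp: less_mult_imp_div_less)
    qed
    have "map v [l * n..<Suc l * n] = xs l" if "l < m" for l
      using tuples_length[OF xs(1)[OF that]] by (intro nth_equalityI) (auto simp: v_def)
    then have "map (block B n v) [0..<m] = ts"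
      using ts(1) xs(2) by (intro nth_equalityI) (auto simp: block_def)
    then show "L (pure_tensor ?T ts) = L' (pure_tensor ?T ts)" using eq[of v, OF v] by simp
  qed
qed

lemma tconcat_multilinear': "multilinear (tensor_power B n) m tscale (tconcat B n)"
  using tconcat_multilinear[of n m]
  by (subst multilinear_space_cong[where W = "tensor_algebra_power B n"]) simp_all

lemma flatten_linear: "linear_on (tensor_power (tensor_power B n) m) tscale (flatten B n m)"
  unfolding flatten_def linear_on_tensor_power by (rule tlift_linear'[OF tconcat_multilinear'])

lemma flatten_pure:
  assumes "\<And>i. i \<in> set is \<Longrightarrow> P i \<in> tuples B n" "length is = m"
  shows "flatten B n m (pure_tensor (tensor_power B n) (map (\<lambda>i. pure_tensor B (P i)) is)) =
    pure_tensor B (concat (map P is))"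
  unfolding flatten_def using assms tconcat_pure[of "is" P n]
  by (subst tlift_pure[OF vector_space_tscale tconcat_multilinear']) (auto intro!: tuples_map)

lemma flatten_blocks:
  assumes "\<And>i. i < m * n \<Longrightarrow> v i \<in> carrier B"
  shows "flatten B n m (pure_tensor (tensor_power B n) (map (block B n v) [0..<m])) =
    pure_tensor B (map v [0..<m * n])"
proof -
  have "i < m * n" if "l < m" "i < Suc l * n" for i l
  proof -
    have "Suc l * n \<le> m * n" using that(1) by (intro mult_le_mono1) simp
    then show ?thesis using that(2) by linarith
  qed
  then have "map v [l * n..<Suc l * n] \<in> tuples B n" if "l \<in> set [0..<m]" for l
    using assms that by (intro tuples_map) auto
  from flatten_pure[of "[0..<m]" "\<lambda>l. map v [l * n..<Suc l * n]" n m, OF this]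
  show ?thesis unfolding concat_map_blocks block_def by simp
qed

lemma flatten_closed: "t \<in> tspace (tensor_power B n) m \<Longrightarrow> flatten B n m t \<in> tspace B (m * n)"
  unfolding flatten_def
proof (erule tlift_closed[OF tconcat_multilinear', rotated])
  fix ts assume "ts \<in> tuples (tensor_power B n) m"
  then have "ts \<in> tuples (tensor_algebra_power B n) m" by (simp add: tuples_def)
  from tconcat_closed'[OF this] show "tconcat B n ts \<in> tspace B (m * n)" by (simp add: mult.commute)
qed

end

lemma UN_blocks: "(\<Union>l\<in>{0..<m}. {l * n..<Suc l * n}) = {0..<m * n::nat}"
proof (induction m)
  case (Suc m)
  have "{0..<Suc m} = insert m {0..<m}" by auto
  then have "(\<Union>l\<in>{0..<Suc m}. {l * n..<Suc l * n}) = {m * n..<Suc m * n} \<union> {0..<m * n}"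
    using Suc by simp
  also have "\<dots> = {0..<Suc m * n}" by auto
  finally show ?case .
qed simp

lemma block_index: "i \<in> {l * n..<Suc l * n} \<Longrightarrow> i div n = l" for i :: nat
proof -
  assume *: "i \<in> {l * n..<Suc l * n}"
  then have "n > 0" by (cases n) auto
  then show ?thesis using * by (intro div_nat_eqI) (auto simp: mult.commute)
qed

context bialgebra
begin

lemma counit_block:
  assumes "\<And>i. i < m * n \<Longrightarrow> v i \<in> carrier B" "l < m"
  shows "counit (tensor_power B n) (block B n v l) = (\<Prod>i\<in>{l * n..<Suc l * n}. counit B (v i))"
proof -
  have "Suc l * n \<le> m * n" using assms(2) by (intro mult_le_mono1) simp
  then show ?thesis
    unfolding block_def using assms(1) by (subst counit_pure_map) auto
qed

text \<open>The same \<open>m * n\<close> factors are split on both sides. A family of choices, one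
  in each block, is one choice on all factors, and flattening respects this identification.\<close>

lemma coalg_map_flatten:
  "coalg_map (tensor_power (tensor_power B n) m) (tensor_power B (m * n)) (flatten B n m)"
proof -
  define T where "T = tensor_power B n"
  define D where "D = tensor_power T m"
  define E where "E = tensor_power B (m * n)"
  interpret T: bialgebra T unfolding T_def by (rule bialgebra_tensor_power)
  interpret D: comul_space D unfolding D_def by (rule T.comul_space_tensor_power)
  interpret E: comul_space E unfolding E_def by (rule comul_space_tensor_power)
  let ?\<phi> = "flatten B n m"
  have lin: "linear_on D (scl E) ?\<phi>"
    using flatten_linear[of n m] by (simp add: D_def E_def T_def)
  have cl: "?\<phi> t \<in> carrier E" if "t \<in> carrier D" for t
    using flatten_closed[of t n m] that by (simp add: D_def E_def T_def)
  have eqD: "linear_on D = linear_on (tensor_algebra_power T m)"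
    by (simp add: D_def linear_on_tensor_power)
  let ?G = "tlift D 2 tscale (\<lambda>xs. pure_tensor E (map ?\<phi> xs))"
  have ml: "multilinear D 2 tscale (\<lambda>xs. pure_tensor E (map ?\<phi> xs))"
    by (rule multilinear_pure_map[OF lin cl])
  show ?thesis
    unfolding T_def[symmetric] D_def[symmetric] E_def[symmetric] coalg_map_def
  proof (intro conjI ballI lin cl)
    fix t assume t: "t \<in> carrier D"
    show "counit E (?\<phi> t) = counit D t"
    proof (rule tensor_power_power_ext[where n = n and m = m and sW = "(*)" and L = "\<lambda>t. counit E (?\<phi> t)"
          and L' = "counit D", folded T_def, folded eqD])
      show "t \<in> tspace T m" using t by (simp add: D_def)
      show "linear_on D (*) (\<lambda>t. counit E (?\<phi> t))"
        by (rule linear_on_compose[OF lin cl]) (use E.counit_linear' in \<open>simp_all add: Hom_k_def\<close>)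
      show "linear_on D (*) (counit D)" using D.counit_linear' by (simp add: Hom_k_def)
      fix v assume v: "\<And>i. i < m * n \<Longrightarrow> v i \<in> carrier B"
      have "counit D (pure_tensor T (map (block B n v) [0..<m])) = (\<Prod>l\<in>{0..<m}. \<Prod>i\<in>{l * n..<Suc l * n}. counit B (v i))"
        unfolding D_def using block_closed[OF v] counit_block[OF v]
        by (subst T.counit_pure_map) (auto simp: T_def)
      also have "\<dots> = (\<Prod>i\<in>(\<Union>l\<in>{0..<m}. {l * n..<Suc l * n}). counit B (v i))"
        using block_index[of _ _ n] by (intro prod.UNION_disjoint[symmetric]) blast+
      also have "\<dots> = counit E (?\<phi> (pure_tensor T (map (block B n v) [0..<m])))"
        unfolding UN_blocks using v flatten_blocks[of m n v, OF v] counit_pure_map[of "[0..<m * n]" "m * n" v]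
        by (simp add: T_def E_def)
      finally show "counit E (?\<phi> (pure_tensor T (map (block B n v) [0..<m]))) =
        counit D (pure_tensor T (map (block B n v) [0..<m]))" ..
    qed
    show "comul E (?\<phi> t) = ?G (comul D t)"
    proof (rule tensor_power_power_ext[where n = n and m = m and sW = tscale and L = "\<lambda>t. comul E (?\<phi> t)"
          and L' = "\<lambda>t. ?G (comul D t)", folded T_def, folded eqD])
      show "t \<in> tspace T m" using t by (simp add: D_def)
      show "linear_on D tscale (\<lambda>t. comul E (?\<phi> t))"
        by (rule linear_on_compose[OF lin cl E.comul_linear'])
      show "linear_on D tscale (\<lambda>t. ?G (comul D t))"
        by (rule linear_on_compose[of D "tensor_algebra_power D 2" "comul D" tscale ?G])
          (use D.comul_linear' D.comul_closed' tlift_linear'[OF ml] in auto)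
      fix v assume v: "\<And>i. i < m * n \<Longrightarrow> v i \<in> carrier B"
      let ?S = "\<lambda>l. set [l * n..<Suc l * n]"
      have v': "v i \<in> carrier B" if "i \<in> set [0..<m * n]" for i using v that by simp
      obtain k p q where r: "\<And>i. i \<in> set [0..<m * n] \<Longrightarrow> comul_rep B (v i) {..<k i::nat} (p i) (q i)"
        by (rule ex_comul_reps[of "set [0..<m * n]" v, OF v'], assumption, rule that)
      let ?A = "\<lambda>i. {..<k i}"
      have un: "(\<Union>l\<in>set [0..<m]. ?S l) = set [0..<m * n]"
        using UN_blocks[where m = m and n = n] by simp
      then have sub: "i \<in> set [0..<m * n]" if "l \<in> set [0..<m]" "i \<in> ?S l" for i l using that by blast
      have disj: "?S l \<inter> ?S l' = {}" if "l \<noteq> l'" for l l'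
        using that block_index[of _ l n] block_index[of _ l' n] unfolding set_upt by blast
      have R: "comul_rep D (pure_tensor T (map (block B n v) [0..<m])) (PiE (set [0..<m]) (\<lambda>l. PiE (?S l) ?A))
        (\<lambda>g. pure_tensor T (map (\<lambda>l. pure_tensor B (map (\<lambda>i. p i (g l i)) [l * n..<Suc l * n])) [0..<m]))
        (\<lambda>g. pure_tensor T (map (\<lambda>l. pure_tensor B (map (\<lambda>i. q i (g l i)) [l * n..<Suc l * n])) [0..<m]))"
        unfolding D_def
      proof (rule T.comul_rep_tensor_power)
        fix l assume l: "l \<in> set [0..<m]"
        then show "block B n v l \<in> carrier T" using block_closed[OF v] by (simp add: T_def)
        show "comul_rep T (block B n v l) (PiE (?S l) ?A)
          (\<lambda>g. pure_tensor B (map (\<lambda>i. p i (g i)) [l * n..<Suc l * n]))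
          (\<lambda>g. pure_tensor B (map (\<lambda>i. q i (g i)) [l * n..<Suc l * n]))"
          unfolding T_def block_def
          by (rule comul_rep_tensor_power) (use sub[OF l] v' r in \<open>auto simp del: set_upt\<close>)
      qed auto
      have R': "comul_rep E (pure_tensor B (map v [0..<m * n])) (PiE (set [0..<m * n]) ?A)
        (\<lambda>h. pure_tensor B (map (\<lambda>i. p i (h i)) [0..<m * n])) (\<lambda>h. pure_tensor B (map (\<lambda>i. q i (h i)) [0..<m * n]))"
        unfolding E_def by (rule comul_rep_tensor_power) (use v' r in auto)
      \<comment> \<open>Used with \<open>s\<close> the left and the right components: a flat choice
        \<open>h\<close>, cut into blocks and flattened again, gives back the flat tensor of its
        components.\<close>
      have fl: "?\<phi> (pure_tensor T (map (\<lambda>l. pure_tensor B (map (\<lambda>i. s i ((\<lambda>l\<in>set [0..<m]. restrict h (?S l)) l i)) [l * n..<Suc l * n])) [0..<m]))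
          = pure_tensor B (map (\<lambda>i. s i (h i)) [0..<m * n])"
        if h: "h \<in> PiE (set [0..<m * n]) ?A"
          and s: "\<And>i j. i \<in> set [0..<m * n] \<Longrightarrow> j \<in> ?A i \<Longrightarrow> s i j \<in> carrier B" for s h
      proof -
        have eq: "map (\<lambda>l. pure_tensor B (map (\<lambda>i. s i ((\<lambda>l\<in>set [0..<m]. restrict h (?S l)) l i)) [l * n..<Suc l * n])) [0..<m]
            = map (block B n (\<lambda>i. s i (h i))) [0..<m]"
          unfolding block_def by (intro map_cong refl arg_cong[where f = "pure_tensor B"]) auto
        have "s i (h i) \<in> carrier B" if "i < m * n" for i
          using s[of i, OF _ PiE_mem[OF h]] that by simp
        then show ?thesis unfolding eq T_def using flatten_blocks[of m n "\<lambda>i. s i (h i)"] by simp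
      qed
      have "?G (comul D (pure_tensor T (map (block B n v) [0..<m]))) =
          (\<Sum>g\<in>PiE (set [0..<m]) (\<lambda>l. PiE (?S l) ?A). pure_tensor E
          [?\<phi> (pure_tensor T (map (\<lambda>l. pure_tensor B (map (\<lambda>i. p i (g l i)) [l * n..<Suc l * n])) [0..<m])),
           ?\<phi> (pure_tensor T (map (\<lambda>l. pure_tensor B (map (\<lambda>i. q i (g l i)) [l * n..<Suc l * n])) [0..<m]))])"
        by (rule tlift_pure_map_rep[OF lin cl R])
      also have "\<dots> = (\<Sum>h\<in>PiE (set [0..<m * n]) ?A. pure_tensor E
          [pure_tensor B (map (\<lambda>i. p i (h i)) [0..<m * n]), pure_tensor B (map (\<lambda>i. q i (h i)) [0..<m * n])])"
        unfolding un[symmetric]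
      proof (subst sum_PiE_UN, rule disj, assumption, unfold un, rule sum.cong[OF refl])
        fix h assume h: "h \<in> PiE (set [0..<m * n]) ?A"
        show "pure_tensor E
          [?\<phi> (pure_tensor T (map (\<lambda>l. pure_tensor B (map (\<lambda>i. p i ((\<lambda>l\<in>set [0..<m]. restrict h (?S l)) l i)) [l * n..<Suc l * n])) [0..<m])),
           ?\<phi> (pure_tensor T (map (\<lambda>l. pure_tensor B (map (\<lambda>i. q i ((\<lambda>l\<in>set [0..<m]. restrict h (?S l)) l i)) [l * n..<Suc l * n])) [0..<m]))]
          = pure_tensor E [pure_tensor B (map (\<lambda>i. p i (h i)) [0..<m * n]), pure_tensor B (map (\<lambda>i. q i (h i)) [0..<m * n])]"
          using fl[OF h, of p] fl[OF h, of q] comul_repD(2,3)[OF r] by (simp only:)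
      qed
      also have "\<dots> = comul E (?\<phi> (pure_tensor T (map (block B n v) [0..<m])))"
        using comul_repD(4)[OF R'] flatten_blocks[of m n v, OF v] by (simp add: T_def)
      finally show "comul E (?\<phi> (pure_tensor T (map (block B n v) [0..<m]))) =
        ?G (comul D (pure_tensor T (map (block B n v) [0..<m])))" ..
    qed
  qed
qed

end

text \<open>
  A word in the factors of \<open>(B\<^bsup>\<otimes>n\<^esup>)\<^bsup>\<otimes>N\<^esup>\<close> is \<open>n\<close> words in the factors of \<open>B\<^bsup>\<otimes>Nn\<^esup>\<close>, the \<open>i\<close>-th factor of
  the \<open>l\<close>-th block having the index \<open>l * n + i\<close>.
\<close>

definition expand_words :: "nat \<Rightarrow> nat list list \<Rightarrow> nat list list"
  where "expand_words n ws = concat (map (\<lambda>w. map (\<lambda>i. map (\<lambda>l. l * n + i) w) [0..<n]) ws)"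

lemma length_expand_words: "length (expand_words n ws) = length ws * n"
  by (induction ws) (simp_all add: expand_words_def)

lemma set_concat_expand_words:
  "set (concat (expand_words n ws)) = (\<Union>l\<in>set (concat ws). {l * n..<Suc l * n})"
proof -
  have sing: "(\<Union>i\<in>{0..<n}. {l * n + i}) = {l * n..<Suc l * n}" for l
  proof (intro equalityI subsetI)
    fix j assume "j \<in> {l * n..<Suc l * n}"
    then have "j = l * n + (j - l * n)" "j - l * n < n" by auto
    then show "j \<in> (\<Union>i\<in>{0..<n}. {l * n + i})" by auto
  qed auto
  have word: "(\<Union>i\<in>{0..<n}. (\<lambda>l. l * n + i) ` A) = (\<Union>l\<in>A. {l * n..<Suc l * n})" for A
    unfolding sing[symmetric] by blast
  show ?thesis
  proof (induction ws)
    case (Cons w ws)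
    have "set (concat (expand_words n (w # ws))) =
        (\<Union>i\<in>{0..<n}. (\<lambda>l. l * n + i) ` set w) \<union> set (concat (expand_words n ws))"
      by (simp add: expand_words_def)
    then show ?case unfolding Cons word by simp
  qed (simp add: expand_words_def)
qed

text \<open>The indices with offset \<open>i\<close> are congruent to \<open>i\<close> modulo
  \<open>n\<close>, and the bound \<open>k \<le> n\<close> makes these residues different.\<close>

lemma distinct_concat_expand:
  assumes "distinct w" "k \<le> n"
  shows "distinct (concat (map (\<lambda>i. map (\<lambda>l. l * n + i) w) [0..<k]))"
  using assms(2)
proof (induction k)
  case (Suc k)
  have "l' * n + k \<noteq> l * n + i" if "i < k" for l l' i
  proof
    assume "l' * n + k = l * n + i"
    then have "(l * n + i) mod n = (l' * n + k) mod n" by simp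
    then show False using that Suc.prems by simp
  qed
  moreover have "distinct (map (\<lambda>l. l * n + k) w)"
    using assms(1) Suc.prems by (simp add: distinct_map inj_on_def)
  ultimately show ?case using Suc by (auto simp: image_iff)
qed simp

lemma disjoint_words_expand:
  assumes "disjoint_words N ws"
  shows "disjoint_words (N * n) (expand_words n ws)"
proof -
  have dist: "distinct (concat (expand_words n ws))" if "distinct (concat ws)" for ws
    using that
  proof (induction ws)
    case (Cons w ws)
    have s: "set (concat (map (\<lambda>i. map (\<lambda>l. l * n + i) w) [0..<n])) = (\<Union>l\<in>set w. {l * n..<Suc l * n})"
      using set_concat_expand_words[of n "[w]"] by (simp add: expand_words_def)
    have "(\<Union>l\<in>set w. {l * n..<Suc l * n}) \<inter> (\<Union>l\<in>set (concat ws). {l * n..<Suc l * n}) = {}"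
      using Cons.prems block_index[where n = n] unfolding concat.simps distinct_append by blast
    then have "set (concat (map (\<lambda>i. map (\<lambda>l. l * n + i) w) [0..<n])) \<inter> set (concat (expand_words n ws)) = {}"
      unfolding s set_concat_expand_words .
    then show ?case
      using Cons distinct_concat_expand[of w n n] unfolding expand_words_def by simp
  qed (simp add: expand_words_def)
  have "{l * n..<Suc l * n} \<subseteq> {..<N * n}" if "l < N" for l
  proof -
    have "Suc l * n \<le> N * n" using that by (intro mult_le_mono1) simp
    then show ?thesis by auto
  qed
  then show ?thesis
    using assms dist unfolding disjoint_words_def set_concat_expand_words by blast
qed

context bialgebra
begin

text \<open>Multiplication in \<open>B^n\<close> is componentwise, so a product of blocks consists
  of \<open>n\<close> products, each along the same word with a fixed offset.\<close>

lemma wprod_block: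
  assumes v: "\<And>i. i < N * n \<Longrightarrow> v i \<in> carrier B" and w: "set w \<subseteq> {..<N}"
  shows "wprod (tensor_power B n) (block B n v) w =
    pure_tensor B (map (\<lambda>i. wprod B v (map (\<lambda>l. l * n + i) w)) [0..<n])"
  using w
proof (induction w)
  case Nil
  show ?case by (simp add: map_replicate_const)
next
  case (Cons l w)
  have vc: "v (l * n + i) \<in> carrier B" if "l < N" "i < n" for l i
  proof (rule v)
    have "l * n + i < Suc l * n" using that by simp
    also have "\<dots> \<le> N * n" using that by (intro mult_le_mono1) simp
    finally show "l * n + i < N * n" .
  qed
  have "map v [l * n..<Suc l * n] = map (\<lambda>i. v (l * n + i)) [0..<n]"
    by (intro nth_equalityI) simp_all
  moreover have "map (\<lambda>i. v (l * n + i)) [0..<n] \<in> tuples B n"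
    using vc Cons.prems by (intro tuples_map) auto
  moreover have "map (\<lambda>i. wprod B v (map (\<lambda>l. l * n + i) w)) [0..<n] \<in> tuples B n"
    using vc Cons.prems by (intro tuples_map wprod_closed) auto
  ultimately show ?case
    using Cons by (simp add: block_def tmult_pure map2_map_map)
qed

text \<open>The bridge between the two levels: products, units and projections for the bialgebra
  \<open>B^n\<close> are carried out in each component, and an omitted block loses all of its
  \<open>n\<close> factors.\<close>

lemma flatten_wmap:
  assumes ws: "disjoint_words N ws" and t: "t \<in> tspace (tensor_power B n) N"
  shows "flatten B n (length ws) (wmap (tensor_power B n) N ws t) =
    wmap B (N * n) (expand_words n ws) (flatten B n N t)"
proof -
  define T where "T = tensor_power B n"
  interpret T: bialgebra T unfolding T_def by (rule bialgebra_tensor_power)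
  let ?M = "length ws" and ?U = "set (concat ws)"
  have U: "?U \<subseteq> {..<N}" using ws by (simp add: disjoint_words_def)
  note es = disjoint_words_expand[OF ws, of n]
  have l1: "linear_on (tensor_power T N) tscale (wmap T N ws)" by (rule T.wmap_linear[OF ws])
  have l2: "linear_on (tensor_power T ?M) tscale (flatten B n ?M)" and
    l3: "linear_on (tensor_power T N) tscale (flatten B n N)"
    unfolding T_def by (rule flatten_linear)+
  have l4: "linear_on (tensor_power B (N * n)) tscale (wmap B (N * n) (expand_words n ws))"
    by (rule wmap_linear[OF es])
  have cl: "wmap T N ws t \<in> tspace T ?M" if "t \<in> tspace T N" for t
    using coalg_mapD(2)[OF T.coalg_map_wmap[OF ws], of t] that by simp
  have t': "t \<in> tspace T N" using t by (simp add: T_def)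
  have "flatten B n ?M (wmap T N ws t) = wmap B (N * n) (expand_words n ws) (flatten B n N t)"
  proof (rule tensor_power_power_ext[where n = n and m = N and sW = tscale
        and L = "\<lambda>t. flatten B n ?M (wmap T N ws t)"
        and L' = "\<lambda>t. wmap B (N * n) (expand_words n ws) (flatten B n N t)", folded T_def, OF _ _ _ t'])
    show "linear_on (tensor_algebra_power T N) tscale (\<lambda>t. flatten B n ?M (wmap T N ws t))"
      unfolding linear_on_tensor_power[symmetric]
      by (rule linear_on_compose[of _ "tensor_power T ?M" "wmap T N ws"]) (use l1 l2 cl in simp_all)
    show "linear_on (tensor_algebra_power T N) tscale (\<lambda>t. wmap B (N * n) (expand_words n ws) (flatten B n N t))"
      unfolding linear_on_tensor_power[symmetric]
      by (rule linear_on_compose[of _ "tensor_power B (N * n)" "flatten B n N"])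
        (use l3 l4 flatten_closed[of _ n N] in \<open>simp_all add: T_def\<close>)
    fix v assume v: "\<And>i. i < N * n \<Longrightarrow> v i \<in> carrier B"
    let ?t = "pure_tensor T (map (block B n v) [0..<N])"
    have bl: "block B n v l \<in> carrier T" if "l < N" for l
      using block_closed[of N n v l] v that by (simp add: T_def)
    let ?P = "\<lambda>w. map (\<lambda>i. wprod B v (map (\<lambda>l. l * n + i) w)) [0..<n]"
    have vc: "v (l * n + i) \<in> carrier B" if "l < N" "i < n" for l i
    proof (rule v)
      have "l * n + i < Suc l * n" using that by simp
      also have "\<dots> \<le> N * n" using that by (intro mult_le_mono1) simp
      finally show "l * n + i < N * n" .
    qed
    have P: "?P w \<in> tuples B n" if "w \<in> set ws" for w
      using vc that U by (intro tuples_map wprod_closed) auto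
    have eqP: "map (wprod T (block B n v)) ws = map (\<lambda>w. pure_tensor B (?P w)) ws"
      unfolding T_def using U v by (intro map_cong refl wprod_block[of N]) auto
    have "wmap T N ws ?t = tscale (\<Prod>l\<in>{..<N} - ?U. counit T (block B n v l))
        (pure_tensor T (map (\<lambda>w. pure_tensor B (?P w)) ws))"
      using T.wmap_pure[of N ws "block B n v", OF ws bl] unfolding eqP by simp
    then have "flatten B n ?M (wmap T N ws ?t) = tscale (\<Prod>l\<in>{..<N} - ?U. counit T (block B n v l))
        (flatten B n ?M (pure_tensor T (map (\<lambda>w. pure_tensor B (?P w)) ws)))"
      using linear_on_scale[OF l2, of "pure_tensor T (map (\<lambda>w. pure_tensor B (?P w)) ws)"] P
      by (simp add: T_def tuples_map)
    also have "flatten B n ?M (pure_tensor T (map (\<lambda>w. pure_tensor B (?P w)) ws)) =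
        pure_tensor B (map (wprod B v) (expand_words n ws))"
      unfolding T_def using flatten_pure[of ws ?P n ?M] P
      by (simp add: expand_words_def map_concat comp_def)
    also have "(\<Prod>l\<in>{..<N} - ?U. counit T (block B n v l)) =
        (\<Prod>l\<in>{..<N} - ?U. \<Prod>i\<in>{l * n..<Suc l * n}. counit B (v i))"
      unfolding T_def using counit_block[of N n v] v by (intro prod.cong) auto
    also have "\<dots> = (\<Prod>i\<in>(\<Union>l\<in>{..<N} - ?U. {l * n..<Suc l * n}). counit B (v i))"
      using block_index[where n = n] by (intro prod.UNION_disjoint[symmetric]) blast+
    also have "(\<Union>l\<in>{..<N} - ?U. {l * n..<Suc l * n}) = {..<N * n} - set (concat (expand_words n ws))"
    proof -
      have "(\<Union>l\<in>{..<N} - ?U. {l * n..<Suc l * n}) =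
          (\<Union>l\<in>{..<N}. {l * n..<Suc l * n}) - (\<Union>l\<in>?U. {l * n..<Suc l * n})"
        by (rule UN_Diff_disjoint[OF U]) (use block_index[where n = n] in blast)
      then show ?thesis
        unfolding set_concat_expand_words using UN_blocks[where m = N and n = n]
        by (simp add: atLeast0LessThan)
    qed
    also have "tscale (\<Prod>i\<in>{..<N * n} - set (concat (expand_words n ws)). counit B (v i))
        (pure_tensor B (map (wprod B v) (expand_words n ws))) =
        wmap B (N * n) (expand_words n ws) (pure_tensor B (map v [0..<N * n]))"
      using wmap_pure[of "N * n" _ v, OF es v] by simp
    also have "pure_tensor B (map v [0..<N * n]) = flatten B n N ?t"
      using flatten_blocks[of N n v] v by (simp add: T_def)
    finally show "flatten B n ?M (wmap T N ws ?t) = wmap B (N * n) (expand_words n ws) (flatten B n N ?t)" .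
  qed
  then show ?thesis by (simp add: T_def)
qed

text \<open>For two blocks \<open>flatten\<close> differs from \<open>regroup\<close> by a
  concatenation with the empty tensor, which is neutral.\<close>

lemma regroup_eq_flatten:
  assumes t: "t \<in> tspace (tensor_power B n) 2"
  shows "regroup B n t = flatten B n 2 t"
proof -
  let ?T = "tensor_power B n"
  have bil: "multilinear ?T 2 tscale (\<lambda>ts. tcat B n n (ts ! 0) (ts ! 1))"
    unfolding bilinear_on_def[symmetric]
    using tcat_linear_left[of _ n n] tcat_linear_right[of _ n n]
    by (intro bilinear_onI) (simp_all add: linear_on_tensor_power)
  show ?thesis
    unfolding regroup_def flatten_def
  proof (rule tlift_cong[OF vector_space_tscale bil tconcat_multilinear' _ t])
    fix ts assume "ts \<in> tuples ?T 2"
    then obtain s t where ts: "ts = [s, t]" "s \<in> tspace B n" "t \<in> tspace B n" by (auto elim: tuples_2E)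
    have id: "linear_on (tensor_algebra_power B n) tscale (\<lambda>t. t)" by (simp add: linear_on_def)
    have "tcat B n 0 t (pure_tensor B []) = t"
      by (rule linear_on_tspace_ext[OF tcat_linear_left id _ ts(3)]) (simp_all add: tcat_pure)
    then show "tcat B n n (ts ! 0) (ts ! 1) = tconcat B n ts" by (simp add: ts)
  qed
qed

end

section \<open>Legs in the convolution monoid\<close>

lemma concat_singletons [simp]: "concat (map (\<lambda>i. [f i]) is) = map f is"
  by (induction "is") auto

lemma disjoint_words_singletons [simp]:
  "disjoint_words N (map (\<lambda>i. [i]) is) \<longleftrightarrow> distinct is \<and> set is \<subseteq> {..<N}"
  by (simp add: disjoint_words_def)

lemma compose_singletons:
  "set is \<subseteq> {..<length ws} \<Longrightarrow> compose_words ws (map (\<lambda>i. [i]) is) = map ((!) ws) is"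
  by (simp add: compose_words_def)

context bialgebra
begin

definition wpull :: "nat \<Rightarrow> nat list list \<Rightarrow> (('a, 'k) tens \<Rightarrow> 'k) \<Rightarrow> ('a, 'k) tens \<Rightarrow> 'k"
  where "wpull N ws = pullback (tensor_power B N) (wmap B N ws)"

text \<open>The leg as an element of the convolution monoid: positions are numbered from
  \<open>0\<close>, and values outside the carrier are normalised.\<close>

definition cleg :: "nat \<Rightarrow> nat list \<Rightarrow> (('a, 'k) tens \<Rightarrow> 'k) \<Rightarrow> ('a, 'k) tens \<Rightarrow> 'k"
  where "cleg N is = wpull N (map (\<lambda>i. [i]) is)"

lemma wpull_hom: "disjoint_words N ws \<Longrightarrow>
    wpull N ws \<in> hom (conv_monoid (tensor_power B (length ws))) (conv_monoid (tensor_power B N))"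
  unfolding wpull_def
  by (rule comul_space.pullback_hom[OF comul_space_tensor_power coalg_map_wmap])

lemma wpull_one: "disjoint_words N ws \<Longrightarrow>
    wpull N ws \<one>\<^bsub>conv_monoid (tensor_power B (length ws))\<^esub> = \<one>\<^bsub>conv_monoid (tensor_power B N)\<^esub>"
  unfolding wpull_def by (rule pullback_one[OF coalg_map_wmap])

lemma wmap_closed: "disjoint_words N ws \<Longrightarrow> t \<in> tspace B N \<Longrightarrow> wmap B N ws t \<in> tspace B (length ws)"
  using coalg_mapD(2)[OF coalg_map_wmap, of N ws t] by simp

lemma wpull_closed:
  assumes "disjoint_words N ws" "f \<in> Hom_k (tensor_power B (length ws))"
  shows "wpull N ws f \<in> carrier (conv_monoid (tensor_power B N))"
  unfolding wpull_def pullback_def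
  by (rule comul_space.restrict_closed[OF comul_space_tensor_power coalg_map_Hom_k[OF coalg_map_wmap]])
    (use assms in auto)

lemma cleg_closed:
  assumes "distinct is" "set is \<subseteq> {..<N}" "f \<in> Hom_k (tensor_power B (length is))"
  shows "cleg N is f \<in> carrier (conv_monoid (tensor_power B N))"
  unfolding cleg_def using assms by (intro wpull_closed) auto

lemma wpull_wpull:
  assumes "disjoint_words N ws" "disjoint_words (length ws) vs"
  shows "wpull N ws (wpull (length ws) vs f) = wpull N (compose_words ws vs) f"
  unfolding wpull_def pullback_def
  by (rule restrict_ext) (simp add: wmap_closed[OF assms(1)] wmap_compose[OF assms])

lemma wpull_cong:
  assumes "disjoint_words N ws" "\<And>t. t \<in> tspace B (length ws) \<Longrightarrow> f t = f' t"
  shows "wpull N ws f = wpull N ws f'"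
  unfolding wpull_def pullback_def
  by (rule restrict_ext) (simp add: wmap_closed[OF assms(1)] assms(2))

text \<open>A leg is composition with the word map of one-letter words, since both apply the counit
  to the remaining factors. \<open>Suc\<close> translates positions to the numbering from
  \<open>1\<close>.\<close>

lemma leg_eq_wmap:
  assumes "is": "distinct is" "set is \<subseteq> {..<N}" and f: "f \<in> Hom_k (tensor_power B (length is))"
    and t: "t \<in> tspace B N"
  shows "leg B N (map Suc is) f t = f (wmap B N (map (\<lambda>i. [i]) is) t)"
proof -
  let ?ws = "map (\<lambda>i. [i]) is"
  let ?L = "\<lambda>t. f (wmap B N ?ws t)"
  have ws: "disjoint_words N ?ws" using "is" by simp
  have lin: "linear_on (tensor_algebra_power B N) (*) ?L"
    using linear_on_compose[of "tensor_power B N" "tensor_power B (length is)" "wmap B N ?ws" "(*)" f]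
      wmap_linear[OF ws] wmap_closed[OF ws] f by (simp add: Hom_k_def linear_on_tensor_power)
  let ?F = "\<lambda>hs. f (pure_tensor B (map (\<lambda>i. hs ! (i - 1)) (map Suc is))) *
    (\<Prod>j\<in>{1..N} - set (map Suc is). counit B (hs ! (j - 1)))"
  have eq: "?L (pure_tensor B hs) = ?F hs" if hs: "hs \<in> tuples B N" for hs
  proof -
    have v: "hs ! i \<in> carrier B" if "i < N" for i by (rule tuples_nth[OF hs that])
    have tup: "map ((!) hs) is \<in> tuples B (length is)"
      using "is" v by (intro tuples_map) auto
    have "{1..N} - Suc ` set is = Suc ` ({..<N} - set is)"
      by (simp add: image_set_diff image_Suc_lessThan)
    then have "(\<Prod>j\<in>{1..N} - set (map Suc is). counit B (hs ! (j - 1))) = (\<Prod>j\<in>{..<N} - set is. counit B (hs ! j))"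
      by (simp add: prod.reindex)
    moreover have words: "map (wprod B ((!) hs)) ?ws = map ((!) hs) is"
      using "is" v by (auto simp: subset_iff)
    moreover have "f (tscale c (pure_tensor B (map ((!) hs) is))) = c * f (pure_tensor B (map ((!) hs) is))" for c
      using linear_on_scale[of "tensor_power B (length is)" "(*)" f] f tup by (simp add: Hom_k_def)
    ultimately show ?thesis
      using wmap_pure[of N ?ws "(!) hs", OF ws v, unfolded words] pure_tensor_nth_map[OF hs]
      by (simp add: comp_def mult.commute)
  qed
  have ml: "multilinear B N (*) ?F"
    by (rule multilinear_cong[OF multilinear_pure_compose[OF lin] eq kvec_axioms])
  show ?thesis
    unfolding leg_def
    by (rule linear_on_tspace_ext[OF tlift_linear[OF vector_space_field ml] lin _ t])
      (simp only: tlift_pure[OF vector_space_field ml] eq)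
qed

lemma leg_Hom_k:
  assumes "is": "distinct is" "set is \<subseteq> {..<N}" and f: "f \<in> Hom_k (tensor_power B (length is))"
  shows "leg B N (map Suc is) f \<in> Hom_k (tensor_power B N)"
proof (rule comul_space.Hom_k_cong[OF comul_space_tensor_power])
  show "f \<circ> wmap B N (map (\<lambda>i. [i]) is) \<in> Hom_k (tensor_power B N)"
    by (rule coalg_map_Hom_k[OF coalg_map_wmap]) (use assms in simp_all)
  show "\<And>t. t \<in> carrier (tensor_power B N) \<Longrightarrow> (f \<circ> wmap B N (map (\<lambda>i. [i]) is)) t = leg B N (map Suc is) f t"
    using leg_eq_wmap[OF assms] by simp
qed

lemma restrict_leg:
  assumes "distinct is" "set is \<subseteq> {..<N}" "f \<in> Hom_k (tensor_power B (length is))"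
  shows "restrict (leg B N (map Suc is) f) (carrier (tensor_power B N)) = cleg N is f"
  unfolding cleg_def wpull_def pullback_def
  by (rule restrict_ext) (simp add: leg_eq_wmap[OF assms])

lemma wpull_cleg:
  assumes "disjoint_words N ws" "distinct is" "set is \<subseteq> {..<length ws}"
  shows "wpull N ws (cleg (length ws) is f) = wpull N (map ((!) ws) is) f"
  using wpull_wpull[OF assms(1), of "map (\<lambda>i. [i]) is" f] assms
  by (simp add: cleg_def compose_singletons)

end

section \<open>Commutation of legs\<close>

lemma sum_PiE_4:
  "(\<Sum>g\<in>PiE {0..<4::nat} A. F (g 0) (g 1) (g 2) (g 3)) =
    (\<Sum>i\<in>A 0. \<Sum>j\<in>A 1. \<Sum>k\<in>A 2. \<Sum>l\<in>A 3. F i j k l)"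
proof -
  have *: "{0..<4::nat} = insert 0 (insert 1 (insert 2 (insert 3 {})))" by auto
  show ?thesis unfolding * by (simp add: sum_PiE_insert)
qed

lemma sum_product_pairs:
  fixes F G :: "'i \<Rightarrow> 'i \<Rightarrow> 'k::semiring_0"
  shows "(\<Sum>i\<in>A. \<Sum>j\<in>B. \<Sum>k\<in>C. \<Sum>l\<in>D. F i j * G k l) = (\<Sum>i\<in>A. \<Sum>j\<in>B. F i j) * (\<Sum>k\<in>C. \<Sum>l\<in>D. G k l)"
  by (simp only: sum_distrib_left[symmetric] sum_distrib_right[symmetric])

lemma lessThan_numerals: "{..<3::nat} = {0, 1, 2}" "{..<4::nat} = {0, 1, 2, 3}"
  by auto

context bialgebra
begin

lemma conv_monoid_tensor_power_ext:
  assumes "F \<in> carrier (conv_monoid (tensor_power B N))" "G \<in> carrier (conv_monoid (tensor_power B N))"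
    and "\<And>v. (\<And>i. i < N \<Longrightarrow> v i \<in> carrier B) \<Longrightarrow>
      F (pure_tensor B (map v [0..<N])) = G (pure_tensor B (map v [0..<N]))"
  shows "F = G"
proof (rule extensionalityI[where A = "tspace B N"])
  show "F \<in> extensional (tspace B N)" "G \<in> extensional (tspace B N)"
    using assms(1,2) by (simp_all add: conv_monoid_simps)
  fix t assume t: "t \<in> tspace B N"
  show "F t = G t"
  proof (rule linear_on_tspace_ext[OF _ _ _ t])
    show "linear_on (tensor_algebra_power B N) (*) F" "linear_on (tensor_algebra_power B N) (*) G"
      using assms(1,2) by (simp_all add: conv_monoid_simps Hom_k_def linear_on_tensor_power)
    fix xs assume xs: "xs \<in> tuples B N"
    show "F (pure_tensor B xs) = G (pure_tensor B xs)"
      unfolding pure_tensor_nth_map[OF xs] by (rule assms(3)) (rule tuples_nth[OF xs])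
  qed
qed

lemma conv_monoid_mult_pure:
  assumes "F \<in> carrier (conv_monoid (tensor_power B N))" "G \<in> carrier (conv_monoid (tensor_power B N))"
    and v: "\<And>i. i < N \<Longrightarrow> v i \<in> carrier B"
    and r: "\<And>i. i < N \<Longrightarrow> comul_rep B (v i) (A i) (p i) (q i)"
  shows "(F \<otimes>\<^bsub>conv_monoid (tensor_power B N)\<^esub> G) (pure_tensor B (map v [0..<N])) =
    (\<Sum>g\<in>PiE {0..<N} A. F (pure_tensor B (map (\<lambda>i. p i (g i)) [0..<N])) *
      G (pure_tensor B (map (\<lambda>i. q i (g i)) [0..<N])))"
proof -
  have t: "pure_tensor B (map v [0..<N]) \<in> tspace B N" using v by (intro pure_tensor_closed tuples_map) auto
  have "comul_rep (tensor_power B N) (pure_tensor B (map v [0..<N])) (PiE (set [0..<N]) A)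
      (\<lambda>g. pure_tensor B (map (\<lambda>i. p i (g i)) [0..<N])) (\<lambda>g. pure_tensor B (map (\<lambda>i. q i (g i)) [0..<N]))"
    by (rule comul_rep_tensor_power) (use v r in auto)
  then have "comul_rep (tensor_power B N) (pure_tensor B (map v [0..<N])) (PiE {0..<N} A)
      (\<lambda>g. pure_tensor B (map (\<lambda>i. p i (g i)) [0..<N])) (\<lambda>g. pure_tensor B (map (\<lambda>i. q i (g i)) [0..<N]))"
    by simp
  from conv_rep[OF _ _ this, of F G] assms(1,2) show ?thesis
    using t by (simp add: conv_monoid_simps)
qed

lemma wpull_pure:
  assumes ws: "disjoint_words N ws" and f: "f \<in> Hom_k (tensor_power B (length ws))"
    and v: "\<And>i. i < N \<Longrightarrow> v i \<in> carrier B"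
  shows "wpull N ws f (pure_tensor B (map v [0..<N])) =
    (\<Prod>j\<in>{..<N} - set (concat ws). counit B (v j)) * f (pure_tensor B (map (wprod B v) ws))"
proof -
  have t: "pure_tensor B (map v [0..<N]) \<in> tspace B N" using v by (intro pure_tensor_closed tuples_map) auto
  have "f (tscale c (pure_tensor B (map (wprod B v) ws))) = c * f (pure_tensor B (map (wprod B v) ws))" for c
    using linear_on_scale[of "tensor_power B (length ws)" "(*)" f] f wprod_tuple[of N ws v, OF ws v]
    by (simp add: Hom_k_def)
  then show ?thesis
    using t wmap_pure[of N ws v, OF ws v] by (simp add: wpull_def pullback_def)
qed

lemma cleg_pure:
  assumes "distinct is" "set is \<subseteq> {..<N}" "f \<in> Hom_k (tensor_power B (length is))"
    and v: "\<And>i. i < N \<Longrightarrow> v i \<in> carrier B"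
  shows "cleg N is f (pure_tensor B (map v [0..<N])) =
    (\<Prod>j\<in>{..<N} - set is. counit B (v j)) * f (pure_tensor B (map v is))"
proof -
  have eq: "map (wprod B v) (map (\<lambda>i. [i]) is) = map v is"
    using assms(2) v by (auto simp: subset_iff)
  show ?thesis
    using wpull_pure[of N "map (\<lambda>i. [i]) is" f v, unfolded eq] assms by (simp add: cleg_def)
qed

lemma linear_on_Hom_pair:
  assumes "f \<in> Hom_k (tensor_power B 2)"
  shows "y \<in> carrier B \<Longrightarrow> linear_on B (*) (\<lambda>x. f (pure_tensor B [x, y]))"
    and "x \<in> carrier B \<Longrightarrow> linear_on B (*) (\<lambda>y. f (pure_tensor B [x, y]))"
  using linear_on_compose[of B "tensor_power B 2" "\<lambda>x. pure_tensor B [x, y]" "(*)" f]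
    linear_on_compose[of B "tensor_power B 2" "\<lambda>y. pure_tensor B [x, y]" "(*)" f]
    linear_on_pure_pair assms
  by (simp_all add: Hom_k_def)

lemma counit_linear_rep:
  assumes L: "linear_on B (*) L" and x: "x \<in> carrier B" and r: "comul_rep B x A p q"
  shows "(\<Sum>k\<in>A. counit B (p k) * L (q k)) = L x" "(\<Sum>k\<in>A. counit B (q k) * L (p k)) = L x"
  using linear_on_comb[OF L, of A q "\<lambda>k. counit B (p k)"] linear_on_comb[OF L, of A p "\<lambda>k. counit B (q k)"]
    counit_rep[OF x r] comul_repD(2,3)[OF r] by simp_all

text \<open>On a pure tensor both products equal f(v0, v1) g(v2, v3): each leg puts counits on the
  factors of the other, and these contract the Sweedler sums there.\<close>

lemma cleg_commute_4:
  assumes f: "f \<in> Hom_k (tensor_power B 2)" and g: "g \<in> Hom_k (tensor_power B 2)"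
  defines "M \<equiv> conv_monoid (tensor_power B 4)"
  shows "cleg 4 [0, 1] f \<otimes>\<^bsub>M\<^esub> cleg 4 [2, 3] g = cleg 4 [2, 3] g \<otimes>\<^bsub>M\<^esub> cleg 4 [0, 1] f"
proof -
  interpret T: bialgebra "tensor_power B 4" by (rule bialgebra_tensor_power)
  interpret M: monoid M unfolding M_def by (rule T.monoid_conv_monoid)
  have F: "cleg 4 [0, 1] f \<in> carrier M" and G: "cleg 4 [2, 3] g \<in> carrier M"
    unfolding M_def using f g by (auto intro!: cleg_closed simp: numeral_2_eq_2)
  show ?thesis
  proof (rule conv_monoid_tensor_power_ext[where N = 4, folded M_def])
    fix v :: "nat \<Rightarrow> 'a" assume v: "\<And>i. i < 4 \<Longrightarrow> v i \<in> carrier B"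
    have v': "v i \<in> carrier B" if "i \<in> {..<4}" for i using v that by simp
    obtain m p q where r: "\<And>i. i \<in> {..<4} \<Longrightarrow> comul_rep B (v i) {..<m i::nat} (p i) (q i)"
      by (rule ex_comul_reps[of "{..<4}" v, OF v'], assumption, rule that)
    have r': "comul_rep B (v i) {..<m i} (p i) (q i)" if "i < 4" for i using r that by simp
    have pq: "p i k \<in> carrier B" "q i k \<in> carrier B" if "i < 4" "k < m i" for i k
      using comul_repD(2,3)[OF r'] that by auto
    have Fp: "cleg 4 [0, 1] f (pure_tensor B (map w [0..<4])) = counit B (w 2) * counit B (w 3) * f (pure_tensor B [w 0, w 1])"
      and Gp: "cleg 4 [2, 3] g (pure_tensor B (map w [0..<4])) = counit B (w 0) * counit B (w 1) * g (pure_tensor B [w 2, w 3])"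
      if "\<And>i. i < 4 \<Longrightarrow> w i \<in> carrier B" for w
    proof -
      have "{..<4} - {0, 1::nat} = {2, 3}" "{..<4} - {2, 3::nat} = {0, 1}" by auto
      then show "cleg 4 [0, 1] f (pure_tensor B (map w [0..<4])) = counit B (w 2) * counit B (w 3) * f (pure_tensor B [w 0, w 1])"
        "cleg 4 [2, 3] g (pure_tensor B (map w [0..<4])) = counit B (w 0) * counit B (w 1) * g (pure_tensor B [w 2, w 3])"
        using cleg_pure[of "[0, 1]" 4 f w] cleg_pure[of "[2, 3]" 4 g w] f g that
        by (simp_all add: numeral_2_eq_2[symmetric])
    qed
    have mult_pure: "(F \<otimes>\<^bsub>M\<^esub> G) (pure_tensor B (map v [0..<4])) = (\<Sum>g\<in>PiE {0..<4} (\<lambda>i. {..<m i}).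
        F (pure_tensor B (map (\<lambda>i. p i (g i)) [0..<4])) * G (pure_tensor B (map (\<lambda>i. q i (g i)) [0..<4])))"
      if "F \<in> carrier M" "G \<in> carrier M" for F G
      unfolding M_def by (rule conv_monoid_mult_pure) (use that v r' in \<open>auto simp: M_def\<close>)
    have mem: "p i (e i) \<in> carrier B" "q i (e i) \<in> carrier B" if "e \<in> PiE {0..<4} (\<lambda>i. {..<m i})" "i < 4" for e i
      using pq[of i "e i"] PiE_mem[OF that(1), of i] that(2) by auto
    \<comment> \<open>Contractions in two factors at once, for either choice of the component that
      receives the counits.\<close>
    have S1: "(\<Sum>i<m 0. \<Sum>j<m 1. counit B (q 0 i) * counit B (q 1 j) * f (pure_tensor B [p 0 i, p 1 j])) = f (pure_tensor B [v 0, v 1])"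
      "(\<Sum>i<m 0. \<Sum>j<m 1. counit B (p 0 i) * counit B (p 1 j) * f (pure_tensor B [q 0 i, q 1 j])) = f (pure_tensor B [v 0, v 1])"
      "(\<Sum>k<m 2. \<Sum>l<m 3. counit B (q 2 k) * counit B (q 3 l) * g (pure_tensor B [p 2 k, p 3 l])) = g (pure_tensor B [v 2, v 3])"
      "(\<Sum>k<m 2. \<Sum>l<m 3. counit B (p 2 k) * counit B (p 3 l) * g (pure_tensor B [q 2 k, q 3 l])) = g (pure_tensor B [v 2, v 3])"
      using pq v counit_linear_rep[OF linear_on_Hom_pair(2)[OF f] v r', of _ 1]
        counit_linear_rep[OF linear_on_Hom_pair(1)[OF f] v r', of _ 0]
        counit_linear_rep[OF linear_on_Hom_pair(2)[OF g] v r', of _ 3]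
        counit_linear_rep[OF linear_on_Hom_pair(1)[OF g] v r', of _ 2]
      by (simp_all add: mult.assoc sum_distrib_left[symmetric])
    have "(cleg 4 [0, 1] f \<otimes>\<^bsub>M\<^esub> cleg 4 [2, 3] g) (pure_tensor B (map v [0..<4])) =
      (\<Sum>e\<in>PiE {0..<4} (\<lambda>i. {..<m i}). counit B (p 2 (e 2)) * counit B (p 3 (e 3)) * f (pure_tensor B [p 0 (e 0), p 1 (e 1)]) *
        (counit B (q 0 (e 0)) * counit B (q 1 (e 1)) * g (pure_tensor B [q 2 (e 2), q 3 (e 3)])))"
      unfolding mult_pure[OF F G]
      by (intro sum.cong refl) (simp only: Fp Gp mem)
    also have "\<dots> = f (pure_tensor B [v 0, v 1]) * g (pure_tensor B [v 2, v 3])"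
      unfolding sum_PiE_4[of "\<lambda>i j k l. counit B (p 2 k) * counit B (p 3 l) * f (pure_tensor B [p 0 i, p 1 j]) *
        (counit B (q 0 i) * counit B (q 1 j) * g (pure_tensor B [q 2 k, q 3 l]))"]
        S1(1,4)[symmetric] sum_product_pairs[symmetric]
      by (intro sum.cong refl) (simp only: mult_ac)
    finally have L: "(cleg 4 [0, 1] f \<otimes>\<^bsub>M\<^esub> cleg 4 [2, 3] g) (pure_tensor B (map v [0..<4])) =
      f (pure_tensor B [v 0, v 1]) * g (pure_tensor B [v 2, v 3])" .
    have "(cleg 4 [2, 3] g \<otimes>\<^bsub>M\<^esub> cleg 4 [0, 1] f) (pure_tensor B (map v [0..<4])) =
      (\<Sum>e\<in>PiE {0..<4} (\<lambda>i. {..<m i}). counit B (p 0 (e 0)) * counit B (p 1 (e 1)) * g (pure_tensor B [p 2 (e 2), p 3 (e 3)]) *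
        (counit B (q 2 (e 2)) * counit B (q 3 (e 3)) * f (pure_tensor B [q 0 (e 0), q 1 (e 1)])))"
      unfolding mult_pure[OF G F]
      by (intro sum.cong refl) (simp only: Fp Gp mem)
    also have "\<dots> = f (pure_tensor B [v 0, v 1]) * g (pure_tensor B [v 2, v 3])"
      unfolding sum_PiE_4[of "\<lambda>i j k l. counit B (p 0 i) * counit B (p 1 j) * g (pure_tensor B [p 2 k, p 3 l]) *
        (counit B (q 2 k) * counit B (q 3 l) * f (pure_tensor B [q 0 i, q 1 j]))"]
        S1(2,3)[symmetric] sum_product_pairs[symmetric]
      by (intro sum.cong refl) (simp only: mult_ac)
    finally show "(cleg 4 [0, 1] f \<otimes>\<^bsub>M\<^esub> cleg 4 [2, 3] g) (pure_tensor B (map v [0..<4])) =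
      (cleg 4 [2, 3] g \<otimes>\<^bsub>M\<^esub> cleg 4 [0, 1] f) (pure_tensor B (map v [0..<4]))"
      using L by simp
  qed (use F G in auto)
qed

text \<open>Both products come from \<open>B^4\<close>, pulled back along the projection of
  \<open>B^N\<close> to the four factors involved.\<close>

lemma cleg_commute:
  assumes "distinct [i, j, k, l]" "{i, j, k, l} \<subseteq> {..<N}"
    and f: "f \<in> Hom_k (tensor_power B 2)" and g: "g \<in> Hom_k (tensor_power B 2)"
  defines "M \<equiv> conv_monoid (tensor_power B N)"
  shows "cleg N [i, j] f \<otimes>\<^bsub>M\<^esub> cleg N [k, l] g = cleg N [k, l] g \<otimes>\<^bsub>M\<^esub> cleg N [i, j] f"
proof -
  let ?ws = "[[i], [j], [k], [l]]"
  have ws: "disjoint_words N ?ws" using assms(1,2) by (auto simp: disjoint_words_def)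
  have len: "length ?ws = 4" by simp
  note h = wpull_hom[OF ws, unfolded len, folded M_def]
  have F: "cleg 4 [0, 1] f \<in> carrier (conv_monoid (tensor_power B 4))"
    and G: "cleg 4 [2, 3] g \<in> carrier (conv_monoid (tensor_power B 4))"
    using f g by (auto intro!: cleg_closed simp: numeral_2_eq_2)
  have "wpull N ?ws (cleg 4 [0, 1] f) = cleg N [i, j] f" "wpull N ?ws (cleg 4 [2, 3] g) = cleg N [k, l] g"
    using wpull_cleg[OF ws, of "[0, 1]" f, unfolded len] wpull_cleg[OF ws, of "[2, 3]" g, unfolded len] by (simp_all add: cleg_def)
  then show ?thesis
    using hom_mult[OF h F G] hom_mult[OF h G F] cleg_commute_4[OF f g] by simp
qed

end

section \<open>Quasi-commutativity in the convolution monoid\<close>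

context co_quasi_triangular
begin

lemma R_cocommutes_rep:
  assumes x: "x \<in> carrier B" "comul_rep B x A p q" and y: "y \<in> carrier B" "comul_rep B y A' p' q'"
  shows "(\<Sum>k\<in>A. \<Sum>l\<in>A'. scl B (R (pure_tensor B [p k, p' l])) (q k \<otimes> q' l)) =
    (\<Sum>k\<in>A. \<Sum>l\<in>A'. scl B (R (pure_tensor B [q k, q' l])) (p' l \<otimes> p k))"
proof -
  note pq = comul_repD(2,3)[OF x(2)] and pq' = comul_repD(2,3)[OF y(2)]
  have lp: "a \<in> carrier B \<Longrightarrow> linear_on B (*) (\<lambda>z. R (pure_tensor B [z, a]))"
    "a \<in> carrier B \<Longrightarrow> linear_on B (*) (\<lambda>z. R (pure_tensor B [a, z]))" for a
    using linear_on_Hom_pair[OF R_linear] by auto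
  have b1: "bilinear_on B (scl B) (\<lambda>b1 b2. scl B (R (pure_tensor B [a1, b1])) (a2 \<otimes> b2))"
    "bilinear_on B (scl B) (\<lambda>b1 b2. scl B (R (pure_tensor B [a2, b2])) (b1 \<otimes> a1))"
    if "a1 \<in> carrier B" "a2 \<in> carrier B" for a1 a2
    using that lp
    by (auto intro!: bilinear_onI linear_on_scale_fun[OF vector_space_axioms]
        linear_on_scale_by[OF vector_space_axioms] kmult_left kmult_right)
  have b2: "bilinear_on B (scl B) (\<lambda>a1 a2. \<Sum>l\<in>A'. scl B (R (pure_tensor B [a1, p' l])) (a2 \<otimes> q' l))"
    "bilinear_on B (scl B) (\<lambda>a1 a2. \<Sum>l\<in>A'. scl B (R (pure_tensor B [a2, q' l])) (p' l \<otimes> a1))"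
    using lp pq'
    by (auto intro!: bilinear_onI linear_on_sum_fun[OF vector_space_axioms] linear_on_scale_fun[OF vector_space_axioms]
        linear_on_scale_by[OF vector_space_axioms] kmult_left kmult_right)
  note s = sweedler_rep[OF vector_space_axioms b1(1) y(2)] sweedler_rep[OF vector_space_axioms b1(2) y(2)]
  have cong: "bilinear_on B (scl B) F" if "bilinear_on B (scl B) G"
    "\<And>a b. a \<in> carrier B \<Longrightarrow> b \<in> carrier B \<Longrightarrow> G a b = F a b" for F G
    unfolding bilinear_on_def
  proof (rule multilinear_cong[OF that(1)[unfolded bilinear_on_def] _ kvec_axioms])
    fix xs assume "xs \<in> tuples B 2"
    then obtain a b where "xs = [a, b]" "a \<in> carrier B" "b \<in> carrier B" by (rule tuples_2E)
    then show "G (xs ! 0) (xs ! 1) = F (xs ! 0) (xs ! 1)" using that(2) by simp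
  qed
  \<comment> \<open>On the carrier the inner Sweedler expressions are the finite sums of
    \<open>b2\<close>, from which they inherit bilinearity.\<close>
  have b3: "bilinear_on B (scl B) (\<lambda>a1 a2. sweedler B (scl B) (\<lambda>b1 b2. scl B (R (pure_tensor B [a1, b1])) (a2 \<otimes> b2)) y)"
    "bilinear_on B (scl B) (\<lambda>a1 a2. sweedler B (scl B) (\<lambda>b1 b2. scl B (R (pure_tensor B [a2, b2])) (b1 \<otimes> a1)) y)"
    by (rule cong[OF b2(1)], simp only: s, rule cong[OF b2(2)], simp only: s)
  show ?thesis
    using R_cocommutes[OF x(1) y(1)] pq
    unfolding sweedler_rep[OF vector_space_axioms b3(1) x(2)] sweedler_rep[OF vector_space_axioms b3(2) x(2)]
    by (simp add: s)
qed

text \<open>This is the quasi-commutativity of \<open>R\<close> after applying \<open>g\<close> with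
  a fixed second argument. The third factor is seen by \<open>g\<close> alone, and the counit in the
  leg of \<open>R\<close> contracts its Sweedler sum.\<close>

lemma cleg_wpull_swap:
  assumes g: "g \<in> Hom_k (tensor_power B 2)"
  defines "M \<equiv> conv_monoid (tensor_power B 3)"
  shows "cleg 3 [0, 1] R \<otimes>\<^bsub>M\<^esub> wpull 3 [[0, 1], [2]] g = wpull 3 [[1, 0], [2]] g \<otimes>\<^bsub>M\<^esub> cleg 3 [0, 1] R"
proof -
  interpret T: bialgebra "tensor_power B 3" by (rule bialgebra_tensor_power)
  interpret M: monoid M unfolding M_def by (rule T.monoid_conv_monoid)
  have w1: "disjoint_words 3 [[0, 1], [2]]" and w2: "disjoint_words 3 [[1, 0], [2]]"
    by (auto simp: disjoint_words_def)
  have F: "cleg 3 [0, 1] R \<in> carrier M" and G: "wpull 3 [[0, 1], [2]] g \<in> carrier M"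
    and G': "wpull 3 [[1, 0], [2]] g \<in> carrier M"
    unfolding M_def using R_linear g w1 w2 by (auto intro!: cleg_closed wpull_closed simp: numeral_2_eq_2)
  show ?thesis
  proof (rule conv_monoid_tensor_power_ext[where N = 3, folded M_def])
    fix v :: "nat \<Rightarrow> 'a" assume v: "\<And>i. i < 3 \<Longrightarrow> v i \<in> carrier B"
    have v': "v i \<in> carrier B" if "i \<in> {..<3}" for i using v that by simp
    obtain m p q where r: "\<And>i. i \<in> {..<3} \<Longrightarrow> comul_rep B (v i) {..<m i::nat} (p i) (q i)"
      by (rule ex_comul_reps[of "{..<3}" v, OF v'], assumption, rule that)
    have r': "comul_rep B (v i) {..<m i} (p i) (q i)" if "i < 3" for i using r that by simp
    have pq: "p i k \<in> carrier B" "q i k \<in> carrier B" if "i < 3" "k < m i" for i k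
      using comul_repD(2,3)[OF r'] that by auto
    have Fp: "cleg 3 [0, 1] R (pure_tensor B (map w [0..<3])) = counit B (w 2) * R (pure_tensor B [w 0, w 1])"
      and Gp: "wpull 3 [[0, 1], [2]] g (pure_tensor B (map w [0..<3])) = g (pure_tensor B [w 0 \<otimes> w 1, w 2])"
      and Gp': "wpull 3 [[1, 0], [2]] g (pure_tensor B (map w [0..<3])) = g (pure_tensor B [w 1 \<otimes> w 0, w 2])"
      if "\<And>i. i < 3 \<Longrightarrow> w i \<in> carrier B" for w
    proof -
      have "{..<3} - {0, 1::nat} = {2}" by auto
      moreover have "(\<Prod>j\<in>{..<3} - {0, 1, 2}. counit B (w j)) = 1" "(\<Prod>j\<in>{..<3} - {1, 0, 2}. counit B (w j)) = 1"
        by (simp_all add: lessThan_numerals)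
      ultimately show "cleg 3 [0, 1] R (pure_tensor B (map w [0..<3])) = counit B (w 2) * R (pure_tensor B [w 0, w 1])"
        "wpull 3 [[0, 1], [2]] g (pure_tensor B (map w [0..<3])) = g (pure_tensor B [w 0 \<otimes> w 1, w 2])"
        "wpull 3 [[1, 0], [2]] g (pure_tensor B (map w [0..<3])) = g (pure_tensor B [w 1 \<otimes> w 0, w 2])"
        using cleg_pure[of "[0, 1]" 3 R w] wpull_pure[OF w1, of g w] wpull_pure[OF w2, of g w] R_linear g that
        by (simp_all add: numeral_2_eq_2[symmetric])
    qed
    have mult_pure: "(F \<otimes>\<^bsub>M\<^esub> G) (pure_tensor B (map v [0..<3])) = (\<Sum>g\<in>PiE {0..<3} (\<lambda>i. {..<m i}).
        F (pure_tensor B (map (\<lambda>i. p i (g i)) [0..<3])) * G (pure_tensor B (map (\<lambda>i. q i (g i)) [0..<3])))"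
      if "F \<in> carrier M" "G \<in> carrier M" for F G
      unfolding M_def by (rule conv_monoid_mult_pure) (use that v r' in \<open>auto simp: M_def\<close>)
    have mem: "p i (e i) \<in> carrier B" "q i (e i) \<in> carrier B" if "e \<in> PiE {0..<3} (\<lambda>i. {..<m i})" "i < 3" for e i
      using pq[of i "e i"] PiE_mem[OF that(1), of i] that(2) by auto
    \<comment> \<open>The linear form that is applied to the identity between elements of
      \<open>B\<close>.\<close>
    let ?L = "\<lambda>y. g (pure_tensor B [y, v 2])"
    have L: "linear_on B (*) ?L" using linear_on_Hom_pair(1)[OF g] v by simp
    have L_sum: "?L (\<Sum>i<m 0. \<Sum>j<m 1. scl B (c i j) (y i j)) = (\<Sum>i<m 0. \<Sum>j<m 1. c i j * ?L (y i j))"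
      if "\<And>i j. i < m 0 \<Longrightarrow> j < m 1 \<Longrightarrow> y i j \<in> carrier B" for c :: "nat \<Rightarrow> nat \<Rightarrow> 'k" and y
    proof -
      have "?L (\<Sum>i<m 0. \<Sum>j<m 1. scl B (c i j) (y i j)) = (\<Sum>i<m 0. ?L (\<Sum>j<m 1. scl B (c i j) (y i j)))"
        using that by (intro linear_on_sum[OF L] sum_closed scl_closed) auto
      also have "\<dots> = (\<Sum>i<m 0. \<Sum>j<m 1. c i j * ?L (y i j))"
        using that by (intro sum.cong refl linear_on_comb[OF L]) auto
      finally show ?thesis .
    qed
    have e3: "(\<Sum>g\<in>PiE {0..<3::nat} A. F (g 0) (g 1) (g 2)) = (\<Sum>i\<in>A 0. \<Sum>j\<in>A 1. \<Sum>k\<in>A 2. F i j k)"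
      for A :: "nat \<Rightarrow> nat set" and F :: "nat \<Rightarrow> nat \<Rightarrow> nat \<Rightarrow> 'k"
      using sum_PiE_3[where F = F and A = A] by (simp add: atLeast0LessThan)
    have "(cleg 3 [0, 1] R \<otimes>\<^bsub>M\<^esub> wpull 3 [[0, 1], [2]] g) (pure_tensor B (map v [0..<3])) =
      (\<Sum>e\<in>PiE {0..<3} (\<lambda>i. {..<m i}). counit B (p 2 (e 2)) * R (pure_tensor B [p 0 (e 0), p 1 (e 1)]) *
        g (pure_tensor B [q 0 (e 0) \<otimes> q 1 (e 1), q 2 (e 2)]))"
      unfolding mult_pure[OF F G]
      by (intro sum.cong refl) (simp only: Fp Gp mem)
    also have "\<dots> = (\<Sum>i<m 0. \<Sum>j<m 1. \<Sum>k<m 2. counit B (p 2 k) * R (pure_tensor B [p 0 i, p 1 j]) *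
        g (pure_tensor B [q 0 i \<otimes> q 1 j, q 2 k]))"
      by (rule e3)
    also have "\<dots> = (\<Sum>i<m 0. \<Sum>j<m 1. R (pure_tensor B [p 0 i, p 1 j]) * ?L (q 0 i \<otimes> q 1 j))"
    proof (intro sum.cong refl)
      fix i j assume "i \<in> {..<m 0}" "j \<in> {..<m 1}"
      then have "q 0 i \<otimes> q 1 j \<in> carrier B" using pq by simp
      then have c: "(\<Sum>k<m 2. counit B (p 2 k) * g (pure_tensor B [q 0 i \<otimes> q 1 j, q 2 k])) = ?L (q 0 i \<otimes> q 1 j)"
        by (intro counit_linear_rep(1)[OF linear_on_Hom_pair(2)[OF g] v r']) simp_all
      show "(\<Sum>k<m 2. counit B (p 2 k) * R (pure_tensor B [p 0 i, p 1 j]) * g (pure_tensor B [q 0 i \<otimes> q 1 j, q 2 k]))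
          = R (pure_tensor B [p 0 i, p 1 j]) * ?L (q 0 i \<otimes> q 1 j)"
        unfolding c[symmetric] sum_distrib_left by (intro sum.cong refl) (simp only: mult_ac)
    qed
    also have "\<dots> = ?L (\<Sum>i<m 0. \<Sum>j<m 1. scl B (R (pure_tensor B [p 0 i, p 1 j])) (q 0 i \<otimes> q 1 j))"
      using pq by (intro L_sum[symmetric]) simp
    also have "\<dots> = ?L (\<Sum>i<m 0. \<Sum>j<m 1. scl B (R (pure_tensor B [q 0 i, q 1 j])) (p 1 j \<otimes> p 0 i))"
      using R_cocommutes_rep[OF v r' v r', of 0 1] by simp
    also have "\<dots> = (\<Sum>i<m 0. \<Sum>j<m 1. R (pure_tensor B [q 0 i, q 1 j]) * ?L (p 1 j \<otimes> p 0 i))"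
      using pq by (intro L_sum) simp
    also have "\<dots> = (\<Sum>i<m 0. \<Sum>j<m 1. \<Sum>k<m 2. g (pure_tensor B [p 1 j \<otimes> p 0 i, p 2 k]) *
        (counit B (q 2 k) * R (pure_tensor B [q 0 i, q 1 j])))"
    proof (intro sum.cong refl)
      fix i j assume "i \<in> {..<m 0}" "j \<in> {..<m 1}"
      then have "p 1 j \<otimes> p 0 i \<in> carrier B" using pq by simp
      then have c: "(\<Sum>k<m 2. counit B (q 2 k) * g (pure_tensor B [p 1 j \<otimes> p 0 i, p 2 k])) = ?L (p 1 j \<otimes> p 0 i)"
        by (intro counit_linear_rep(2)[OF linear_on_Hom_pair(2)[OF g] v r']) simp_all
      show "R (pure_tensor B [q 0 i, q 1 j]) * ?L (p 1 j \<otimes> p 0 i) =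
        (\<Sum>k<m 2. g (pure_tensor B [p 1 j \<otimes> p 0 i, p 2 k]) * (counit B (q 2 k) * R (pure_tensor B [q 0 i, q 1 j])))"
        unfolding c[symmetric] sum_distrib_left by (intro sum.cong refl) (simp only: mult_ac)
    qed
    also have "\<dots> = (\<Sum>e\<in>PiE {0..<3} (\<lambda>i. {..<m i}). g (pure_tensor B [p 1 (e 1) \<otimes> p 0 (e 0), p 2 (e 2)]) *
        (counit B (q 2 (e 2)) * R (pure_tensor B [q 0 (e 0), q 1 (e 1)])))"
      by (rule e3[symmetric])
    also have "\<dots> = (wpull 3 [[1, 0], [2]] g \<otimes>\<^bsub>M\<^esub> cleg 3 [0, 1] R) (pure_tensor B (map v [0..<3]))"
      unfolding mult_pure[OF G' F]
      by (intro sum.cong refl) (simp only: Fp Gp' mem)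
    finally show "(cleg 3 [0, 1] R \<otimes>\<^bsub>M\<^esub> wpull 3 [[0, 1], [2]] g) (pure_tensor B (map v [0..<3])) =
      (wpull 3 [[1, 0], [2]] g \<otimes>\<^bsub>M\<^esub> cleg 3 [0, 1] R) (pure_tensor B (map v [0..<3]))" .
  qed (use F G G' in auto)
qed

end

section \<open>Multiplicativity and unit conditions for legs\<close>

context bialgebra
begin

lemma mult_id_eq_wmap:
  assumes t: "t \<in> tspace B 3"
  shows "mult_id B t = wmap B 3 [[0, 1], [2]] t"
proof -
  have ws: "disjoint_words 3 [[0, 1], [2]]" by (auto simp: disjoint_words_def)
  have eq: "wmap_tuple B 3 [[0, 1], [2]] xs = pure_tensor B [xs ! 0 \<otimes> xs ! 1, xs ! 2]" if "xs \<in> tuples B 3" for xs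
    using that by (auto elim!: tuples_3E simp: wmap_tuple_def lessThan_numerals)
  have ml: "multilinear B 3 tscale (\<lambda>xs. pure_tensor B [xs ! 0 \<otimes> xs ! 1, xs ! 2])"
    by (rule multilinear_cong[OF wmap_tuple_multilinear[OF ws] eq kvec_axioms])
  show ?thesis
    unfolding mult_id_def wmap_def
    by (rule tlift_cong[OF vector_space_tscale ml wmap_tuple_multilinear[OF ws] _ t]) (simp only: eq)
qed

lemma id_mult_eq_wmap:
  assumes t: "t \<in> tspace B 3"
  shows "id_mult B t = wmap B 3 [[0], [1, 2]] t"
proof -
  have ws: "disjoint_words 3 [[0], [1, 2]]" by (auto simp: disjoint_words_def)
  have eq: "wmap_tuple B 3 [[0], [1, 2]] xs = pure_tensor B [xs ! 0, xs ! 1 \<otimes> xs ! 2]" if "xs \<in> tuples B 3" for xs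
    using that by (auto elim!: tuples_3E simp: wmap_tuple_def lessThan_numerals)
  have ml: "multilinear B 3 tscale (\<lambda>xs. pure_tensor B [xs ! 0, xs ! 1 \<otimes> xs ! 2])"
    by (rule multilinear_cong[OF wmap_tuple_multilinear[OF ws] eq kvec_axioms])
  show ?thesis
    unfolding id_mult_def wmap_def
    by (rule tlift_cong[OF vector_space_tscale ml wmap_tuple_multilinear[OF ws] _ t]) (simp only: eq)
qed

lemma monoid_conv_tensor_power: "monoid (conv_monoid (tensor_power B N))"
  by (rule bialgebra.monoid_conv_monoid[OF bialgebra_tensor_power])

lemma cleg_pair_closed:
  "i \<noteq> j \<Longrightarrow> i < N \<Longrightarrow> j < N \<Longrightarrow> f \<in> Hom_k (tensor_power B 2) \<Longrightarrow>
    cleg N [i, j] f \<in> carrier (conv_monoid (tensor_power B N))"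
  by (rule cleg_closed) (simp_all add: numeral_2_eq_2)

lemma wpull_cleg_pair:
  assumes "disjoint_words N ws" "length ws = M" "i \<noteq> j" "i < M" "j < M"
  shows "wpull N ws (cleg M [i, j] f) = wpull N [ws ! i, ws ! j] f"
  using wpull_cleg[OF assms(1), of "[i, j]" f] assms by simp

end

context co_quasi_triangular
begin

text \<open>The axiom gives the case of three factors, and the general case is its pullback along
  the projection to the factors \<open>i\<close>, \<open>j\<close>, \<open>k\<close>.\<close>

lemma wpull_mult_left:
  assumes d: "distinct [i, j, k]" "{i, j, k} \<subseteq> {..<N}"
  shows "wpull N [[i, j], [k]] R =
    cleg N [i, k] R \<otimes>\<^bsub>conv_monoid (tensor_power B N)\<^esub> cleg N [j, k] R"
proof -
  let ?M = "conv_monoid (tensor_power B 3)" and ?ws = "[[i], [j], [k]]"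
  interpret T: bialgebra "tensor_power B 3" by (rule bialgebra_tensor_power)
  have w: "disjoint_words 3 [[0, 1], [2]]" by (auto simp: disjoint_words_def)
  have ws: "disjoint_words N ?ws" and len: "length ?ws = 3" using d by (auto simp: disjoint_words_def)
  have l1: "leg B 3 [1, 3] R \<in> Hom_k (tensor_power B 3)" "leg B 3 [2, 3] R \<in> Hom_k (tensor_power B 3)"
    using leg_Hom_k[of "[0, 2]" 3 R] leg_Hom_k[of "[1, 2]" 3 R] R_linear by (simp_all add: numeral_2_eq_2 numeral_3_eq_3)
  have l2: "restrict (leg B 3 [1, 3] R) (carrier (tensor_power B 3)) = cleg 3 [0, 2] R"
    "restrict (leg B 3 [2, 3] R) (carrier (tensor_power B 3)) = cleg 3 [1, 2] R"
    using restrict_leg[of "[0, 2]" 3 R] restrict_leg[of "[1, 2]" 3 R] R_linear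
    by (simp_all add: numeral_2_eq_2 numeral_3_eq_3 del: restrict_apply)
  have "wpull 3 [[0, 1], [2]] R = restrict (conv (tensor_power B 3) (leg B 3 [1, 3] R) (leg B 3 [2, 3] R)) (carrier (tensor_power B 3))"
    unfolding wpull_def pullback_def
  proof (rule restrict_ext)
    fix t assume "t \<in> carrier (tensor_power B 3)"
    then have t: "t \<in> tspace B 3" by simp
    show "(R \<circ> wmap B 3 [[0, 1], [2]]) t = conv (tensor_power B 3) (leg B 3 [1, 3] R) (leg B 3 [2, 3] R) t"
      unfolding comp_def mult_id_eq_wmap[OF t, symmetric] by (rule R_mult_id[OF t])
  qed
  also have "\<dots> = cleg 3 [0, 2] R \<otimes>\<^bsub>?M\<^esub> cleg 3 [1, 2] R"
    unfolding T.conv_restrict[OF l1, symmetric] l2 ..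
  finally have *: "wpull 3 [[0, 1], [2]] R = cleg 3 [0, 2] R \<otimes>\<^bsub>?M\<^esub> cleg 3 [1, 2] R" .
  have cl: "cleg 3 [0, 2] R \<in> carrier ?M" "cleg 3 [1, 2] R \<in> carrier ?M"
    using R_linear by (auto intro: cleg_pair_closed)
  have "wpull N [[i, j], [k]] R = wpull N ?ws (wpull 3 [[0, 1], [2]] R)"
    using wpull_wpull[OF ws, of "[[0, 1], [2]]" R, unfolded len, OF w] by (simp add: compose_words_def)
  also have "\<dots> = wpull N ?ws (cleg 3 [0, 2] R) \<otimes>\<^bsub>conv_monoid (tensor_power B N)\<^esub> wpull N ?ws (cleg 3 [1, 2] R)"
    unfolding * using hom_mult[OF wpull_hom[OF ws, unfolded len] cl] .
  finally show ?thesis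
    using wpull_cleg_pair[OF ws len, of 0 2 R] wpull_cleg_pair[OF ws len, of 1 2 R] by (simp add: cleg_def)
qed

lemma wpull_mult_right_3:
  "wpull 3 [[0], [1, 2]] R = cleg 3 [0, 2] R \<otimes>\<^bsub>conv_monoid (tensor_power B 3)\<^esub> cleg 3 [0, 1] R"
proof -
  interpret T: bialgebra "tensor_power B 3" by (rule bialgebra_tensor_power)
  have l1: "leg B 3 [1, 3] R \<in> Hom_k (tensor_power B 3)" "leg B 3 [1, 2] R \<in> Hom_k (tensor_power B 3)"
    using leg_Hom_k[of "[0, 2]" 3 R] leg_Hom_k[of "[0, 1]" 3 R] R_linear by (simp_all add: numeral_2_eq_2 numeral_3_eq_3)
  have l2: "restrict (leg B 3 [1, 3] R) (carrier (tensor_power B 3)) = cleg 3 [0, 2] R"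
    "restrict (leg B 3 [1, 2] R) (carrier (tensor_power B 3)) = cleg 3 [0, 1] R"
    using restrict_leg[of "[0, 2]" 3 R] restrict_leg[of "[0, 1]" 3 R] R_linear
    by (simp_all add: numeral_2_eq_2 numeral_3_eq_3 del: restrict_apply)
  have "wpull 3 [[0], [1, 2]] R = restrict (conv (tensor_power B 3) (leg B 3 [1, 3] R) (leg B 3 [1, 2] R)) (carrier (tensor_power B 3))"
    unfolding wpull_def pullback_def
  proof (rule restrict_ext)
    fix t assume "t \<in> carrier (tensor_power B 3)"
    then have t: "t \<in> tspace B 3" by simp
    show "(R \<circ> wmap B 3 [[0], [1, 2]]) t = conv (tensor_power B 3) (leg B 3 [1, 3] R) (leg B 3 [1, 2] R) t"
      unfolding comp_def id_mult_eq_wmap[OF t, symmetric] by (rule R_id_mult[OF t])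
  qed
  also have "\<dots> = cleg 3 [0, 2] R \<otimes>\<^bsub>conv_monoid (tensor_power B 3)\<^esub> cleg 3 [0, 1] R"
    unfolding T.conv_restrict[OF l1, symmetric] l2 ..
  finally show ?thesis .
qed

lemma wpull_mult_right:
  assumes d: "distinct [i, j, k]" "{i, j, k} \<subseteq> {..<N}"
  shows "wpull N [[i], [j, k]] R =
    cleg N [i, k] R \<otimes>\<^bsub>conv_monoid (tensor_power B N)\<^esub> cleg N [i, j] R"
proof -
  let ?ws = "[[i], [j], [k]]"
  have w: "disjoint_words 3 [[0], [1, 2]]" by (auto simp: disjoint_words_def)
  have ws: "disjoint_words N ?ws" and len: "length ?ws = 3" using d by (auto simp: disjoint_words_def)
  have cl: "cleg 3 [0, 2] R \<in> carrier (conv_monoid (tensor_power B 3))" "cleg 3 [0, 1] R \<in> carrier (conv_monoid (tensor_power B 3))"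
    using R_linear by (auto intro: cleg_pair_closed)
  have "wpull N [[i], [j, k]] R = wpull N ?ws (wpull 3 [[0], [1, 2]] R)"
    using wpull_wpull[OF ws, of "[[0], [1, 2]]" R, unfolded len, OF w] by (simp add: compose_words_def)
  also have "\<dots> = wpull N ?ws (cleg 3 [0, 2] R) \<otimes>\<^bsub>conv_monoid (tensor_power B N)\<^esub> wpull N ?ws (cleg 3 [0, 1] R)"
    unfolding wpull_mult_right_3 using hom_mult[OF wpull_hom[OF ws, unfolded len] cl] .
  finally show ?thesis
    using wpull_cleg_pair[OF ws len, of 0 2 R] wpull_cleg_pair[OF ws len, of 0 1 R] by (simp add: cleg_def)
qed

lemma cleg_swap_left:
  assumes d: "distinct [i, j, k]" "{i, j, k} \<subseteq> {..<N}" and g: "g \<in> Hom_k (tensor_power B 2)"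
  defines "M \<equiv> conv_monoid (tensor_power B N)"
  shows "cleg N [i, j] R \<otimes>\<^bsub>M\<^esub> wpull N [[i, j], [k]] g = wpull N [[j, i], [k]] g \<otimes>\<^bsub>M\<^esub> cleg N [i, j] R"
proof -
  let ?M = "conv_monoid (tensor_power B 3)" and ?ws = "[[i], [j], [k]]"
  have w: "disjoint_words 3 [[0, 1], [2]]" "disjoint_words 3 [[1, 0], [2]]" by (auto simp: disjoint_words_def)
  have ws: "disjoint_words N ?ws" and len: "length ?ws = 3" using d by (auto simp: disjoint_words_def)
  note h = hom_mult[OF wpull_hom[OF ws, unfolded len, folded M_def]]
  have cl: "cleg 3 [0, 1] R \<in> carrier ?M" using R_linear by (auto intro: cleg_pair_closed)
  have cg: "wpull 3 [[0, 1], [2]] g \<in> carrier ?M" "wpull 3 [[1, 0], [2]] g \<in> carrier ?M"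
    using w g by (auto intro!: wpull_closed simp: numeral_2_eq_2)
  have "wpull N ?ws (wpull 3 [[0, 1], [2]] g) = wpull N [[i, j], [k]] g"
    "wpull N ?ws (wpull 3 [[1, 0], [2]] g) = wpull N [[j, i], [k]] g"
    using wpull_wpull[OF ws, of "[[0, 1], [2]]" g, unfolded len, OF w(1)]
      wpull_wpull[OF ws, of "[[1, 0], [2]]" g, unfolded len, OF w(2)] by (simp_all add: compose_words_def)
  moreover have "wpull N ?ws (cleg 3 [0, 1] R) = cleg N [i, j] R"
    using wpull_cleg_pair[OF ws len, of 0 1 R] by (simp add: cleg_def)
  ultimately show ?thesis
    using h[OF cl cg(1)] h[OF cg(2) cl] cleg_wpull_swap[OF g] by simp
qed

text \<open>The left version is applied to \<open>g\<close> with its arguments exchanged, which is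
  the pullback of \<open>g\<close> along the word map \<open>[[1], [0]]\<close>.\<close>

lemma cleg_swap_right:
  assumes d: "distinct [i, j, k]" "{i, j, k} \<subseteq> {..<N}" and g: "g \<in> Hom_k (tensor_power B 2)"
  defines "M \<equiv> conv_monoid (tensor_power B N)"
  shows "cleg N [i, j] R \<otimes>\<^bsub>M\<^esub> wpull N [[k], [i, j]] g = wpull N [[k], [j, i]] g \<otimes>\<^bsub>M\<^esub> cleg N [i, j] R"
proof -
  have w: "disjoint_words 2 [[1], [0]]" by (auto simp: disjoint_words_def)
  have g': "wpull 2 [[1], [0]] g \<in> Hom_k (tensor_power B 2)"
    using wpull_closed[OF w, of g] g by (simp add: conv_monoid_simps numeral_2_eq_2)
  have "disjoint_words N [[i, j], [k]]" "disjoint_words N [[j, i], [k]]" using d by (auto simp: disjoint_words_def)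
  then have "wpull N [[i, j], [k]] (wpull 2 [[1], [0]] g) = wpull N [[k], [i, j]] g"
    "wpull N [[j, i], [k]] (wpull 2 [[1], [0]] g) = wpull N [[k], [j, i]] g"
    using wpull_wpull[of N "[[i, j], [k]]" "[[1], [0]]" g] wpull_wpull[of N "[[j, i], [k]]" "[[1], [0]]" g] w
    by (simp_all add: compose_words_def numeral_2_eq_2)
  then show ?thesis
    using cleg_swap_left[OF d g'] unfolding M_def by simp
qed

text \<open>\<open>R(a, 1\<cdot>1) = R(a\<^sub>(\<^sub>1\<^sub>), 1) R(a\<^sub>(\<^sub>2\<^sub>), 1)\<close> makes \<open>R(-, 1)\<close> idempotent.\<close>

lemma wpull_unit_right: "i < N \<Longrightarrow> wpull N [[i], []] R = \<one>\<^bsub>conv_monoid (tensor_power B N)\<^esub>"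
  and wpull_unit_left: "i < N \<Longrightarrow> wpull N [[], [i]] R = \<one>\<^bsub>conv_monoid (tensor_power B N)\<^esub>"
proof -
  let ?M1 = "conv_monoid (tensor_power B 1)"
  interpret M1: monoid ?M1 by (rule monoid_conv_tensor_power)
  interpret T: bialgebra "tensor_power B 2" by (rule bialgebra_tensor_power)
  have RU: "restrict R (carrier (tensor_power B 2)) \<in> Units (conv_monoid (tensor_power B 2))"
    using T.conv_invertible_iff[OF R_linear] R_invertible by simp
  have cl3: "cleg 3 [0, 1] R \<in> carrier (conv_monoid (tensor_power B 3))"
    "cleg 3 [0, 2] R \<in> carrier (conv_monoid (tensor_power B 3))"
    "cleg 3 [1, 2] R \<in> carrier (conv_monoid (tensor_power B 3))"
    using R_linear by (auto intro: cleg_pair_closed)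
  have unit: "e = \<one>\<^bsub>?M1\<^esub>" if "e \<in> Units ?M1" "e \<otimes>\<^bsub>?M1\<^esub> e = e" for e
    using that M1.Units_l_cancel[OF that(1) M1.Units_closed[OF that(1)] M1.one_closed]
      M1.r_one[OF M1.Units_closed[OF that(1)]] by metis
  \<comment> \<open>Word maps are coalgebra maps, so invertibility of \<open>R\<close> passes to its
    pullbacks along them.\<close>
  have U: "wpull 1 ws R \<in> Units ?M1" if "disjoint_words 1 ws" "length ws = 2" for ws
  proof -
    have "wpull 1 ws R = wpull 1 ws (restrict R (carrier (tensor_power B 2)))"
      using that by (intro wpull_cong) auto
    then show ?thesis
      using comul_space.pullback_Units[OF comul_space_tensor_power coalg_map_wmap[OF that(1), unfolded that(2)] RU]
      by (simp add: wpull_def)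
  qed
  have ws: "disjoint_words 1 [[0], [], []]" "disjoint_words 1 [[], [], [0]]"
    and w1: "disjoint_words 1 [[0], []]" "disjoint_words 1 [[], [0]]"
    and w3: "disjoint_words 3 [[0], [1, 2]]" "disjoint_words 3 [[0, 1], [2]]"
    by (auto simp: disjoint_words_def)
  have len: "length [[0], [], []] = 3" "length [[], [], [0::nat]] = 3" by simp_all
  have e1: "wpull 1 [[0], []] R = \<one>\<^bsub>?M1\<^esub>"
  proof (rule unit[OF U])
    \<comment> \<open>The empty words insert units, and the product of two inserted units is again
      the unit.\<close>
    have "wpull 1 [[0], []] R = wpull 1 [[0], [], []] (wpull 3 [[0], [1, 2]] R)"
      using wpull_wpull[OF ws(1), of "[[0], [1, 2]]" R] w3 by (simp add: compose_words_def numeral_3_eq_3)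
    also have "\<dots> = wpull 1 [[0], [], []] (cleg 3 [0, 2] R) \<otimes>\<^bsub>?M1\<^esub> wpull 1 [[0], [], []] (cleg 3 [0, 1] R)"
      unfolding wpull_mult_right_3 using hom_mult[OF wpull_hom[OF ws(1), unfolded len] cl3(2,1)] .
    finally show "wpull 1 [[0], []] R \<otimes>\<^bsub>?M1\<^esub> wpull 1 [[0], []] R = wpull 1 [[0], []] R"
      using wpull_cleg_pair[OF ws(1) len(1), of 0 2 R] wpull_cleg_pair[OF ws(1) len(1), of 0 1 R] by simp
  qed (use w1 in simp_all)
  have e2: "wpull 1 [[], [0]] R = \<one>\<^bsub>?M1\<^esub>"
  proof (rule unit[OF U])
    have "wpull 1 [[], [0]] R = wpull 1 [[], [], [0]] (wpull 3 [[0, 1], [2]] R)"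
      using wpull_wpull[OF ws(2), of "[[0, 1], [2]]" R] w3 by (simp add: compose_words_def numeral_3_eq_3)
    also have "\<dots> = wpull 1 [[], [], [0]] (cleg 3 [0, 2] R) \<otimes>\<^bsub>?M1\<^esub> wpull 1 [[], [], [0]] (cleg 3 [1, 2] R)"
      using hom_mult[OF wpull_hom[OF ws(2), unfolded len] cl3(2,3)] wpull_mult_left[of 0 1 2 3] by simp
    finally show "wpull 1 [[], [0]] R \<otimes>\<^bsub>?M1\<^esub> wpull 1 [[], [0]] R = wpull 1 [[], [0]] R"
      using wpull_cleg_pair[OF ws(2) len(2), of 0 2 R] wpull_cleg_pair[OF ws(2) len(2), of 1 2 R] by simp
  qed (use w1 in simp_all)
  assume "i < N"
  then have wi: "disjoint_words N [[i]]" by (simp add: disjoint_words_def)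
  have l1: "length [[i]] = 1" by simp
  show "wpull N [[i], []] R = \<one>\<^bsub>conv_monoid (tensor_power B N)\<^esub>"
    using wpull_wpull[OF wi, of "[[0], []]" R, unfolded l1, OF w1(1)] wpull_one[OF wi, unfolded l1]
    unfolding e1 by (simp add: compose_words_def)
  show "wpull N [[], [i]] R = \<one>\<^bsub>conv_monoid (tensor_power B N)\<^esub>"
    using wpull_wpull[OF wi, of "[[], [0]]" R, unfolded l1, OF w1(2)] wpull_one[OF wi, unfolded l1]
    unfolding e2 by (simp add: compose_words_def)
qed

end

text \<open>The structure equal to \<open>Q\<close> supplies multiplicativity, which merges two
  adjacent legs into one functional of a product; the other structure supplies the
  quasi-commutativity that reverses this product.\<close>

lemma mixed_Yang_Baxter:
  assumes R: "co_quasi_triangular B R" and S: "co_quasi_triangular B S" and Q: "Q = R \<or> Q = S"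
    and d: "distinct [i, j, k]" "{i, j, k} \<subseteq> {..<N}"
  defines "M \<equiv> conv_monoid (tensor_power B N)"
  shows "bialgebra.cleg B N [i, j] R \<otimes>\<^bsub>M\<^esub> (bialgebra.cleg B N [i, k] Q \<otimes>\<^bsub>M\<^esub> bialgebra.cleg B N [j, k] S) =
    bialgebra.cleg B N [j, k] S \<otimes>\<^bsub>M\<^esub> (bialgebra.cleg B N [i, k] Q \<otimes>\<^bsub>M\<^esub> bialgebra.cleg B N [i, j] R)"
proof -
  interpret R: co_quasi_triangular B R by (rule R)
  interpret S: co_quasi_triangular B S by (rule S)
  interpret M: monoid M unfolding M_def by (rule R.monoid_conv_tensor_power)
  let ?c = "R.cleg N"
  have cl: "?c [a, b] F \<in> carrier M" if "a \<noteq> b" "{a, b} \<subseteq> {i, j, k}" "F = R \<or> F = S" for a b F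
    unfolding M_def using that d(2) R.R_linear S.R_linear by (intro R.cleg_pair_closed) auto
  have cls: "?c [i, j] R \<in> carrier M" "?c [i, k] R \<in> carrier M" "?c [i, k] S \<in> carrier M" "?c [j, k] S \<in> carrier M"
    using d(1) by (auto intro!: cl)
  from Q show ?thesis
  proof
    assume Q: "Q = S" \<comment> \<open>\<open>R\<close> is moved past \<open>S\<^sub>i\<^sub>k * S\<^sub>j\<^sub>k = S \<circ> (m \<otimes> id)\<close> by its quasi-commutativity\<close>
    show ?thesis
      using R.cleg_swap_left[OF d S.R_linear] S.wpull_mult_left[OF d] S.wpull_mult_left[of j i k N] d cls
      unfolding Q M_def[symmetric] by (auto simp: M.m_assoc insert_commute)
  next
    assume Q: "Q = R"
    \<comment> \<open>Here \<open>R_ik * R_ij\<close> is \<open>R\<close> on factor \<open>i\<close>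
      and the product of the factors \<open>j\<close> and \<open>k\<close>; moving
      \<open>S_jk\<close> past it exchanges these two.\<close>
    have d': "distinct [j, k, i]" "{j, k, i} \<subseteq> {..<N}" using d by auto
    show ?thesis
      using S.cleg_swap_right[OF d' R.R_linear] R.wpull_mult_right[OF d] R.wpull_mult_right[of i k j N] d cls
      unfolding Q M_def[symmetric] by (auto simp: M.m_assoc insert_commute)
  qed
qed

section \<open>Triangular products in a monoid\<close>

text \<open>Descending inside a row, ascending over the rows of a triangle: the order of the factors
  of the twist, with all indices lowered by one.\<close>

definition row_prod :: "('m, 'z) monoid_scheme \<Rightarrow> (nat \<Rightarrow> 'm) \<Rightarrow> nat \<Rightarrow> 'm"
  where "row_prod M f m = foldr (mult M) (map f (rev [0..<m])) (one M)"

definition triangle_prod :: "('m, 'z) monoid_scheme \<Rightarrow> (nat \<Rightarrow> nat \<Rightarrow> 'm) \<Rightarrow> nat \<Rightarrow> 'm"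
  where "triangle_prod M f n = foldr (mult M) (map (\<lambda>i. row_prod M (f i) i) [0..<n]) (one M)"

lemma row_prod_simps [simp]:
  "row_prod M f 0 = one M"
  "row_prod M f (Suc m) = mult M (f m) (row_prod M f m)"
  by (simp_all add: row_prod_def)

lemma triangle_prod_0 [simp]: "triangle_prod M f 0 = one M"
  by (simp add: triangle_prod_def)

context monoid
begin

definition commutes :: "'a \<Rightarrow> 'a \<Rightarrow> bool"
  where "commutes x y \<longleftrightarrow> x \<otimes> y = y \<otimes> x"

lemma commutes_one [simp]: "x \<in> carrier G \<Longrightarrow> commutes x \<one>"
  by (simp add: commutes_def)

lemma commutes_sym: "commutes x y \<Longrightarrow> commutes y x"
  by (simp add: commutes_def)

lemma commutes_mult:
  assumes "commutes x y" "commutes x z" "x \<in> carrier G" "y \<in> carrier G" "z \<in> carrier G"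
  shows "commutes x (y \<otimes> z)"
proof -
  have "x \<otimes> (y \<otimes> z) = (x \<otimes> y) \<otimes> z" using assms by (simp add: m_assoc)
  also have "\<dots> = y \<otimes> (x \<otimes> z)"
    using assms by (simp only: commutes_def m_assoc)
  also have "\<dots> = y \<otimes> z \<otimes> x" using assms by (simp add: commutes_def m_assoc)
  finally show ?thesis by (simp add: commutes_def)
qed

lemma commutesD:
  assumes "commutes x y" "x \<in> carrier G" "y \<in> carrier G" "z \<in> carrier G"
  shows "x \<otimes> (y \<otimes> z) = y \<otimes> (x \<otimes> z)"
  using assms by (simp add: commutes_def m_assoc[symmetric])

lemma foldr_closed: "set xs \<subseteq> carrier G \<Longrightarrow> z \<in> carrier G \<Longrightarrow> foldr (\<otimes>) xs z \<in> carrier G"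
  by (induction xs) auto

lemma foldr_append_mult:
  "set xs \<subseteq> carrier G \<Longrightarrow> z \<in> carrier G \<Longrightarrow> foldr (\<otimes>) xs z = foldr (\<otimes>) xs \<one> \<otimes> z"
  by (induction xs) (auto simp: m_assoc foldr_closed)

lemma row_prod_closed: "(\<And>j. j < m \<Longrightarrow> f j \<in> carrier G) \<Longrightarrow> row_prod G f m \<in> carrier G"
  by (induction m) auto

lemma triangle_prod_Suc:
  assumes "\<And>i j. j < i \<Longrightarrow> i < Suc n \<Longrightarrow> f i j \<in> carrier G"
  shows "triangle_prod G f (Suc n) = triangle_prod G f n \<otimes> row_prod G (f n) n"
proof -
  have "set (map (\<lambda>i. row_prod G (f i) i) [0..<n]) \<subseteq> carrier G"
    using assms by (auto intro!: row_prod_closed)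
  moreover have "row_prod G (f n) n \<in> carrier G" using assms by (intro row_prod_closed) auto
  ultimately show ?thesis
    using foldr_append_mult[of _ "row_prod G (f n) n"] by (simp add: triangle_prod_def)
qed

lemma triangle_prod_closed:
  "(\<And>i j. j < i \<Longrightarrow> i < n \<Longrightarrow> f i j \<in> carrier G) \<Longrightarrow> triangle_prod G f n \<in> carrier G"
  unfolding triangle_prod_def by (rule foldr_closed) (auto intro!: row_prod_closed)

lemma commutes_row:
  assumes "x \<in> carrier G" "\<And>j. j < m \<Longrightarrow> f j \<in> carrier G" "\<And>j. j < m \<Longrightarrow> commutes x (f j)"
  shows "commutes x (row_prod G f m)"
  using assms(2,3) by (induction m) (auto intro!: commutes_mult row_prod_closed simp: assms(1))

lemma commutes_triangle:
  assumes x: "x \<in> carrier G" and f: "\<And>i j. j < i \<Longrightarrow> i < n \<Longrightarrow> f i j \<in> carrier G"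
    and c: "\<And>i j. j < i \<Longrightarrow> i < n \<Longrightarrow> commutes x (f i j)"
  shows "commutes x (triangle_prod G f n)"
  using f c
proof (induction n)
  case (Suc n)
  then show ?case
    by (subst triangle_prod_Suc)
      (auto intro!: commutes_mult commutes_row triangle_prod_closed row_prod_closed x)
qed (simp add: x)

text \<open>When the two rows are separated, \<open>d j\<close> has to pass only those
  \<open>b k\<close> with \<open>k < j\<close>.\<close>

lemma row_prod_mult:
  assumes "\<And>j. j < m \<Longrightarrow> b j \<in> carrier G" "\<And>j. j < m \<Longrightarrow> d j \<in> carrier G"
    and "\<And>j k. j < m \<Longrightarrow> k < m \<Longrightarrow> j \<noteq> k \<Longrightarrow> commutes (d j) (b k)"
  shows "row_prod G (\<lambda>j. b j \<otimes> d j) m = row_prod G b m \<otimes> row_prod G d m"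
  using assms
proof (induction m)
  case (Suc m)
  have "commutes (d m) (row_prod G b m)"
    using Suc.prems by (intro commutes_row) auto
  moreover have cl: "row_prod G b m \<in> carrier G" "row_prod G d m \<in> carrier G"
    using Suc.prems by (auto intro!: row_prod_closed)
  ultimately have "d m \<otimes> (row_prod G b m \<otimes> row_prod G d m) = row_prod G b m \<otimes> (d m \<otimes> row_prod G d m)"
    using Suc.prems(2)[of m] by (intro commutesD) auto
  moreover have "row_prod G (\<lambda>j. b j \<otimes> d j) m = row_prod G b m \<otimes> row_prod G d m"
    using Suc.prems by (intro Suc.IH) auto
  ultimately show ?case
    using cl Suc.prems(1)[of m] Suc.prems(2)[of m] by (simp add: m_assoc)
qed simp

text \<open>The element \<open>a\<close> moves through both rows one index at a time. A Yang--Baxter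
  step handles each index \<open>j\<close>, and the commutations bring \<open>a\<close>,
  \<open>b j\<close> and \<open>d j\<close> next to each other.\<close>

lemma row_exchange:
  assumes a: "a \<in> carrier G"
    and b: "\<And>j. j < m \<Longrightarrow> b j \<in> carrier G" and d: "\<And>j. j < m \<Longrightarrow> d j \<in> carrier G"
    and bd: "\<And>j k. j < m \<Longrightarrow> k < m \<Longrightarrow> j \<noteq> k \<Longrightarrow> commutes (b j) (d k)"
    and yb: "\<And>j. j < m \<Longrightarrow> a \<otimes> (b j \<otimes> d j) = d j \<otimes> (b j \<otimes> a)"
  shows "row_prod G d m \<otimes> (row_prod G b m \<otimes> a) = a \<otimes> (row_prod G b m \<otimes> row_prod G d m)"
  using b d bd yb
proof (induction m)
  case (Suc m)
  let ?B = "row_prod G b m" and ?D = "row_prod G d m"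
  have cl: "?B \<in> carrier G" "?D \<in> carrier G" "b m \<in> carrier G" "d m \<in> carrier G"
    using Suc.prems by (auto intro!: row_prod_closed)
  have c1: "commutes (b m) ?D" using Suc.prems by (intro commutes_row) auto
  have c2: "commutes ?B (d m)" using Suc.prems by (intro commutes_sym[OF commutes_row]) (auto intro: commutes_sym)
  have IH: "?D \<otimes> (?B \<otimes> a) = a \<otimes> (?B \<otimes> ?D)" using Suc.prems by (intro Suc.IH) auto
  have yb: "a \<otimes> (b m \<otimes> d m) = d m \<otimes> (b m \<otimes> a)" using Suc.prems by simp
  have "row_prod G d (Suc m) \<otimes> (row_prod G b (Suc m) \<otimes> a) = d m \<otimes> (?D \<otimes> (b m \<otimes> (?B \<otimes> a)))"
    using cl a by (simp add: m_assoc)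
  also have "\<dots> = d m \<otimes> (b m \<otimes> (?D \<otimes> (?B \<otimes> a)))"
    using cl a by (simp add: commutesD[OF c1 cl(3,2)])
  also have "\<dots> = (d m \<otimes> (b m \<otimes> a)) \<otimes> (?B \<otimes> ?D)"
    unfolding IH using cl a by (simp add: m_assoc)
  also have "\<dots> = a \<otimes> (b m \<otimes> (d m \<otimes> (?B \<otimes> ?D)))"
    unfolding yb[symmetric] using cl a by (simp add: m_assoc)
  also have "d m \<otimes> (?B \<otimes> ?D) = ?B \<otimes> (d m \<otimes> ?D)"
    using cl by (simp add: commutesD[OF c2 cl(1,4)])
  finally show ?case using cl by (simp add: m_assoc)
qed (simp add: a)

end

text \<open>
  In the application \<open>a i j\<close>, \<open>b i j\<close> and \<open>d i j\<close> are the legs on the factors \<open>(x\<^sub>i, y\<^sub>j)\<close>, \<open>(x\<^sub>i, z\<^sub>j)\<close> and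
  \<open>(y\<^sub>i, z\<^sub>j)\<close> of a triple tensor product.
\<close>

locale triangular_exchange = monoid G
  for G :: "('m, 'z) monoid_scheme" (structure) +
  fixes n :: nat and a b d :: "nat \<Rightarrow> nat \<Rightarrow> 'm"
  assumes a_closed: "j < i \<Longrightarrow> i < n \<Longrightarrow> a i j \<in> carrier G"
    and b_closed: "j < i \<Longrightarrow> i < n \<Longrightarrow> b i j \<in> carrier G"
    and d_closed: "j < i \<Longrightarrow> i < n \<Longrightarrow> d i j \<in> carrier G"
    and a_b: "j < i \<Longrightarrow> i < n \<Longrightarrow> l < k \<Longrightarrow> k < n \<Longrightarrow> i \<noteq> k \<Longrightarrow> commutes (a i j) (b k l)"
    and a_d: "j < i \<Longrightarrow> i < n \<Longrightarrow> l < k \<Longrightarrow> k < n \<Longrightarrow> j \<noteq> k \<Longrightarrow> commutes (a i j) (d k l)"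
    and b_d: "j < i \<Longrightarrow> i < n \<Longrightarrow> l < k \<Longrightarrow> k < n \<Longrightarrow> j \<noteq> l \<Longrightarrow> commutes (b i j) (d k l)"
    and yang_baxter: "k < j \<Longrightarrow> j < i \<Longrightarrow> i < n \<Longrightarrow> a i j \<otimes> (b i k \<otimes> d j k) = d j k \<otimes> (b i k \<otimes> a i j)"
begin

text \<open>Row \<open>i\<close> of the \<open>b\<close>- and \<open>a\<close>-legs moves from right
  to left through the triangle of \<open>d\<close>-legs. In passing, it changes from all
  \<open>b\<close> before all \<open>a\<close> to the alternating order, as \<open>a i m\<close>
  overtakes the \<open>b i k\<close> with \<open>k < m\<close>.\<close>

lemma row_triangle:
  assumes "i < n" "m \<le> i"
  shows "triangle_prod G d m \<otimes> (row_prod G (b i) m \<otimes> row_prod G (a i) m) =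
    row_prod G (\<lambda>j. b i j \<otimes> a i j) m \<otimes> triangle_prod G d m"
  using assms(2)
proof (induction m)
  case (Suc m)
  let ?D = "triangle_prod G d m" and ?r = "row_prod G (d m) m"
  let ?B = "row_prod G (b i) m" and ?A = "row_prod G (a i) m"
  let ?P = "row_prod G (\<lambda>j. b i j \<otimes> a i j) m"
  have m: "m < i" "m < n" using Suc.prems assms(1) by auto
  have cl: "?D \<in> carrier G" "?r \<in> carrier G" "?B \<in> carrier G" "?A \<in> carrier G" "?P \<in> carrier G"
    "b i m \<in> carrier G" "a i m \<in> carrier G"
    using m assms(1) by (auto intro!: triangle_prod_closed row_prod_closed m_closed a_closed b_closed d_closed)
  have c1: "commutes (b i m) ?D" "commutes (a i m) ?D"
    using m assms(1) by (auto intro!: commutes_triangle b_closed a_closed d_closed b_d a_d)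
  have c2: "commutes (b i m) ?r"
    using m assms(1) by (auto intro!: commutes_row b_closed d_closed b_d)
  have c3: "commutes ?r ?A"
  proof (rule commutes_sym, rule commutes_sym, rule commutes_row)
    fix j assume j: "j < m"
    show "commutes ?r (a i j)"
      using j m assms(1) by (intro commutes_sym[OF commutes_row] a_closed d_closed a_d) auto
  qed (use cl m assms(1) in \<open>auto intro!: a_closed\<close>)
  \<comment> \<open>The triples that occur are \<open>k < m < i\<close>, those of the Yang--Baxter
    assumption.\<close>
  have ex: "?r \<otimes> (?B \<otimes> a i m) = a i m \<otimes> (?B \<otimes> ?r)"
    using m assms(1) by (intro row_exchange a_closed b_closed d_closed b_d yang_baxter) auto
  have IH: "?D \<otimes> (?B \<otimes> ?A) = ?P \<otimes> ?D" using Suc by simp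
  have T: "triangle_prod G d (Suc m) = ?D \<otimes> ?r"
    using m by (intro triangle_prod_Suc d_closed) auto
  have "triangle_prod G d (Suc m) \<otimes> (row_prod G (b i) (Suc m) \<otimes> row_prod G (a i) (Suc m)) =
      ?D \<otimes> (?r \<otimes> (b i m \<otimes> (?B \<otimes> (a i m \<otimes> ?A))))"
    unfolding T using cl by (simp add: m_assoc)
  \<comment> \<open>The second index of every \<open>d\<close>-leg involved is below
    \<open>m\<close>, so \<open>b i m\<close> passes them all.\<close>
  also have "\<dots> = b i m \<otimes> (?D \<otimes> ((?r \<otimes> (?B \<otimes> a i m)) \<otimes> ?A))"
    using cl by (simp add: m_assoc commutesD[OF c1(1) cl(6,1), symmetric] commutesD[OF c2 cl(6,2), symmetric])
  also have "\<dots> = b i m \<otimes> (?D \<otimes> (a i m \<otimes> (?B \<otimes> (?r \<otimes> ?A))))"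
    unfolding ex using cl by (simp add: m_assoc)
  also have "\<dots> = b i m \<otimes> (a i m \<otimes> ((?D \<otimes> (?B \<otimes> ?A)) \<otimes> ?r))"
    using cl c3 by (simp add: m_assoc commutesD[OF c1(2) cl(7,1), symmetric] commutes_def)
  also have "\<dots> = row_prod G (\<lambda>j. b i j \<otimes> a i j) (Suc m) \<otimes> triangle_prod G d (Suc m)"
    unfolding IH T using cl by (simp add: m_assoc)
  finally show ?case .
qed simp

text \<open>Induction on the number of rows. The new \<open>b\<close> and \<open>d\<close> rows
  commute with the old \<open>a\<close> triangle, so the induction hypothesis applies to the front
  part; \<open>row_triangle\<close> then moves the new \<open>b\<close> and \<open>a\<close> rows
  through the old \<open>d\<close> triangle.\<close>

lemma triangle_exchange:
  "m \<le> n \<Longrightarrow> triangle_prod G (\<lambda>i j. b i j \<otimes> d i j) m \<otimes> triangle_prod G a m =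
    triangle_prod G (\<lambda>i j. b i j \<otimes> a i j) m \<otimes> triangle_prod G d m"
proof (induction m)
  case (Suc m)
  then have m: "m < n" by simp
  let ?A = "row_prod G (a m) m" and ?B = "row_prod G (b m) m" and ?D = "row_prod G (d m) m"
  let ?P = "row_prod G (\<lambda>j. b m j \<otimes> a m j) m"
  let ?ta = "triangle_prod G a m" and ?td = "triangle_prod G d m"
  let ?tba = "triangle_prod G (\<lambda>i j. b i j \<otimes> a i j) m" and ?tbd = "triangle_prod G (\<lambda>i j. b i j \<otimes> d i j) m"
  have cl: "?A \<in> carrier G" "?B \<in> carrier G" "?D \<in> carrier G" "?P \<in> carrier G"
    "?ta \<in> carrier G" "?td \<in> carrier G" "?tba \<in> carrier G" "?tbd \<in> carrier G"
    using m by (auto intro!: triangle_prod_closed row_prod_closed m_closed a_closed b_closed d_closed)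
  have T: "triangle_prod G f (Suc m) = triangle_prod G f m \<otimes> row_prod G (f m) m"
    if "\<And>i j. j < i \<Longrightarrow> i < n \<Longrightarrow> f i j \<in> carrier G" for f
    using that m by (intro triangle_prod_Suc) auto
  have BD: "row_prod G (\<lambda>j. b m j \<otimes> d m j) m = ?B \<otimes> ?D"
    using m by (intro row_prod_mult b_closed d_closed commutes_sym[OF b_d]) auto
  have c1: "commutes ?D ?ta"
    using m cl by (intro commutes_triangle a_closed commutes_sym[OF commutes_row] d_closed a_d) auto
  have c2: "commutes ?B ?ta"
    using m cl by (intro commutes_triangle a_closed commutes_sym[OF commutes_row] b_closed a_b) auto
  have c3: "commutes ?D ?A"
    using m cl by (intro commutes_row a_closed commutes_sym[OF commutes_row] d_closed a_d) auto
  have row: "?td \<otimes> (?B \<otimes> ?A) = ?P \<otimes> ?td" using m by (intro row_triangle) auto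
  have IH: "?tbd \<otimes> ?ta = ?tba \<otimes> ?td" using Suc by simp
  have "triangle_prod G (\<lambda>i j. b i j \<otimes> d i j) (Suc m) \<otimes> triangle_prod G a (Suc m) =
      ?tbd \<otimes> (?B \<otimes> (?D \<otimes> (?ta \<otimes> ?A)))"
    using cl by (simp add: T a_closed b_closed d_closed BD m_assoc)
  \<comment> \<open>The new \<open>d\<close> row passes every \<open>a i j\<close> with
    \<open>i \<le> m\<close>: a common factor would require \<open>j = m\<close>, but
    \<open>j < i\<close>.\<close>
  also have "\<dots> = (?tbd \<otimes> ?ta) \<otimes> (?B \<otimes> (?A \<otimes> ?D))"
    using cl c3 by (simp add: m_assoc commutesD[OF c1 cl(3,5)] commutesD[OF c2 cl(2,5)] commutes_def)
  also have "\<dots> = ?tba \<otimes> ((?td \<otimes> (?B \<otimes> ?A)) \<otimes> ?D)"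
    unfolding IH using cl by (simp add: m_assoc)
  also have "\<dots> = triangle_prod G (\<lambda>i j. b i j \<otimes> a i j) (Suc m) \<otimes> triangle_prod G d (Suc m)"
    unfolding row using cl by (simp add: T a_closed b_closed d_closed m_assoc)
  finally show ?case .
qed simp

end

section \<open>Homomorphic images and invertibility of triangular products\<close>

lemma foldr_hom:
  assumes "monoid G" "h \<in> hom G H" "h \<one>\<^bsub>G\<^esub> = \<one>\<^bsub>H\<^esub>" "set xs \<subseteq> carrier G"
  shows "h (foldr (mult G) xs \<one>\<^bsub>G\<^esub>) = foldr (mult H) (map h xs) \<one>\<^bsub>H\<^esub>"
proof -
  interpret monoid G by (rule assms(1))
  show ?thesis
    using assms(4) by (induction xs) (auto simp: assms(3) hom_mult[OF assms(2)] foldr_closed)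
qed

lemma triangle_prod_hom:
  assumes "monoid G" "h \<in> hom G H" "h \<one>\<^bsub>G\<^esub> = \<one>\<^bsub>H\<^esub>"
    and f: "\<And>i j. j < i \<Longrightarrow> i < n \<Longrightarrow> f i j \<in> carrier G"
  shows "h (triangle_prod G f n) = triangle_prod H (\<lambda>i j. h (f i j)) n"
proof -
  interpret monoid G by (rule assms(1))
  have row: "h (row_prod G (f i) i) = row_prod H (\<lambda>j. h (f i j)) i" if "i < n" for i
    unfolding row_prod_def using f that
    by (subst foldr_hom[OF assms(1-3)]) (auto simp: comp_def rev_map)
  have "h (triangle_prod G f n) = foldr (mult H) (map h (map (\<lambda>i. row_prod G (f i) i) [0..<n])) \<one>\<^bsub>H\<^esub>"
    unfolding triangle_prod_def using f
    by (intro foldr_hom[OF assms(1-3)]) (auto intro!: row_prod_closed)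
  also have "map h (map (\<lambda>i. row_prod G (f i) i) [0..<n]) = map (\<lambda>i. row_prod H (\<lambda>j. h (f i j)) i) [0..<n]"
    using row by simp
  finally show ?thesis by (simp add: triangle_prod_def)
qed

lemma triangle_prod_cong:
  assumes "\<And>i j. j < i \<Longrightarrow> i < n \<Longrightarrow> f i j = g i j"
  shows "triangle_prod M f n = triangle_prod M g n"
proof -
  have "row_prod M (f i) i = row_prod M (g i) i" if "i < n" for i
  proof -
    have "map (f i) (rev [0..<i]) = map (g i) (rev [0..<i])" using that assms by auto
    then show ?thesis by (simp only: row_prod_def)
  qed
  then have "map (\<lambda>i. row_prod M (f i) i) [0..<n] = map (\<lambda>i. row_prod M (g i) i) [0..<n]" by simp
  then show ?thesis by (simp only: triangle_prod_def)
qed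

lemma (in monoid) triangle_prod_one: "triangle_prod G (\<lambda>i j. \<one>) n = \<one>"
proof -
  have "row_prod G (\<lambda>j. \<one>) m = \<one>" for m by (induction m) auto
  then show ?thesis by (induction n) (simp_all add: triangle_prod_Suc)
qed

lemma (in monoid) triangle_prod_Units:
  assumes "\<And>i j. j < i \<Longrightarrow> i < n \<Longrightarrow> f i j \<in> Units G"
  shows "triangle_prod G f n \<in> Units G"
proof -
  have units: "foldr (\<otimes>) xs \<one> \<in> Units G" if "set xs \<subseteq> Units G" for xs
    using that by (induction xs) auto
  then show ?thesis
    unfolding triangle_prod_def row_prod_def using assms by (auto intro!: units)
qed

section \<open>The twist of a transitive colouring\<close>

lemma nth_expand_words:
  "l < length ws \<Longrightarrow> i < n \<Longrightarrow> expand_words n ws ! (n * l + i) = map (\<lambda>l. l * n + i) (ws ! l)"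
  unfolding expand_words_def by (rule nth_concat_blocks)

lemma expand_words_pair:
  assumes "length ws = 2" "i < n"
  shows "expand_words n ws ! i = map (\<lambda>l. l * n + i) (ws ! 0)"
    "expand_words n ws ! (n + i) = map (\<lambda>l. l * n + i) (ws ! 1)"
  using nth_expand_words[of 0 ws i n] nth_expand_words[of 1 ws i n] assms by simp_all

text \<open>
  Indices start at \<open>0\<close> here: \<open>r i j\<close> stands for the structure of colour \<open>c (j + 1, i + 1)\<close>.
\<close>

locale coloured_family = bialgebra H
  for H :: "('a::ab_group_add, 'k::field) bialg" +
  fixes n :: nat and r :: "nat \<Rightarrow> nat \<Rightarrow> ('a, 'k) tens \<Rightarrow> 'k" and J0 :: "('a, 'k) tens \<Rightarrow> 'k"
  assumes r_cqt: "j < i \<Longrightarrow> i < n \<Longrightarrow> co_quasi_triangular H (r i j)"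
    and r_trans: "k < j \<Longrightarrow> j < i \<Longrightarrow> i < n \<Longrightarrow> r i k = r i j \<or> r i k = r j k"
    and J0_Hom_k: "J0 \<in> Hom_k (tensor_power H (2 * n))"
    and J0_eq: "restrict J0 (tspace H (2 * n)) =
      triangle_prod (conv_monoid (tensor_power H (2 * n))) (\<lambda>i j. cleg (2 * n) [i, n + j] (r i j)) n"
begin

abbreviation T where "T \<equiv> tensor_power H n"

abbreviation J where "J \<equiv> J0 \<circ> regroup H n"

sublocale T: bialgebra T
  by (rule bialgebra_tensor_power)

lemma r_Hom_k: "j < i \<Longrightarrow> i < n \<Longrightarrow> r i j \<in> Hom_k (tensor_power H 2)"
  using co_quasi_triangular.R_linear[OF r_cqt] .

lemma cleg_r_closed:
  "j < i \<Longrightarrow> i < n \<Longrightarrow> k \<noteq> l \<Longrightarrow> k < N \<Longrightarrow> l < N \<Longrightarrow>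
    cleg N [k, l] (r i j) \<in> carrier (conv_monoid (tensor_power H N))"
  by (rule cleg_pair_closed) (auto intro: r_Hom_k)

lemma cleg_r_Units:
  assumes ij: "j < i" "i < n" and kl: "k \<noteq> l" "k < N" "l < N"
  shows "cleg N [k, l] (r i j) \<in> Units (conv_monoid (tensor_power H N))"
proof -
  interpret P: bialgebra "tensor_power H 2" by (rule bialgebra_tensor_power)
  have U: "restrict (r i j) (carrier (tensor_power H 2)) \<in> Units (conv_monoid (tensor_power H 2))"
    using P.conv_invertible_iff[OF r_Hom_k[OF ij]] co_quasi_triangular.R_invertible[OF r_cqt[OF ij]] by simp
  have ws: "disjoint_words N [[k], [l]]" and len: "length [[k], [l]] = 2"
    using kl by (auto simp: disjoint_words_def)
  have "cleg N [k, l] (r i j) = wpull N [[k], [l]] (restrict (r i j) (carrier (tensor_power H 2)))"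
  proof -
    have "wpull N [[k], [l]] (r i j) = wpull N [[k], [l]] (restrict (r i j) (carrier (tensor_power H 2)))"
      by (rule wpull_cong[OF ws]) (simp add: numeral_2_eq_2)
    then show ?thesis by (simp add: cleg_def del: restrict_apply)
  qed
  then show ?thesis
    using comul_space.pullback_Units[OF comul_space_tensor_power coalg_map_wmap[OF ws, unfolded len] U]
    by (simp add: wpull_def)
qed

lemma J_eq_flatten: "t \<in> tspace T 2 \<Longrightarrow> J t = J0 (flatten H n 2 t)"
  by (simp add: regroup_eq_flatten)

lemma J_Hom_k: "J \<in> Hom_k (tensor_power T 2)"
  by (rule comul_space.Hom_k_cong[OF T.comul_space_tensor_power coalg_map_Hom_k[OF coalg_map_flatten J0_Hom_k]])
    (simp add: J_eq_flatten[symmetric])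

text \<open>One formula for all terms of the twist conditions, as \<open>ws\<close> may be a
  multiplication, a projection or an insertion of units. Flattening splits the two words into
  components; component \<open>i\<close> of the first and component \<open>j\<close> of the second
  become the arguments of \<open>r i j\<close>.\<close>

lemma J_words:
  assumes ws: "disjoint_words N ws" and len: "length ws = 2"
  shows "restrict (\<lambda>t. J (wmap T N ws t)) (tspace T N) =
    pullback (tensor_power T N) (flatten H n N)
      (triangle_prod (conv_monoid (tensor_power H (N * n)))
        (\<lambda>i j. wpull (N * n) [map (\<lambda>l. l * n + i) (ws ! 0), map (\<lambda>l. l * n + j) (ws ! 1)] (r i j)) n)"
proof -
  let ?E = "expand_words n ws" and ?M = "conv_monoid (tensor_power H (N * n))"
  have E: "disjoint_words (N * n) ?E" by (rule disjoint_words_expand[OF ws])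
  have lE: "length ?E = 2 * n" by (simp add: length_expand_words len)
  have "J (wmap T N ws t) = wpull (N * n) ?E (restrict J0 (tspace H (2 * n))) (flatten H n N t)"
    if t: "t \<in> tspace T N" for t
  proof -
    have "J (wmap T N ws t) = J0 (flatten H n 2 (wmap T N ws t))"
      using T.wmap_closed[OF ws t] len by (intro J_eq_flatten) simp
    also have "\<dots> = J0 (wmap H (N * n) ?E (flatten H n N t))"
      using flatten_wmap[OF ws t] len by simp
    finally show ?thesis
      using flatten_closed[OF t] wmap_closed[OF E flatten_closed[OF t]] lE
      by (simp add: wpull_def pullback_def)
  qed
  then have "restrict (\<lambda>t. J (wmap T N ws t)) (tspace T N) =
      pullback (tensor_power T N) (flatten H n N) (wpull (N * n) ?E (restrict J0 (tspace H (2 * n))))"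
    unfolding pullback_def by (intro ext) (simp add: restrict_def)
  also have "wpull (N * n) ?E (restrict J0 (tspace H (2 * n))) =
      triangle_prod ?M (\<lambda>i j. wpull (N * n) ?E (cleg (2 * n) [i, n + j] (r i j))) n"
    unfolding J0_eq
    by (rule triangle_prod_hom[where h = "wpull (N * n) ?E", OF monoid_conv_tensor_power wpull_hom[OF E, unfolded lE] wpull_one[OF E, unfolded lE]])
      (auto intro!: cleg_r_closed)
  also have "\<dots> = triangle_prod ?M
      (\<lambda>i j. wpull (N * n) [map (\<lambda>l. l * n + i) (ws ! 0), map (\<lambda>l. l * n + j) (ws ! 1)] (r i j)) n"
    by (rule triangle_prod_cong)
      (simp add: wpull_cleg_pair[OF E lE] expand_words_pair[OF len])
  finally show ?thesis .
qed

text \<open>Legs of invertible structures are units, hence so is their product, and pulling back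
  along the coalgebra map \<open>flatten\<close> preserves this.\<close>

lemma J_invertible: "conv_invertible (tensor_power T 2) J"
proof -
  interpret T2: bialgebra "tensor_power T 2" by (rule T.bialgebra_tensor_power)
  interpret M: monoid "conv_monoid (tensor_power H (2 * n))" by (rule monoid_conv_tensor_power)
  have "restrict J0 (carrier (tensor_power H (2 * n))) \<in> Units (conv_monoid (tensor_power H (2 * n)))"
    using J0_eq by (auto intro!: M.triangle_prod_Units cleg_r_Units simp del: restrict_apply)
  from T2.pullback_Units[OF coalg_map_flatten this]
  have "restrict J (carrier (tensor_power T 2)) \<in> Units (conv_monoid (tensor_power T 2))"
    unfolding pullback_restrict[OF coalg_map_flatten]
    by (rule back_subst[where P = "\<lambda>f. f \<in> _"]) (rule restrict_ext, simp add: J_eq_flatten[symmetric])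
  then show ?thesis using T2.conv_invertible_iff[OF J_Hom_k] by simp
qed

text \<open>In the application the words insert a unit next to a single block. By \<open>one\<close>
  every leg becomes trivial, so the triangular product is the counit, and evaluation at the one-slot
  tensor of \<open>a\<close> returns to \<open>T\<close>.\<close>

lemma J_unit:
  assumes ws: "disjoint_words 1 ws" "length ws = 2"
    and one: "\<And>i j. j < i \<Longrightarrow> i < n \<Longrightarrow>
      wpull (1 * n) [map (\<lambda>l. l * n + i) (ws ! 0), map (\<lambda>l. l * n + j) (ws ! 1)] (r i j) =
        \<one>\<^bsub>conv_monoid (tensor_power H (1 * n))\<^esub>"
    and a: "a \<in> carrier T"
  shows "J (wmap T 1 ws (pure_tensor T [a])) = counit T a"
proof -
  let ?M = "conv_monoid (tensor_power H (1 * n))"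
  interpret M: monoid ?M by (rule monoid_conv_tensor_power)
  have p: "pure_tensor T [a] \<in> tspace T 1" using a by (intro pure_tensor_closed) simp
  have "restrict (\<lambda>t. J (wmap T 1 ws t)) (tspace T 1) =
      pullback (tensor_power T 1) (flatten H n 1) (triangle_prod ?M (\<lambda>i j. \<one>\<^bsub>?M\<^esub>) n)"
    unfolding J_words[OF ws] by (rule arg_cong[where f = "pullback _ _"], rule triangle_prod_cong, rule one)
  also have "\<dots> = \<one>\<^bsub>conv_monoid (tensor_power T 1)\<^esub>"
    unfolding M.triangle_prod_one by (rule pullback_one[OF coalg_map_flatten])
  finally have "restrict (\<lambda>t. J (wmap T 1 ws t)) (tspace T 1) (pure_tensor T [a]) =
      \<one>\<^bsub>conv_monoid (tensor_power T 1)\<^esub> (pure_tensor T [a])"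
    by (rule arg_cong)
  then have "J (wmap T 1 ws (pure_tensor T [a])) = counit (tensor_power T 1) (pure_tensor T [a])"
    using p by (simp add: conv_monoid_simps)
  also have "\<dots> = counit T a" using a by (simp add: T.counit_pure)
  finally show ?thesis .
qed

lemma J_pure_one:
  assumes a: "a \<in> carrier T"
  shows "J (pure_tensor T [a, \<one>\<^bsub>T\<^esub>]) = counit T a" "J (pure_tensor T [\<one>\<^bsub>T\<^esub>, a]) = counit T a"
proof -
  have w: "disjoint_words 1 [[0], []]" "disjoint_words 1 [[], [0]]" by (auto simp: disjoint_words_def)
  have u: "{..<1} - {0::nat} = {}" by auto
  have e: "wmap T 1 [[0], []] (pure_tensor T [a]) = pure_tensor T [a, \<one>\<^bsub>T\<^esub>]"
    "wmap T 1 [[], [0]] (pure_tensor T [a]) = pure_tensor T [\<one>\<^bsub>T\<^esub>, a]"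
    using T.wmap_pure[OF w(1), of "\<lambda>_. a"] T.wmap_pure[OF w(2), of "\<lambda>_. a"] T.r_one[OF a] a u
    by (simp_all del: tensor_power_simps)
  \<comment> \<open>An empty word stays empty in each component, so every leg has the unit of
    \<open>H\<close> as one of its arguments.\<close>
  have "wpull (1 * n) [map (\<lambda>l. l * n + i) ([[0], []] ! 0), map (\<lambda>l. l * n + j) ([[0], []] ! 1)] (r i j) =
      \<one>\<^bsub>conv_monoid (tensor_power H (1 * n))\<^esub>"
    "wpull (1 * n) [map (\<lambda>l. l * n + i) ([[], [0]] ! 0), map (\<lambda>l. l * n + j) ([[], [0]] ! 1)] (r i j) =
      \<one>\<^bsub>conv_monoid (tensor_power H (1 * n))\<^esub>"
    if "j < i" "i < n" for i j
    using co_quasi_triangular.wpull_unit_right[OF r_cqt[OF that], of i n]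
      co_quasi_triangular.wpull_unit_left[OF r_cqt[OF that], of j n] that by simp_all
  from J_unit[OF w(1) _ this(1) a] J_unit[OF w(2) _ this(2) a]
  show "J (pure_tensor T [a, \<one>\<^bsub>T\<^esub>]) = counit T a" "J (pure_tensor T [\<one>\<^bsub>T\<^esub>, a]) = counit T a"
    by (simp_all only: e list.size)
qed

text \<open>With \<open>f\<close> equal to the counit, both sides of a unit condition reduce to
  \<open>a\<close> by the counit laws.\<close>

lemma sweedler_counit:
  assumes a: "a \<in> carrier T" and f: "\<And>x. x \<in> carrier T \<Longrightarrow> f x = counit T x"
  shows "sweedler T (scl T) (\<lambda>a1 a2. scl T (f a1) a2) a = a"
    "sweedler T (scl T) (\<lambda>a1 a2. scl T (f a2) a1) a = a"
proof -
  obtain m p q where rep: "comul_rep T a {..<m::nat} p q" using T.comul_rep_exists[OF a] by blast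
  note pq = comul_repD(2,3)[OF rep]
  have "linear_on T (*) f"
    using T.counit_linear f by (simp add: Hom_k_def linear_on_def)
  then have "bilinear_on T (scl T) (\<lambda>a1 a2. scl T (f a1) a2)" "bilinear_on T (scl T) (\<lambda>a1 a2. scl T (f a2) a1)"
    by (auto intro!: bilinear_onI linear_onI
        simp: linear_on_def tens.scale_left_distrib tens.scale_right_distrib tens.scale_left_commute)
  from sweedler_rep[OF T.vector_space_axioms this(1) rep] sweedler_rep[OF T.vector_space_axioms this(2) rep]
  show "sweedler T (scl T) (\<lambda>a1 a2. scl T (f a1) a2) a = a" "sweedler T (scl T) (\<lambda>a1 a2. scl T (f a2) a1) a = a"
    using T.counit_rep[OF a rep] pq f by (simp_all del: tensor_power_simps)
qed

text \<open>The three blocks of length \<open>n\<close> start at \<open>0\<close>, \<open>n\<close>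
  and \<open>2 * n\<close>, so two legs share a factor only when indices in the same block coincide;
  the side conditions of the three commutation rules exclude exactly this.\<close>

lemma triangular_exchange_legs:
  defines "M \<equiv> conv_monoid (tensor_power H (3 * n))"
  shows "triangular_exchange M n (\<lambda>i j. cleg (3 * n) [i, n + j] (r i j))
    (\<lambda>i j. cleg (3 * n) [i, 2 * n + j] (r i j)) (\<lambda>i j. cleg (3 * n) [n + i, 2 * n + j] (r i j))"
proof -
  interpret M: monoid M unfolding M_def by (rule monoid_conv_tensor_power)
  have comm: "M.commutes (cleg (3 * n) [u, v] (r i j)) (cleg (3 * n) [x, y] (r k l))"
    if "distinct [u, v, x, y]" "{u, v, x, y} \<subseteq> {..<3 * n}" "j < i" "i < n" "l < k" "k < n" for u v x y i j k l
    unfolding M.commutes_def unfolding M_def using that by (intro cleg_commute r_Hom_k) auto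
  show ?thesis
  proof (unfold_locales)
    fix i j k assume kji: "k < j" "j < i" "i < n"
    \<comment> \<open>The structures are \<open>r i j\<close>, \<open>r j k\<close> and, as
      \<open>Q\<close>, \<open>r i k\<close>; transitivity, in the form \<open>r_trans\<close>,
      makes \<open>Q\<close> one of the other two.\<close>
    have "cleg (3 * n) [i, n + j] (r i j) \<otimes>\<^bsub>M\<^esub> (cleg (3 * n) [i, 2 * n + k] (r i k) \<otimes>\<^bsub>M\<^esub> cleg (3 * n) [n + j, 2 * n + k] (r j k)) =
        cleg (3 * n) [n + j, 2 * n + k] (r j k) \<otimes>\<^bsub>M\<^esub> (cleg (3 * n) [i, 2 * n + k] (r i k) \<otimes>\<^bsub>M\<^esub> cleg (3 * n) [i, n + j] (r i j))"
      unfolding M_def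
      by (rule mixed_Yang_Baxter) (use kji r_trans[OF kji] in \<open>auto intro: r_cqt\<close>)
    then show "cleg (3 * n) [i, n + j] (r i j) \<otimes>\<^bsub>M\<^esub> (cleg (3 * n) [i, 2 * n + k] (r i k) \<otimes>\<^bsub>M\<^esub> cleg (3 * n) [n + j, 2 * n + k] (r j k)) =
        cleg (3 * n) [n + j, 2 * n + k] (r j k) \<otimes>\<^bsub>M\<^esub> (cleg (3 * n) [i, 2 * n + k] (r i k) \<otimes>\<^bsub>M\<^esub> cleg (3 * n) [i, n + j] (r i j))" .
  qed (auto simp: M_def intro!: cleg_r_closed comm[unfolded M_def])
qed

text \<open>Each of the four functionals is \<open>J\<close> after a word map on three blocks, hence
  the image of a triangular product under one homomorphism \<open>?h\<close>. The equation is then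
  \<open>triangle_exchange\<close> in the convolution monoid of \<open>H^(3n)\<close>.\<close>

lemma J_cocycle:
  assumes t: "t \<in> tspace T 3"
  shows "conv (tensor_power T 3) (J \<circ> mult_id T) (leg T 3 [1, 2] J) t =
    conv (tensor_power T 3) (J \<circ> id_mult T) (leg T 3 [2, 3] J) t"
proof -
  interpret T3: bialgebra "tensor_power T 3" by (rule T.bialgebra_tensor_power)
  let ?M = "conv_monoid (tensor_power H (3 * n))" and ?MT = "conv_monoid (tensor_power T 3)"
  define a b d where "a = (\<lambda>i j. cleg (3 * n) [i, n + j] (r i j))"
    and "b = (\<lambda>i j. cleg (3 * n) [i, 2 * n + j] (r i j))"
    and "d = (\<lambda>i j. cleg (3 * n) [n + i, 2 * n + j] (r i j))"
  interpret X: triangular_exchange ?M n a b d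
    unfolding a_def b_def d_def by (rule triangular_exchange_legs)
  let ?h = "pullback (tensor_power T 3) (flatten H n 3)"
  have h: "?h \<in> hom ?M ?MT" by (rule T3.pullback_hom[OF coalg_map_flatten])
  have w: "disjoint_words 3 [[0, 1], [2]]" "disjoint_words 3 [[0], [1, 2]]"
    "disjoint_words 3 [[0], [1]]" "disjoint_words 3 [[1], [2]]"
    by (auto simp: disjoint_words_def)
  note JH = J_Hom_k
  have Jw: "(\<lambda>t. J (wmap T 3 ws t)) \<in> Hom_k (tensor_power T 3)" if "disjoint_words 3 ws" "length ws = 2" for ws
    using coalg_map_Hom_k[OF T.coalg_map_wmap[OF that(1)], of J] JH that(2) by (simp add: comp_def)
  have leg1: "leg T 3 [1, 2] J t = J (wmap T 3 [[0], [1]] t)" and leg2: "leg T 3 [2, 3] J t = J (wmap T 3 [[1], [2]] t)"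
    if "t \<in> tspace T 3" for t
    using T.leg_eq_wmap[of "[0, 1]" 3 J t] T.leg_eq_wmap[of "[1, 2]" 3 J t] JH that
    by (simp_all add: numeral_2_eq_2 numeral_3_eq_3)
  have mi: "(J \<circ> mult_id T) t = J (wmap T 3 [[0, 1], [2]] t)" and im: "(J \<circ> id_mult T) t = J (wmap T 3 [[0], [1, 2]] t)"
    if "t \<in> tspace T 3" for t
    unfolding comp_def T.mult_id_eq_wmap[OF that] T.id_mult_eq_wmap[OF that] by (rule refl)+
  \<comment> \<open>Convolution depends only on values on the carrier, where each of its two
    arguments agrees with \<open>J\<close> after a word map.\<close>
  have conv_eq: "restrict (conv (tensor_power T 3) f g) (carrier (tensor_power T 3)) =
      restrict (\<lambda>t. J (wmap T 3 ws t)) (tspace T 3) \<otimes>\<^bsub>?MT\<^esub> restrict (\<lambda>t. J (wmap T 3 vs t)) (tspace T 3)"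
    if "\<And>t. t \<in> tspace T 3 \<Longrightarrow> f t = J (wmap T 3 ws t)" "\<And>t. t \<in> tspace T 3 \<Longrightarrow> g t = J (wmap T 3 vs t)"
      "disjoint_words 3 ws" "disjoint_words 3 vs" "length ws = 2" "length vs = 2" for f g ws vs
  proof -
    have "restrict (conv (tensor_power T 3) f g) (carrier (tensor_power T 3)) =
        restrict (conv (tensor_power T 3) (\<lambda>t. J (wmap T 3 ws t)) (\<lambda>t. J (wmap T 3 vs t))) (carrier (tensor_power T 3))"
      using that by (intro restrict_ext T3.conv_cong[symmetric] Jw) auto
    then show ?thesis
      using T3.conv_restrict[OF Jw[OF that(3,5)] Jw[OF that(4,6)]] by (simp del: restrict_apply)
  qed
  have cl: "triangle_prod ?M a n \<in> carrier ?M" "triangle_prod ?M d n \<in> carrier ?M"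
    "triangle_prod ?M (\<lambda>i j. b i j \<otimes>\<^bsub>?M\<^esub> d i j) n \<in> carrier ?M"
    "triangle_prod ?M (\<lambda>i j. b i j \<otimes>\<^bsub>?M\<^esub> a i j) n \<in> carrier ?M"
    by (auto intro!: X.triangle_prod_closed X.m_closed X.a_closed X.b_closed X.d_closed)
  have e_mi: "restrict (\<lambda>t. J (wmap T 3 [[0, 1], [2]] t)) (tspace T 3) = ?h (triangle_prod ?M (\<lambda>i j. b i j \<otimes>\<^bsub>?M\<^esub> d i j) n)"
  proof (subst J_words[OF w(1)], simp, rule arg_cong[where f = ?h], rule triangle_prod_cong)
    fix i j assume ij: "j < i" "i < n"
    have "wpull (3 * n) [[i, n + i], [2 * n + j]] (r i j) = b i j \<otimes>\<^bsub>?M\<^esub> d i j"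
      unfolding b_def d_def by (rule co_quasi_triangular.wpull_mult_left[OF r_cqt[OF ij]]) (use ij in auto)
    then show "wpull (3 * n) [map (\<lambda>l. l * n + i) ([[0, 1], [2]] ! 0), map (\<lambda>l. l * n + j) ([[0, 1], [2]] ! 1)] (r i j) =
        b i j \<otimes>\<^bsub>?M\<^esub> d i j" by simp
  qed
  have e_im: "restrict (\<lambda>t. J (wmap T 3 [[0], [1, 2]] t)) (tspace T 3) = ?h (triangle_prod ?M (\<lambda>i j. b i j \<otimes>\<^bsub>?M\<^esub> a i j) n)"
  proof (subst J_words[OF w(2)], simp, rule arg_cong[where f = ?h], rule triangle_prod_cong)
    fix i j assume ij: "j < i" "i < n"
    have "wpull (3 * n) [[i], [n + j, 2 * n + j]] (r i j) = b i j \<otimes>\<^bsub>?M\<^esub> a i j"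
      unfolding a_def b_def by (rule co_quasi_triangular.wpull_mult_right[OF r_cqt[OF ij]]) (use ij in auto)
    then show "wpull (3 * n) [map (\<lambda>l. l * n + i) ([[0], [1, 2]] ! 0), map (\<lambda>l. l * n + j) ([[0], [1, 2]] ! 1)] (r i j) =
        b i j \<otimes>\<^bsub>?M\<^esub> a i j" by simp
  qed
  have e_1: "restrict (\<lambda>t. J (wmap T 3 [[0], [1]] t)) (tspace T 3) = ?h (triangle_prod ?M a n)"
    by (subst J_words[OF w(3)], simp, rule arg_cong[where f = ?h], rule triangle_prod_cong)
      (simp add: a_def cleg_def)
  have e_2: "restrict (\<lambda>t. J (wmap T 3 [[1], [2]] t)) (tspace T 3) = ?h (triangle_prod ?M d n)"
    by (subst J_words[OF w(4)], simp, rule arg_cong[where f = ?h], rule triangle_prod_cong)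
      (simp add: d_def cleg_def)
  have "restrict (conv (tensor_power T 3) (J \<circ> mult_id T) (leg T 3 [1, 2] J)) (carrier (tensor_power T 3)) =
      ?h (triangle_prod ?M (\<lambda>i j. b i j \<otimes>\<^bsub>?M\<^esub> d i j) n) \<otimes>\<^bsub>?MT\<^esub> ?h (triangle_prod ?M a n)"
    unfolding e_mi[symmetric] e_1[symmetric] by (rule conv_eq[OF mi leg1 w(1,3)]) simp_all
  also have "\<dots> = ?h (triangle_prod ?M (\<lambda>i j. b i j \<otimes>\<^bsub>?M\<^esub> d i j) n \<otimes>\<^bsub>?M\<^esub> triangle_prod ?M a n)"
    by (rule hom_mult[OF h cl(3,1), symmetric])
  also have "\<dots> = ?h (triangle_prod ?M (\<lambda>i j. b i j \<otimes>\<^bsub>?M\<^esub> a i j) n \<otimes>\<^bsub>?M\<^esub> triangle_prod ?M d n)"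
    by (simp only: X.triangle_exchange[OF order_refl])
  also have "\<dots> = ?h (triangle_prod ?M (\<lambda>i j. b i j \<otimes>\<^bsub>?M\<^esub> a i j) n) \<otimes>\<^bsub>?MT\<^esub> ?h (triangle_prod ?M d n)"
    by (rule hom_mult[OF h cl(4,2)])
  also have "\<dots> = restrict (conv (tensor_power T 3) (J \<circ> id_mult T) (leg T 3 [2, 3] J)) (carrier (tensor_power T 3))"
    unfolding e_im[symmetric] e_2[symmetric] by (rule conv_eq[OF im leg2 w(2,4), symmetric]) simp_all
  finally show ?thesis
    using t by (metis restrict_apply' tensor_power_simps(1))
qed

theorem dual_drinfeld_twist_J: "dual_drinfeld_twist T J"
proof (intro dual_drinfeld_twist.intro dual_drinfeld_twist_axioms.intro)
  show "bialgebra T" by (rule T.bialgebra_axioms)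
  show "J \<in> Hom_k (tensor_power T 2)" by (rule J_Hom_k)
  show "conv_invertible (tensor_power T 2) J" by (rule J_invertible)
  fix a assume a: "a \<in> carrier T"
  show "sweedler T (scl T) (\<lambda>a1 a2. scl T (J (pure_tensor T [a1, \<one>\<^bsub>T\<^esub>])) a2) a =
      sweedler T (scl T) (\<lambda>a1 a2. scl T (J (pure_tensor T [a2, \<one>\<^bsub>T\<^esub>])) a1) a"
    using sweedler_counit[OF a J_pure_one(1)] by (simp only:)
  show "sweedler T (scl T) (\<lambda>a1 a2. scl T (J (pure_tensor T [\<one>\<^bsub>T\<^esub>, a1])) a2) a =
      sweedler T (scl T) (\<lambda>a1 a2. scl T (J (pure_tensor T [\<one>\<^bsub>T\<^esub>, a2])) a1) a"
    using sweedler_counit[OF a J_pure_one(2)] by (simp only:)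
qed (rule J_cocycle)

end

section \<open>The defining product of the twist as a triangular product\<close>

lemma (in bialgebra) J_col_triangle:
  assumes r: "\<And>i j. j < i \<Longrightarrow> i < n \<Longrightarrow> R (c (Suc j, Suc i)) \<in> Hom_k (tensor_power B 2)" and n: "0 < n"
  shows "J_col B R n c \<in> Hom_k (tensor_power B (2 * n))"
    and "restrict (J_col B R n c) (tspace B (2 * n)) =
      triangle_prod (conv_monoid (tensor_power B (2 * n))) (\<lambda>i j. cleg (2 * n) [i, n + j] (R (c (Suc j, Suc i)))) n"
proof -
  let ?D = "tensor_power B (2 * n)"
  interpret D: bialgebra ?D by (rule bialgebra_tensor_power)
  interpret M: monoid "conv_monoid ?D" by (rule monoid_conv_tensor_power)
  define L where "L i j = leg B (2 * n) (map Suc [i, n + j]) (R (c (Suc j, Suc i)))" for i j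
  define P where "P i = conv_prod ?D (map (L i) (rev [0..<i]))" for i
  have L: "L i j \<in> Hom_k ?D" "restrict (L i j) (carrier ?D) = cleg (2 * n) [i, n + j] (R (c (Suc j, Suc i)))"
    if "j < i" "i < n" for i j
    using leg_Hom_k[of "[i, n + j]" "2 * n"] restrict_leg[of "[i, n + j]" "2 * n"] r[OF that] that
    unfolding L_def by (simp_all add: numeral_2_eq_2 del: restrict_apply list.map)
  have P: "P i \<in> Hom_k ?D" "restrict (P i) (carrier ?D) =
      row_prod (conv_monoid ?D) (\<lambda>j. cleg (2 * n) [i, n + j] (R (c (Suc j, Suc i)))) i" if i: "i < n" for i
  proof -
    have s: "set (map (L i) (rev [0..<i])) \<subseteq> Hom_k ?D" using L(1) i by auto
    show "P i \<in> Hom_k ?D" unfolding P_def by (rule D.conv_prod_Hom_k[OF s])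
    have "map (\<lambda>f. restrict f (carrier ?D)) (map (L i) (rev [0..<i])) =
        map (\<lambda>j. cleg (2 * n) [i, n + j] (R (c (Suc j, Suc i)))) (rev [0..<i])"
      unfolding map_map comp_def by (rule map_cong[OF refl]) (rule L(2), use i in auto)
    then show "restrict (P i) (carrier ?D) =
      row_prod (conv_monoid ?D) (\<lambda>j. cleg (2 * n) [i, n + j] (R (c (Suc j, Suc i)))) i"
      unfolding P_def D.conv_prod_restrict[OF s] row_prod_def by (simp only:)
  qed
  \<comment> \<open>The rows \<open>2, \<dots>, n\<close> of the definition, and the positions
    inside each row, are lowered by one.\<close>
  have shift: "[2..<n + 1] = map Suc [1..<n]" "rev [1..<Suc i] = map Suc (rev [0..<i])" for i
    by (simp_all add: map_Suc_upt rev_map[symmetric] numeral_2_eq_2)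
  have J: "J_col B R n c = conv_prod ?D (map P [1..<n])"
    unfolding J_col_def shift(1) map_map comp_def P_def L_def shift(2) by simp
  have s: "set (map P [1..<n]) \<subseteq> Hom_k ?D" using P(1) by auto
  show "J_col B R n c \<in> Hom_k ?D" unfolding J by (rule D.conv_prod_Hom_k[OF s])
  have m: "map (\<lambda>f. restrict f (carrier ?D)) (map P [1..<n]) =
      map (\<lambda>i. row_prod (conv_monoid ?D) (\<lambda>j. cleg (2 * n) [i, n + j] (R (c (Suc j, Suc i)))) i) [1..<n]"
    unfolding map_map comp_def by (rule map_cong[OF refl]) (rule P(2), auto)
  \<comment> \<open>After the shift the defining product starts with row \<open>1\<close>; the
    triangular product also has a row \<open>0\<close>, an empty product equal to the unit.\<close>
  have "[0..<n] = 0 # [1..<n]" using n by (simp add: upt_conv_Cons)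
  moreover have "foldr (mult (conv_monoid ?D)) (map (\<lambda>i. row_prod (conv_monoid ?D)
      (\<lambda>j. cleg (2 * n) [i, n + j] (R (c (Suc j, Suc i)))) i) [1..<n]) \<one>\<^bsub>conv_monoid ?D\<^esub> \<in> carrier (conv_monoid ?D)"
    by (rule M.foldr_closed) (auto intro!: M.row_prod_closed cleg_pair_closed r)
  moreover have "restrict (J_col B R n c) (tspace B (2 * n)) = restrict (J_col B R n c) (carrier ?D)"
    by (simp only: tensor_power_simps)
  ultimately show "restrict (J_col B R n c) (tspace B (2 * n)) =
      triangle_prod (conv_monoid ?D) (\<lambda>i j. cleg (2 * n) [i, n + j] (R (c (Suc j, Suc i)))) n"
    unfolding J D.conv_prod_restrict[OF s] m triangle_prod_def by (simp del: upt_Suc)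
qed

theorem theorem5p10:
  fixes H :: "('a::ab_group_add, 'k::field_char_0) bialg"
    and C :: "'c set"
    and R :: "'c \<Rightarrow> ('a, 'k) tens \<Rightarrow> 'k"
    and n :: nat
    and c :: "nat \<times> nat \<Rightarrow> 'c"
  assumes "bialgebra H"
    and "\<And>\<gamma>. \<gamma> \<in> C \<Longrightarrow> co_quasi_triangular H (R \<gamma>)"
    and "2 \<le> n"
    and "\<And>i j. \<lbrakk>1 \<le> i; i < j; j \<le> n\<rbrakk> \<Longrightarrow> c (i, j) \<in> C"
    and "transitive_colouring n c"
  shows "dual_drinfeld_twist (tensor_power H n) (J_col H R n c \<circ> regroup H n)"
proof -
  interpret H: bialgebra H by (rule assms(1))
  have cqt: "co_quasi_triangular H (R (c (Suc j, Suc i)))" if "j < i" "i < n" for i j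
    using that by (intro assms(2,4)) auto
  have Hom: "R (c (Suc j, Suc i)) \<in> Hom_k (tensor_power H 2)" if "j < i" "i < n" for i j
    using co_quasi_triangular.R_linear[OF cqt[OF that]] .
  have n: "0 < n" using assms(3) by simp
  interpret coloured_family H n "\<lambda>i j. R (c (Suc j, Suc i))" "J_col H R n c"
  proof (intro coloured_family.intro coloured_family_axioms.intro H.bialgebra_axioms cqt
      H.J_col_triangle[of n R c, OF Hom n])
    fix i j k assume "k < j" "j < i" "i < n"
    \<comment> \<open>Colours name the smaller index first and the family \<open>r\<close> the
      larger one, which is why the two alternatives trade places.\<close>
    then have "c (Suc k, Suc i) \<in> {c (Suc k, Suc j), c (Suc j, Suc i)}"
      using assms(5) unfolding transitive_colouring_def by simp
    then show "R (c (Suc k, Suc i)) = R (c (Suc j, Suc i)) \<or> R (c (Suc k, Suc i)) = R (c (Suc k, Suc j))"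
      by auto
  qed
  show ?thesis by (rule dual_drinfeld_twist_J)
qed

end
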